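(* Let $i\colon A\to X$ be a long cofibration of directed graphs, and let $f\colon A\to Y$ be any map of directed graphs. Consider their pushout $X\cup_A Y$ in the category $\mathbf{DiGraph}$ of directed graphs, with structure maps $g\colon X\to X\cup_A Y$ and $j\colon Y\to X\cup_A Y$ (so $g\circ i=j\circ f$). Then: (Excision) the map $$g_\ast\colon \mathrm{RH}_\ast(X,A)\to \mathrm{RH}_\ast(X\cup_A Y,Y)$$ is an isomorphism. (Mayer--Vietoris) there is a long exact sequence $$\cdots\to\mathrm{RH}_\ast(A)\xrightarrow{(-i_\ast,\,f_\ast)}\mathrm{RH}_\ast(X)\oplus\mathrm{RH}_\ast(Y)\xrightarrow{g_\ast\oplus j_\ast}\mathrm{RH}_\ast(X\cup_A Y)\xrightarrow{\partial_\ast}\mathrm{RH}_{\ast-1}(A)\to\cdots$$ where $(-i_\ast,f_\ast)(a)=(-i_\ast a,f_\ast a)$ and $(g_\ast\oplus j_\ast)(x,y)=g_\ast x+j_\ast y$.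
   Context: Fix a commutative ring $R$. A directed graph $G$ is a set $V(G)$ of vertices with a set $E(G)\subseteq V(G)\times V(G)$ of directed edges. A map of directed graphs $f\colon G\to H$ is a function $f\colon V(G)\to V(H)$ such that for every edge $(u,v)\in E(G)$ either $f(u)=f(v)$ or $(f(u),f(v))\in E(H)$ (or both). These form the category $\mathbf{DiGraph}$, which has all small limits and colimits, in particular pushouts. A directed path in $G$ from $u$ to $v$ is a tuple $(v_0,\ldots,v_k)$ of vertices with $v_0=u$, $v_k=v$ and, for each $0\le i<k$, $v_i=v_{i+1}$ or $(v_i,v_{i+1})\in E(G)$. "Path" means directed path. Reachability complex: $\mathrm{RC}_\ast(G)$ is the chain complex of $R$-modules which in degree $k$ is freely generated by tuples $(v_0,\ldots,v_k)$ of vertices of $G$ such that adjacent entries are distinct and, for each $1\le j\le k$, there is a path in $G$ from $v_{j-1}$ to $v_j$. The differential is $\partial(v_0,\ldots,v_k)=\sum_{j=0}^k(-1)^j(v_0,\ldots,\widehat{v_j},\ldots,v_k)$, where any term in which adjacent entries coincide is omitted. Reachability homology is $\mathrm{RH}_\ast(G)=H_\ast(\mathrm{RC}_\ast(G))$. A map $f\colon G\to H$ induces a chain map sending $(v_0,\ldots,v_k)$ to $(f(v_0),\ldots,f(v_k))$ if adjacent entries of the latter are distinct and to $0$ otherwise, hence a map $f_\ast$ on homology. For a subgraph $A\subseteq G$, $\mathrm{RC}_\ast(A)$ is a subcomplex of $\mathrm{RC}_\ast(G)$; $\mathrm{RC}_\ast(G,A)=\mathrm{RC}_\ast(G)/\mathrm{RC}_\ast(A)$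 and $\mathrm{RH}_\ast(G,A)=H_\ast(\mathrm{RC}_\ast(G,A))$. In $\mathrm{RH}_\ast(X\cup_A Y,Y)$, $Y$ is regarded as a subgraph of $X\cup_A Y$ via $j$ (which is injective when $i$ is a long cofibration). Long cofibration: for a subgraph $A\subseteq X$, the reach $rA$ is the induced subgraph of $X$ on all vertices that admit a path in $X$ from some vertex of $A$. A long cofibration is an induced subgraph inclusion $A\hookrightarrow X$ such that (1) there are no paths in $X$ from vertices not in $A$ to vertices in $A$; and (2) for each vertex $x\in rA$ there is a vertex $\pi(x)\in A$ such that, for each vertex $a\in A$, $a$ admits a path to $x$ if and only if $a$ admits a path to $\pi(x)$. *)

theory Defs
  imports
    "HOL-Library.Poly_Mapping"
    "HOL-Library.FuncSet"
    "HOL-Algebra.Module"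
    "HOL-Algebra.AbelCoset"
    "Graph_Theory.Pair_Digraph"
    "Graph_Theory.Digraph_Component"
begin

section \<open>Directed graphs, maps and pushouts\<close>

definition digraph_map :: "'v pair_pre_digraph \<Rightarrow> 'w pair_pre_digraph \<Rightarrow> ('v \<Rightarrow> 'w) \<Rightarrow> bool" where
  "digraph_map G H f \<longleftrightarrow> f ` pverts G \<subseteq> pverts H \<and>
     (\<forall>(u, v) \<in> parcs G. f u = f v \<or> (f u, f v) \<in> parcs H)"

definition dipath :: "'v pair_pre_digraph \<Rightarrow> 'v list \<Rightarrow> bool" where
  "dipath G p \<longleftrightarrow> p \<noteq> [] \<and> set p \<subseteq> pverts G \<and> successively (\<lambda>u v. u = v \<or> (u, v) \<in> parcs G) p"

definition has_path :: "'v pair_pre_digraph \<Rightarrow> 'v \<Rightarrow> 'v \<Rightarrow> bool" where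
  "has_path G u v \<longleftrightarrow> (\<exists>p. dipath G p \<and> hd p = u \<and> last p = v)"

definition reach_verts :: "'v pair_pre_digraph \<Rightarrow> 'v pair_pre_digraph \<Rightarrow> 'v set" where
  "reach_verts A X = {x \<in> pverts X. \<exists>a \<in> pverts A. has_path X a x}"

definition long_cofibration :: "'v pair_pre_digraph \<Rightarrow> 'v pair_pre_digraph \<Rightarrow> bool" where
  "long_cofibration A X \<longleftrightarrow>
     induced_subgraph (with_proj A) (with_proj X) \<and>
     (\<forall>x \<in> pverts X - pverts A. \<forall>a \<in> pverts A. \<not> has_path X x a) \<and>
     (\<forall>x \<in> reach_verts A X. \<exists>p \<in> pverts A. \<forall>a \<in> pverts A. has_path X a x \<longleftrightarrow> has_path X a p)"

text \<open>Vertex maps are total functions on the vertex type, so only their values on the vertices of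
  the source graph matter.\<close>

definition is_cocone ::
  "'a pair_pre_digraph \<Rightarrow> 'x pair_pre_digraph \<Rightarrow> 'y pair_pre_digraph \<Rightarrow> ('a \<Rightarrow> 'x) \<Rightarrow> ('a \<Rightarrow> 'y)
   \<Rightarrow> 'h pair_pre_digraph \<Rightarrow> ('x \<Rightarrow> 'h) \<Rightarrow> ('y \<Rightarrow> 'h) \<Rightarrow> bool" where
  "is_cocone A X Y i f H u v \<longleftrightarrow>
     pair_wf_digraph H \<and> digraph_map X H u \<and> digraph_map Y H v \<and> (\<forall>a \<in> pverts A. u (i a) = v (f a))"

definition factors_through ::
  "'x pair_pre_digraph \<Rightarrow> 'y pair_pre_digraph \<Rightarrow> 'p pair_pre_digraph \<Rightarrow> ('x \<Rightarrow> 'p) \<Rightarrow> ('y \<Rightarrow> 'p)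
   \<Rightarrow> 'h pair_pre_digraph \<Rightarrow> ('x \<Rightarrow> 'h) \<Rightarrow> ('y \<Rightarrow> 'h) \<Rightarrow> ('p \<Rightarrow> 'h) \<Rightarrow> bool" where
  "factors_through X Y P g j H u v h \<longleftrightarrow> digraph_map P H h \<and>
     (\<forall>x \<in> pverts X. h (g x) = u x) \<and> (\<forall>y \<in> pverts Y. h (j y) = v y)"

text \<open>HOL cannot quantify over all vertex types inside a formula, so the test graphs \<open>H\<close> live on the
  type of sets of elements of the disjoint union. That type contains the vertex set of the standard
  pushout (a quotient of the disjoint union), and this is enough: the lemma \<open>pushout_universal\<close>
  derives the universal property for test graphs on an arbitrary type.\<close>

definition is_pushout ::
  "'a pair_pre_digraph \<Rightarrow> 'x pair_pre_digraph \<Rightarrow> 'y pair_pre_digraph \<Rightarrow> ('a \<Rightarrow> 'x) \<Rightarrow> ('a \<Rightarrow> 'y)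
   \<Rightarrow> 'p pair_pre_digraph \<Rightarrow> ('x \<Rightarrow> 'p) \<Rightarrow> ('y \<Rightarrow> 'p) \<Rightarrow> bool" where
  "is_pushout A X Y i f P g j \<longleftrightarrow> is_cocone A X Y i f P g j \<and>
     (\<forall>(H :: ('x + 'y) set pair_pre_digraph) u v. is_cocone A X Y i f H u v \<longrightarrow>
        (\<exists>!h. h \<in> extensional (pverts P) \<and> factors_through X Y P g j H u v h))"

text \<open>The standard construction of the pushout, and its universal property.\<close>

definition glue_rel :: "'a pair_pre_digraph \<Rightarrow> ('a \<Rightarrow> 'x) \<Rightarrow> ('a \<Rightarrow> 'y) \<Rightarrow> ('x + 'y) rel" where
  "glue_rel A i f = {(Inl (i a), Inr (f a)) |a. a \<in> pverts A}"

definition glue_class ::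
  "'a pair_pre_digraph \<Rightarrow> ('a \<Rightarrow> 'x) \<Rightarrow> ('a \<Rightarrow> 'y) \<Rightarrow> 'x + 'y \<Rightarrow> ('x + 'y) set" where
  "glue_class A i f z = (glue_rel A i f \<union> (glue_rel A i f)\<inverse>)\<^sup>* `` {z}"

definition glue ::
  "'a pair_pre_digraph \<Rightarrow> 'x pair_pre_digraph \<Rightarrow> 'y pair_pre_digraph \<Rightarrow> ('a \<Rightarrow> 'x) \<Rightarrow> ('a \<Rightarrow> 'y)
   \<Rightarrow> ('x + 'y) set pair_pre_digraph" where
  "glue A X Y i f = (let q = glue_class A i f in
     \<lparr> pverts = q ` (pverts X <+> pverts Y),
       parcs = (\<lambda>(u, v). (q (Inl u), q (Inl v))) ` parcs X \<union> (\<lambda>(u, v). (q (Inr u), q (Inr v))) ` parcs Y \<rparr>)"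

lemma glue_class_self: "z \<in> glue_class A i f z"
  by (simp add: glue_class_def)

lemma glue_class_glued:
  assumes "a \<in> pverts A"
  shows "glue_class A i f (Inl (i a)) = glue_class A i f (Inr (f a))"
proof -
  let ?r = "glue_rel A i f \<union> (glue_rel A i f)\<inverse>"
  have "(Inl (i a), Inr (f a)) \<in> glue_rel A i f"
    using assms by (auto simp: glue_rel_def)
  then have "(Inl (i a), Inr (f a)) \<in> ?r\<^sup>*" "(Inr (f a), Inl (i a)) \<in> ?r\<^sup>*"
    by auto
  then show ?thesis
    unfolding glue_class_def by (auto intro: rtrancl_trans)
qed

lemma glue_class_respects:
  assumes "\<And>a. a \<in> pverts A \<Longrightarrow> u (i a) = v (f a)" and "z' \<in> glue_class A i f z"
  shows "case_sum u v z' = case_sum u v z"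
proof -
  have "(z, z') \<in> (glue_rel A i f \<union> (glue_rel A i f)\<inverse>)\<^sup>*"
    using assms(2) by (simp add: glue_class_def)
  then show ?thesis
    by (induction rule: rtrancl_induct) (auto simp: glue_rel_def assms(1))
qed

lemma glue_cocone:
  assumes "pair_wf_digraph X" "pair_wf_digraph Y"
  shows "is_cocone A X Y i f (glue A X Y i f) (glue_class A i f \<circ> Inl) (glue_class A i f \<circ> Inr)"
proof -
  let ?Q = "glue A X Y i f" and ?q = "glue_class A i f"
  have X: "\<And>u v. (u, v) \<in> parcs X \<Longrightarrow> u \<in> pverts X \<and> v \<in> pverts X"
    and Y: "\<And>u v. (u, v) \<in> parcs Y \<Longrightarrow> u \<in> pverts Y \<and> v \<in> pverts Y"
    using assms by (auto dest: pair_wf_digraph.in_arcsD1 pair_wf_digraph.in_arcsD2)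
  have verts: "\<And>x. x \<in> pverts X \<Longrightarrow> ?q (Inl x) \<in> pverts ?Q"
    "\<And>y. y \<in> pverts Y \<Longrightarrow> ?q (Inr y) \<in> pverts ?Q"
    by (auto simp: glue_def Let_def)
  have arcs: "parcs ?Q = (\<lambda>(u, v). (?q (Inl u), ?q (Inl v))) ` parcs X
      \<union> (\<lambda>(u, v). (?q (Inr u), ?q (Inr v))) ` parcs Y"
    by (simp add: glue_def Let_def)
  have "pair_wf_digraph ?Q"
    unfolding pair_wf_digraph_def arcs using X Y verts by auto
  moreover have "digraph_map X ?Q (?q \<circ> Inl)" "digraph_map Y ?Q (?q \<circ> Inr)"
    unfolding digraph_map_def arcs using verts by (auto intro!: image_eqI)
  ultimately show ?thesis
    by (simp add: is_cocone_def glue_class_glued)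
qed

lemma glue_factors:
  assumes c: "is_cocone A X Y i f H u v"
  shows "\<exists>h. factors_through X Y (glue A X Y i f) (glue_class A i f \<circ> Inl) (glue_class A i f \<circ> Inr) H u v h"
proof -
  let ?Q = "glue A X Y i f" and ?q = "glue_class A i f"
  define h where "h C = case_sum u v (SOME z. z \<in> C)" for C
  have h: "h (?q z) = case_sum u v z" for z
    unfolding h_def
  proof (rule glue_class_respects[where A = A and i = i and f = f])
    show "\<And>a. a \<in> pverts A \<Longrightarrow> u (i a) = v (f a)" using c by (simp add: is_cocone_def)
    show "(SOME z'. z' \<in> ?q z) \<in> ?q z" by (rule someI[of _ z]) (rule glue_class_self)
  qed
  have arcs: "parcs ?Q = (\<lambda>(u, v). (?q (Inl u), ?q (Inl v))) ` parcs X
      \<union> (\<lambda>(u, v). (?q (Inr u), ?q (Inr v))) ` parcs Y"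
    and verts: "pverts ?Q = ?q ` (pverts X <+> pverts Y)"
    by (simp_all add: glue_def Let_def)
  have "digraph_map X H u" "digraph_map Y H v" using c by (auto simp: is_cocone_def)
  then have "digraph_map ?Q H h"
    unfolding digraph_map_def arcs verts by (auto simp: h)
  then have "factors_through X Y ?Q (?q \<circ> Inl) (?q \<circ> Inr) H u v h"
    by (simp add: factors_through_def h)
  then show ?thesis by blast
qed

lemma factors_unique:
  assumes cover: "pverts P \<subseteq> g ` pverts X \<union> j ` pverts Y"
    and "factors_through X Y P g j H u v h" "factors_through X Y P g j H u v h'"
    and "h \<in> extensional (pverts P)" "h' \<in> extensional (pverts P)"
  shows "h = h'"
  using assms by (intro extensionalityI) (auto simp: factors_through_def)

lemma ex1_factor:
  assumes "pverts P \<subseteq> g ` pverts X \<union> j ` pverts Y"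
    and "factors_through X Y P g j H u v (restrict h (pverts P))"
  shows "\<exists>!h. h \<in> extensional (pverts P) \<and> factors_through X Y P g j H u v h"
proof (rule ex1I[of _ "restrict h (pverts P)"])
  show "restrict h (pverts P) \<in> extensional (pverts P) \<and>
      factors_through X Y P g j H u v (restrict h (pverts P))"
    using assms(2) by simp
  show "h' = restrict h (pverts P)"
    if "h' \<in> extensional (pverts P) \<and> factors_through X Y P g j H u v h'" for h'
    by (rule factors_unique[OF assms(1)]) (use that assms(2) in auto)
qed

lemma factors_restrict:
  assumes "factors_through X Y P g j H u v h" "is_cocone A X Y i f P g j"
  shows "factors_through X Y P g j H u v (restrict h (pverts P))"
proof -
  have "pair_wf_digraph P" and im: "g ` pverts X \<subseteq> pverts P" "j ` pverts Y \<subseteq> pverts P"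
    using assms(2) by (auto simp: is_cocone_def digraph_map_def)
  then have "\<And>u v. (u, v) \<in> parcs P \<Longrightarrow> u \<in> pverts P \<and> v \<in> pverts P"
    by (auto dest: pair_wf_digraph.in_arcsD1 pair_wf_digraph.in_arcsD2)
  then have "digraph_map P H (restrict h (pverts P))"
    using assms(1) by (auto simp: factors_through_def digraph_map_def)
  then show ?thesis
    using assms(1) im by (auto simp: factors_through_def image_subset_iff)
qed

lemma pushout_exists:
  fixes X :: "'x pair_pre_digraph" and Y :: "'y pair_pre_digraph"
  assumes "pair_wf_digraph X" "pair_wf_digraph Y"
  shows "is_pushout A X Y i f (glue A X Y i f) (glue_class A i f \<circ> Inl) (glue_class A i f \<circ> Inr)"
  unfolding is_pushout_def
proof (intro conjI allI impI)
  show c: "is_cocone A X Y i f (glue A X Y i f) (glue_class A i f \<circ> Inl) (glue_class A i f \<circ> Inr)"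
    by (rule glue_cocone[OF assms])
  fix H :: "('x + 'y) set pair_pre_digraph" and u v
  assume H: "is_cocone A X Y i f H u v"
  have cover: "pverts (glue A X Y i f)
      \<subseteq> (glue_class A i f \<circ> Inl) ` pverts X \<union> (glue_class A i f \<circ> Inr) ` pverts Y"
    by (auto simp: glue_def Let_def)
  obtain h where "factors_through X Y (glue A X Y i f) (glue_class A i f \<circ> Inl) (glue_class A i f \<circ> Inr) H u v h"
    using glue_factors[OF H] by blast
  from factors_restrict[OF this c]
  show "\<exists>!h. h \<in> extensional (pverts (glue A X Y i f)) \<and>
      factors_through X Y (glue A X Y i f) (glue_class A i f \<circ> Inl) (glue_class A i f \<circ> Inr) H u v h"
    by (rule ex1_factor[OF cover])
qed

lemma pushout_cover:
  fixes X :: "'x pair_pre_digraph" and Y :: "'y pair_pre_digraph"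
  assumes "is_pushout A X Y i f P g j"
  shows "pverts P \<subseteq> g ` pverts X \<union> j ` pverts Y"
proof -
  define H :: "('x + 'y) set pair_pre_digraph" where "H = \<lparr> pverts = UNIV, parcs = UNIV \<rparr>"
  have "is_cocone A X Y i f H (\<lambda>_. {}) (\<lambda>_. {})"
    by (auto simp: is_cocone_def H_def digraph_map_def pair_wf_digraph_def)
  then have ex1: "\<exists>!h. h \<in> extensional (pverts P) \<and> factors_through X Y P g j H (\<lambda>_. {}) (\<lambda>_. {}) h"
    using assms by (auto simp: is_pushout_def)
  define h0 where "h0 = restrict (\<lambda>_. {} :: ('x + 'y) set) (pverts P)"
  define h1 where "h1 = restrict (\<lambda>p. if p \<in> g ` pverts X \<union> j ` pverts Y then {} else UNIV :: ('x + 'y) set) (pverts P)"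
  have im: "g ` pverts X \<subseteq> pverts P" "j ` pverts Y \<subseteq> pverts P"
    using assms by (auto simp: is_pushout_def is_cocone_def digraph_map_def)
  have "factors_through X Y P g j H (\<lambda>_. {}) (\<lambda>_. {}) h0"
    "factors_through X Y P g j H (\<lambda>_. {}) (\<lambda>_. {}) h1"
    using im by (auto simp: factors_through_def digraph_map_def H_def h0_def h1_def)
  moreover have "h0 \<in> extensional (pverts P)" "h1 \<in> extensional (pverts P)"
    by (auto simp: h0_def h1_def)
  ultimately have "h0 = h1" using ex1 by blast
  show ?thesis
  proof
    fix p assume p: "p \<in> pverts P"
    show "p \<in> g ` pverts X \<union> j ` pverts Y"
    proof (rule ccontr)
      assume "p \<notin> g ` pverts X \<union> j ` pverts Y"
      then have "h1 p = UNIV" "h0 p = {}" using p by (auto simp: h0_def h1_def)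
      with \<open>h0 = h1\<close> show False by simp
    qed
  qed
qed

lemma pushout_universal:
  fixes H :: "'h pair_pre_digraph"
  assumes wf: "pair_wf_digraph X" "pair_wf_digraph Y"
    and po: "is_pushout A X Y i f P g j" and H: "is_cocone A X Y i f H u v"
  shows "\<exists>!h. h \<in> extensional (pverts P) \<and> factors_through X Y P g j H u v h"
proof -
  have c: "is_cocone A X Y i f P g j" using po by (simp add: is_pushout_def)
  obtain \<phi> where \<phi>: "factors_through X Y P g j (glue A X Y i f)
      (glue_class A i f \<circ> Inl) (glue_class A i f \<circ> Inr) \<phi>"
    using po glue_cocone[OF wf, of A i f] unfolding is_pushout_def by blast
  obtain \<psi> where \<psi>: "factors_through X Y (glue A X Y i f)
      (glue_class A i f \<circ> Inl) (glue_class A i f \<circ> Inr) H u v \<psi>"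
    using glue_factors[OF H] by blast
  have "factors_through X Y P g j H u v (\<psi> \<circ> \<phi>)"
    unfolding factors_through_def
  proof (intro conjI)
    have "digraph_map P (glue A X Y i f) \<phi>" "digraph_map (glue A X Y i f) H \<psi>"
      using \<phi> \<psi> by (auto simp: factors_through_def)
    then show "digraph_map P H (\<psi> \<circ> \<phi>)"
      by (fastforce simp: digraph_map_def)
  qed (use \<phi> \<psi> in \<open>auto simp: factors_through_def\<close>)
  from factors_restrict[OF this c] show ?thesis
    by (rule ex1_factor[OF pushout_cover[OF po]])
qed

section \<open>Modules and homology\<close>

text \<open>Modules are records of HOL-Algebra whose scalars are all elements of the type \<open>'r\<close>. The fields
  \<^const>\<open>monoid.mult\<close> and \<^const>\<open>one\<close>, inherited from the ring record, play no role for modules.\<close>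

definition module_hom :: "('r, 'm) module \<Rightarrow> ('r, 'n) module \<Rightarrow> ('m \<Rightarrow> 'n) set" where
  "module_hom M N = {h \<in> hom (add_monoid M) (add_monoid N).
     \<forall>r. \<forall>x \<in> carrier M. h (r \<odot>\<^bsub>M\<^esub> x) = r \<odot>\<^bsub>N\<^esub> h x}"

definition module_iso :: "('r, 'm) module \<Rightarrow> ('r, 'n) module \<Rightarrow> ('m \<Rightarrow> 'n) set" where
  "module_iso M N = {h \<in> module_hom M N. bij_betw h (carrier M) (carrier N)}"

definition module_prod :: "('r, 'm) module \<Rightarrow> ('r, 'n) module \<Rightarrow> ('r, 'm \<times> 'n) module" where
  "module_prod M N = \<lparr> carrier = carrier M \<times> carrier N, monoid.mult = undefined, one = undefined,
     zero = (\<zero>\<^bsub>M\<^esub>, \<zero>\<^bsub>N\<^esub>),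
     add = (\<lambda>(x, y) (x', y'). (x \<oplus>\<^bsub>M\<^esub> x', y \<oplus>\<^bsub>N\<^esub> y')),
     smult = (\<lambda>r (x, y). (r \<odot>\<^bsub>M\<^esub> x, r \<odot>\<^bsub>N\<^esub> y)) \<rparr>"

definition exact_at ::
  "('r, 'l) module \<Rightarrow> ('l \<Rightarrow> 'm) \<Rightarrow> ('r, 'm) module \<Rightarrow> ('m \<Rightarrow> 'n) \<Rightarrow> ('r, 'n) module \<Rightarrow> bool" where
  "exact_at L f M g N \<longleftrightarrow> f \<in> module_hom L M \<and> g \<in> module_hom M N \<and> f ` carrier L = a_kernel M N g"

text \<open>On cosets, \<open>r \<cdot> (N + x) = N + r \<cdot> x\<close>; the right-hand side is the sum of the set \<open>r \<cdot> (N + x)\<close> with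
  \<open>N\<close>. Likewise a linear map \<open>\<phi>\<close> into \<open>M\<close> that respects the submodules being factored out sends a coset
  \<open>C\<close> to the coset \<open>\<phi> ` C + N\<close>.\<close>

definition quot_module :: "('r, 'm) module \<Rightarrow> 'm set \<Rightarrow> ('r, 'm set) module" where
  "quot_module M N = \<lparr> carrier = a_rcosets\<^bsub>M\<^esub> N, monoid.mult = undefined, one = undefined,
     zero = N, add = (\<lambda>C D. C <+>\<^bsub>M\<^esub> D), smult = (\<lambda>r C. ((\<lambda>x. r \<odot>\<^bsub>M\<^esub> x) ` C) <+>\<^bsub>M\<^esub> N) \<rparr>"

definition quot_map :: "('r, 'm) module \<Rightarrow> 'm set \<Rightarrow> ('l \<Rightarrow> 'm) \<Rightarrow> 'l set \<Rightarrow> 'm set" where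
  "quot_map M N \<phi> C = (\<phi> ` C) <+>\<^bsub>M\<^esub> N"

text \<open>The map \<open>chain_diff C k\<close> goes from degree \<open>k\<close> to degree \<open>k - 1\<close>.\<close>

record ('r, 'm) chain_complex =
  chain_mod :: "int \<Rightarrow> ('r, 'm) module"
  chain_diff :: "int \<Rightarrow> 'm \<Rightarrow> 'm"

definition cycles :: "('r, 'm) chain_complex \<Rightarrow> int \<Rightarrow> 'm set" where
  "cycles C k = a_kernel (chain_mod C k) (chain_mod C (k - 1)) (chain_diff C k)"

definition boundaries :: "('r, 'm) chain_complex \<Rightarrow> int \<Rightarrow> 'm set" where
  "boundaries C k = chain_diff C (k + 1) ` carrier (chain_mod C (k + 1))"

definition homology :: "('r, 'm) chain_complex \<Rightarrow> int \<Rightarrow> ('r, 'm set) module" where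
  "homology C k = quot_module (chain_mod C k \<lparr> carrier := cycles C k \<rparr>) (boundaries C k)"

text \<open>The map on homology induced by a chain map \<open>\<phi>\<close> with target \<open>D\<close>.\<close>

definition homology_map ::
  "('r, 'n) chain_complex \<Rightarrow> (int \<Rightarrow> 'm \<Rightarrow> 'n) \<Rightarrow> int \<Rightarrow> 'm set \<Rightarrow> 'n set" where
  "homology_map D \<phi> k = quot_map (chain_mod D k) (boundaries D k) (\<phi> k)"

definition quot_complex ::
  "('r, 'm) chain_complex \<Rightarrow> (int \<Rightarrow> 'm set) \<Rightarrow> ('r, 'm set) chain_complex" where
  "quot_complex C N = \<lparr> chain_mod = (\<lambda>k. quot_module (chain_mod C k) (N k)),
     chain_diff = (\<lambda>k. quot_map (chain_mod C (k - 1)) (N (k - 1)) (chain_diff C k)) \<rparr>"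

section \<open>Reachability homology\<close>

text \<open>The sort \<open>{comm_ring, comm_monoid_mult}\<close> is \<^class>\<open>comm_ring_1\<close> without the axiom \<open>0 \<noteq> 1\<close>, so
  the zero ring is allowed. The argument \<open>R\<close> below only fixes the coefficient type.\<close>

definition free_module ::
  "'r::{comm_ring, comm_monoid_mult} itself \<Rightarrow> 'b set \<Rightarrow> ('r, 'b \<Rightarrow>\<^sub>0 'r) module" where
  "free_module R B = \<lparr> carrier = {c. Poly_Mapping.keys c \<subseteq> B}, monoid.mult = undefined, one = undefined,
     zero = 0, add = (+), smult = (\<lambda>r. Poly_Mapping.map ((*) r)) \<rparr>"

definition rc_tuples :: "'v pair_pre_digraph \<Rightarrow> int \<Rightarrow> 'v list set" where
  "rc_tuples G k = {v. v \<noteq> [] \<and> int (length v) = k + 1 \<and> set v \<subseteq> pverts G \<and>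
     distinct_adj v \<and> successively (has_path G) v}"

definition omit_nth :: "nat \<Rightarrow> 'v list \<Rightarrow> 'v list" where
  "omit_nth j v = take j v @ drop (Suc j) v"

text \<open>The empty face of a \<open>0\<close>-tuple is omitted as well, since the complex is zero in degree \<open>-1\<close>.\<close>

definition rc_boundary :: "('v list \<Rightarrow>\<^sub>0 'r::{comm_ring, comm_monoid_mult}) \<Rightarrow> 'v list \<Rightarrow>\<^sub>0 'r" where
  "rc_boundary c = (\<Sum>v \<in> Poly_Mapping.keys c. \<Sum>j<length v.
     if omit_nth j v \<noteq> [] \<and> distinct_adj (omit_nth j v)
     then Poly_Mapping.single (omit_nth j v) ((-1) ^ j * Poly_Mapping.lookup c v) else 0)"

definition rc_map ::
  "('v \<Rightarrow> 'w) \<Rightarrow> ('v list \<Rightarrow>\<^sub>0 'r::{comm_ring, comm_monoid_mult}) \<Rightarrow> 'w list \<Rightarrow>\<^sub>0 'r" where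
  "rc_map f c = (\<Sum>v \<in> Poly_Mapping.keys c.
     if distinct_adj (map f v) then Poly_Mapping.single (map f v) (Poly_Mapping.lookup c v) else 0)"

definition RC ::
  "'r::{comm_ring, comm_monoid_mult} itself \<Rightarrow> 'v pair_pre_digraph
   \<Rightarrow> ('r, 'v list \<Rightarrow>\<^sub>0 'r) chain_complex" where
  "RC R G = \<lparr> chain_mod = (\<lambda>k. free_module R (rc_tuples G k)), chain_diff = (\<lambda>k. rc_boundary) \<rparr>"

definition RH ::
  "'r::{comm_ring, comm_monoid_mult} itself \<Rightarrow> 'v pair_pre_digraph
   \<Rightarrow> int \<Rightarrow> ('r, ('v list \<Rightarrow>\<^sub>0 'r) set) module" where
  "RH R G = homology (RC R G)"

text \<open>For a map \<open>f\<close> into \<open>H\<close>; the source graph does not enter the formula.\<close>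

definition RH_map ::
  "'r::{comm_ring, comm_monoid_mult} itself \<Rightarrow> 'w pair_pre_digraph \<Rightarrow> ('v \<Rightarrow> 'w)
   \<Rightarrow> int \<Rightarrow> ('v list \<Rightarrow>\<^sub>0 'r) set \<Rightarrow> ('w list \<Rightarrow>\<^sub>0 'r) set" where
  "RH_map R H f = homology_map (RC R H) (\<lambda>k. rc_map f)"

definition RC_sub ::
  "'r::{comm_ring, comm_monoid_mult} itself \<Rightarrow> 'v pair_pre_digraph \<Rightarrow> int \<Rightarrow> ('v list \<Rightarrow>\<^sub>0 'r) set" where
  "RC_sub R A k = carrier (chain_mod (RC R A) k)"

definition RC_rel ::
  "'r::{comm_ring, comm_monoid_mult} itself \<Rightarrow> 'v pair_pre_digraph \<Rightarrow> 'v pair_pre_digraph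
   \<Rightarrow> ('r, ('v list \<Rightarrow>\<^sub>0 'r) set) chain_complex" where
  "RC_rel R G A = quot_complex (RC R G) (RC_sub R A)"

definition RH_rel ::
  "'r::{comm_ring, comm_monoid_mult} itself \<Rightarrow> 'v pair_pre_digraph \<Rightarrow> 'v pair_pre_digraph
   \<Rightarrow> int \<Rightarrow> ('r, ('v list \<Rightarrow>\<^sub>0 'r) set set) module" where
  "RH_rel R G A = homology (RC_rel R G A)"

text \<open>For a map \<open>f\<close> of pairs into \<open>(H, B)\<close>.\<close>

definition RH_rel_map ::
  "'r::{comm_ring, comm_monoid_mult} itself \<Rightarrow> 'w pair_pre_digraph \<Rightarrow> 'w pair_pre_digraph \<Rightarrow> ('v \<Rightarrow> 'w)
   \<Rightarrow> int \<Rightarrow> ('v list \<Rightarrow>\<^sub>0 'r) set set \<Rightarrow> ('w list \<Rightarrow>\<^sub>0 'r) set set" where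
  "RH_rel_map R H B f = homology_map (RC_rel R H B)
     (\<lambda>k. quot_map (chain_mod (RC R H) k) (RC_sub R B k) (rc_map f))"

text \<open>The copy of a graph inside another under a vertex-injective map. A loop of \<open>G\<close> stays a loop of the
  image even where the ambient graph has none there; loops do not affect the existence of
  paths, so the chain groups are the same.\<close>

definition image_graph :: "('v \<Rightarrow> 'w) \<Rightarrow> 'v pair_pre_digraph \<Rightarrow> 'w pair_pre_digraph" where
  "image_graph j G = \<lparr> pverts = j ` pverts G, parcs = (\<lambda>(u, v). (j u, j v)) ` parcs G \<rparr>"

end

theory Submission
  imports Defs
begin

text \<open>
  Write \<open>\<rho>\<close> for the map of the reach \<open>rA\<close> to \<open>A\<close> that is \<open>\<pi>\<close> off \<open>A\<close> and the identity on \<open>A\<close>. It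
  preserves reachability and there is a path from \<open>\<rho> x\<close> to \<open>x\<close>, so the prism operator makes \<open>RC(A)\<close> a
  deformation retract of \<open>RC(rA)\<close>. Reachability in the pushout \<open>P\<close> can be computed: nothing returns to \<open>Y\<close>,
  reachability inside \<open>Y\<close> and inside \<open>X - A\<close> is unchanged, and \<open>y\<close> reaches \<open>x \<in> X - A\<close> iff \<open>x \<in> rA\<close> and
  \<open>y\<close> reaches \<open>f (\<pi> x)\<close>. Hence \<open>Y\<close> sits in \<open>P\<close> in the same way as \<open>A\<close> in \<open>X\<close>, and \<open>RC(Y)\<close> is a
  deformation retract of \<open>RC(rY)\<close>. Excision follows because \<open>RC(X, rA)\<close> and \<open>RC(P, rY)\<close> have the same
  basis, the tuples that start outside the reach. Mayer--Vietoris is a formal consequence of excision and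
  of the injectivity of \<open>RC(A) \<rightarrow> RC(X)\<close> and \<open>RC(Y) \<rightarrow> RC(P)\<close>.
\<close>

text \<open>The exact sequence cannot be taken from a short exact sequence of chain complexes: the
  images of \<open>RC(X)\<close> and \<open>RC(Y)\<close> need not span \<open>RC(P)\<close>, since
  a tuple \<open>(j y, g x)\<close> with \<open>y\<close> outside the image of \<open>f\<close> and
  \<open>x\<close> in \<open>X - A\<close> comes from neither. Nor need \<open>g\<close> be
  injective on \<open>A\<close>. What makes a comparison possible is the direction of paths. The
  reach is closed under going forward and \<open>A\<close> under going backward, so the first entry
  of a tuple decides: the tuple lies wholly in the reach, or it avoids \<open>A\<close> altogether.
  On tuples of the second kind \<open>g\<close> is injective and reflects paths; those of the first
  kind are deformed into \<open>A\<close>. The second condition on a long cofibration says that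
  \<open>\<pi>\<close> is right adjoint to the inclusion of \<open>A\<close> into its reach, for the
  preorder of reachability, and an adjunction of preorders yields a chain homotopy. Excision is
  first proved on representatives. Its two halves become assumptions of an abstract square of
  complexes, from which the isomorphism and the exact sequence are both obtained.\<close>

section \<open>Quotient modules\<close>

text \<open>Homology only uses these of the module axioms, and they pass to quotients without reference to a
  ring structure on the scalars.\<close>

locale scaled_group = abelian_group M for M :: "('r, 'm) module" (structure) +
  assumes smult_closed [simp]: "x \<in> carrier M \<Longrightarrow> r \<odot> x \<in> carrier M"
    and smult_add: "x \<in> carrier M \<Longrightarrow> y \<in> carrier M \<Longrightarrow> r \<odot> (x \<oplus> y) = r \<odot> x \<oplus> r \<odot> y"

definition scaled_subgroup :: "'m set \<Rightarrow> ('r, 'm) module \<Rightarrow> bool" where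
  "scaled_subgroup N M \<longleftrightarrow> additive_subgroup N M \<and> (\<forall>r. \<forall>x \<in> N. r \<odot>\<^bsub>M\<^esub> x \<in> N)"

lemma module_homD:
  assumes "h \<in> module_hom M N"
  shows "x \<in> carrier M \<Longrightarrow> h x \<in> carrier N"
    and "x \<in> carrier M \<Longrightarrow> y \<in> carrier M \<Longrightarrow> h (x \<oplus>\<^bsub>M\<^esub> y) = h x \<oplus>\<^bsub>N\<^esub> h y"
    and "x \<in> carrier M \<Longrightarrow> h (r \<odot>\<^bsub>M\<^esub> x) = r \<odot>\<^bsub>N\<^esub> h x"
  using assms by (auto simp: module_hom_def hom_def)

lemma module_homI:
  assumes "\<And>x. x \<in> carrier M \<Longrightarrow> h x \<in> carrier N"
    and "\<And>x y. x \<in> carrier M \<Longrightarrow> y \<in> carrier M \<Longrightarrow> h (x \<oplus>\<^bsub>M\<^esub> y) = h x \<oplus>\<^bsub>N\<^esub> h y"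
    and "\<And>r x. x \<in> carrier M \<Longrightarrow> h (r \<odot>\<^bsub>M\<^esub> x) = r \<odot>\<^bsub>N\<^esub> h x"
  shows "h \<in> module_hom M N"
  using assms by (auto simp: module_hom_def hom_def)

lemma module_hom_group_hom:
  assumes "h \<in> module_hom M N" "abelian_group M" "abelian_group N"
  shows "abelian_group_hom M N h"
  using assms
  by (intro abelian_group_homI group_hom.intro group_hom_axioms.intro)
     (auto simp: module_hom_def abelian_group.a_group)

lemma module_hom_zero:
  assumes "h \<in> module_hom M N" "abelian_group M" "abelian_group N"
  shows "h \<zero>\<^bsub>M\<^esub> = \<zero>\<^bsub>N\<^esub>"
proof -
  interpret abelian_group_hom M N h by (rule module_hom_group_hom[OF assms(1-3)])
  show ?thesis by simp
qed

lemma scaled_subgroup_abelian: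
  assumes "scaled_subgroup N M" "abelian_group M"
  shows "abelian_subgroup N M"
  using assms by (auto simp: scaled_subgroup_def intro: abelian_subgroupI3)

context
  fixes M :: "('r, 'm) module" and N
  assumes M: "scaled_group M" and N: "scaled_subgroup N M"
begin

interpretation scaled_group M by (rule M)
interpretation abelian_subgroup N M by (rule scaled_subgroup_abelian[OF N]) unfold_locales

lemma scaled_subgroup_smult: "x \<in> N \<Longrightarrow> r \<odot>\<^bsub>M\<^esub> x \<in> N"
  using N by (auto simp: scaled_subgroup_def)

lemma quot_module_carrier: "carrier (quot_module M N) = {N +>\<^bsub>M\<^esub> x |x. x \<in> carrier M}"
  by (auto simp: quot_module_def A_RCOSETS_def')

lemma quot_module_eq_iff:
  assumes "x \<in> carrier M" "y \<in> carrier M"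
  shows "N +>\<^bsub>M\<^esub> x = N +>\<^bsub>M\<^esub> y \<longleftrightarrow> x \<ominus>\<^bsub>M\<^esub> y \<in> N"
  using assms a_rcos_module[of y x] a_repr_independence'[of x y] a_rcos_self[of x]
  by (auto simp: a_minus_def)

lemma quot_module_eqI:
  assumes "x \<in> carrier M" "y \<in> carrier M" "n \<in> N" "x = n \<oplus>\<^bsub>M\<^esub> y"
  shows "N +>\<^bsub>M\<^esub> x = N +>\<^bsub>M\<^esub> y"
  using assms by (simp add: quot_module_eq_iff a_minus_def a_assoc r_neg)

lemma quot_module_eqD:
  assumes "x \<in> carrier M" "y \<in> carrier M" "N +>\<^bsub>M\<^esub> x = N +>\<^bsub>M\<^esub> y"
  shows "\<exists>n \<in> N. x = n \<oplus>\<^bsub>M\<^esub> y"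
  using assms by (intro bexI[of _ "x \<ominus>\<^bsub>M\<^esub> y"]) (auto simp: quot_module_eq_iff a_minus_def a_assoc l_neg)

text \<open>All computations in quotients go through representatives by this formula. Only
  additivity of \<open>\<phi>\<close> is required, so that the action of a scalar can be taken for
  \<open>\<phi>\<close>; this is how \<open>quot_module_smult\<close> is obtained.\<close>

lemma quot_map_coset:
  assumes \<phi>: "\<phi> \<in> hom (add_monoid L) (add_monoid M)"
    and K: "additive_subgroup K L" "\<phi> ` K \<subseteq> N" and x: "x \<in> carrier L"
  shows "quot_map M N \<phi> (K +>\<^bsub>L\<^esub> x) = N +>\<^bsub>M\<^esub> \<phi> x"
proof -
  interpret K: additive_subgroup K L by (rule K)
  have \<phi>x: "\<phi> x \<in> carrier M" using \<phi> x by (auto simp: hom_def)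
  have \<phi>K: "\<phi> k \<in> N" if "k \<in> K" for k using K(2) that by blast
  have \<phi>_add: "\<phi> (k \<oplus>\<^bsub>L\<^esub> x) = \<phi> k \<oplus>\<^bsub>M\<^esub> \<phi> x" if "k \<in> K" for k
    using \<phi> K.a_Hcarr[OF that] x by (auto simp: hom_def)
  have "quot_map M N \<phi> (K +>\<^bsub>L\<^esub> x) = {\<phi> (k \<oplus>\<^bsub>L\<^esub> x) \<oplus>\<^bsub>M\<^esub> n |k n. k \<in> K \<and> n \<in> N}"
    unfolding quot_map_def set_add_def' a_r_coset_def' by blast
  also have "\<dots> = {n \<oplus>\<^bsub>M\<^esub> \<phi> x |n. n \<in> N}"
  proof (intro equalityI subsetI)
    fix z assume "z \<in> {\<phi> (k \<oplus>\<^bsub>L\<^esub> x) \<oplus>\<^bsub>M\<^esub> n |k n. k \<in> K \<and> n \<in> N}"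
    then obtain k n where kn: "k \<in> K" "n \<in> N" "z = \<phi> (k \<oplus>\<^bsub>L\<^esub> x) \<oplus>\<^bsub>M\<^esub> n" by blast
    then have "z = (\<phi> k \<oplus>\<^bsub>M\<^esub> n) \<oplus>\<^bsub>M\<^esub> \<phi> x"
      using \<phi>x \<phi>K[of k] by (simp add: \<phi>_add a_ac)
    then show "z \<in> {n \<oplus>\<^bsub>M\<^esub> \<phi> x |n. n \<in> N}" using kn \<phi>K by blast
  next
    fix z assume "z \<in> {n \<oplus>\<^bsub>M\<^esub> \<phi> x |n. n \<in> N}"
    then obtain n where n: "n \<in> N" "z = n \<oplus>\<^bsub>M\<^esub> \<phi> x" by blast
    \<comment> \<open>\<open>L\<close> is not assumed to be a group, so \<open>\<phi>\<close> is not
      known to preserve zero; the error \<open>\<phi> \<zero>\<close> lies in \<open>N\<close> and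
      is subtracted.\<close>
    have z: "\<phi> \<zero>\<^bsub>L\<^esub> \<in> N" using \<phi>K K.zero_closed by blast
    then have c: "\<phi> \<zero>\<^bsub>L\<^esub> \<in> carrier M" "n \<in> carrier M" using n by auto
    then have "\<phi> (\<zero>\<^bsub>L\<^esub> \<oplus>\<^bsub>L\<^esub> x) \<oplus>\<^bsub>M\<^esub> (n \<ominus>\<^bsub>M\<^esub> \<phi> \<zero>\<^bsub>L\<^esub>)
        = (n \<oplus>\<^bsub>M\<^esub> \<phi> x) \<oplus>\<^bsub>M\<^esub> (\<phi> \<zero>\<^bsub>L\<^esub> \<ominus>\<^bsub>M\<^esub> \<phi> \<zero>\<^bsub>L\<^esub>)"
      using \<phi>x by (simp add: \<phi>_add K.zero_closed a_minus_def a_ac)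
    then have "z = \<phi> (\<zero>\<^bsub>L\<^esub> \<oplus>\<^bsub>L\<^esub> x) \<oplus>\<^bsub>M\<^esub> (n \<ominus>\<^bsub>M\<^esub> \<phi> \<zero>\<^bsub>L\<^esub>)"
      using c n \<phi>x by (simp add: a_minus_def r_neg)
    moreover have "n \<ominus>\<^bsub>M\<^esub> \<phi> \<zero>\<^bsub>L\<^esub> \<in> N" using z n by (simp add: a_minus_def)
    ultimately show "z \<in> {\<phi> (k \<oplus>\<^bsub>L\<^esub> x) \<oplus>\<^bsub>M\<^esub> n |k n. k \<in> K \<and> n \<in> N}"
      using K.zero_closed by blast
  qed
  finally show ?thesis by (auto simp: a_r_coset_def')
qed

lemma quot_module_add:
  assumes "x \<in> carrier M" "y \<in> carrier M"
  shows "(N +>\<^bsub>M\<^esub> x) \<oplus>\<^bsub>quot_module M N\<^esub> (N +>\<^bsub>M\<^esub> y) = N +>\<^bsub>M\<^esub> (x \<oplus>\<^bsub>M\<^esub> y)"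
  using a_rcos_sum[OF assms] by (simp add: quot_module_def)

lemma quot_module_smult:
  assumes "x \<in> carrier M"
  shows "r \<odot>\<^bsub>quot_module M N\<^esub> (N +>\<^bsub>M\<^esub> x) = N +>\<^bsub>M\<^esub> (r \<odot>\<^bsub>M\<^esub> x)"
  using quot_map_coset[of "\<lambda>x. r \<odot>\<^bsub>M\<^esub> x" M N x] assms scaled_subgroup_smult is_additive_subgroup
  by (auto simp: quot_module_def quot_map_def hom_def smult_add)

lemma quot_module_zero: "\<zero>\<^bsub>quot_module M N\<^esub> = N"
  by (simp add: quot_module_def)

lemma quot_module_coset_self: "x \<in> N \<Longrightarrow> N +>\<^bsub>M\<^esub> x = N"
  by (rule a_rcos_const)

lemma quot_module_coset_zero: "N +>\<^bsub>M\<^esub> \<zero>\<^bsub>M\<^esub> = N"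
  by (simp add: quot_module_coset_self)

lemma scaled_group_quot_module: "scaled_group (quot_module M N)"
proof (rule scaled_group.intro)
  show "abelian_group (quot_module M N)"
  proof (rule abelian_groupI)
    show "\<exists>y \<in> carrier (quot_module M N). y \<oplus>\<^bsub>quot_module M N\<^esub> x = \<zero>\<^bsub>quot_module M N\<^esub>"
      if x: "x \<in> carrier (quot_module M N)" for x
    proof -
      obtain z where z: "z \<in> carrier M" "x = N +>\<^bsub>M\<^esub> z" using x by (auto simp: quot_module_carrier)
      then have "(N +>\<^bsub>M\<^esub> (\<ominus>\<^bsub>M\<^esub> z)) \<oplus>\<^bsub>quot_module M N\<^esub> x = \<zero>\<^bsub>quot_module M N\<^esub>"
        by (simp add: quot_module_add quot_module_zero l_neg quot_module_coset_zero)
      then show ?thesis using z by (auto simp: quot_module_carrier)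
    qed
    show "\<zero>\<^bsub>quot_module M N\<^esub> \<in> carrier (quot_module M N)"
      unfolding quot_module_zero quot_module_carrier using quot_module_coset_zero[symmetric] by blast
    show "\<zero>\<^bsub>quot_module M N\<^esub> \<oplus>\<^bsub>quot_module M N\<^esub> x = x" if "x \<in> carrier (quot_module M N)" for x
      using that quot_module_add[of "\<zero>\<^bsub>M\<^esub>"]
      by (auto simp: quot_module_carrier quot_module_zero quot_module_coset_zero)
  qed (auto simp: quot_module_carrier quot_module_add a_ac)
  show "scaled_group_axioms (quot_module M N)"
    by unfold_locales
      (auto simp: quot_module_carrier quot_module_smult quot_module_add smult_add)
qed

end

lemma quot_map_hom:
  assumes L: "scaled_group L" "scaled_subgroup K L" and M: "scaled_group M" "scaled_subgroup N M"
    and \<phi>: "\<phi> \<in> module_hom L M" "\<phi> ` K \<subseteq> N"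
  shows "quot_map M N \<phi> \<in> module_hom (quot_module L K) (quot_module M N)"
proof -
  interpret L: scaled_group L by (rule L)
  have K: "additive_subgroup K L" using L(2) by (simp add: scaled_subgroup_def)
  have *: "quot_map M N \<phi> (K +>\<^bsub>L\<^esub> x) = N +>\<^bsub>M\<^esub> \<phi> x" if "x \<in> carrier L" for x
    using \<phi>(1) by (intro quot_map_coset[OF M _ K \<phi>(2) that]) (simp add: module_hom_def)
  show ?thesis
    by (rule module_homI)
      (auto simp: quot_module_carrier[OF L] quot_module_carrier[OF M] * quot_module_add[OF L]
        quot_module_add[OF M] quot_module_smult[OF L] quot_module_smult[OF M] module_homD[OF \<phi>(1)])
qed

lemma scaled_group_subgroup:
  assumes M: "scaled_group M" and Z: "scaled_subgroup Z M"
  shows "scaled_group (M\<lparr>carrier := Z\<rparr>)"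
proof -
  interpret scaled_group M by (rule M)
  interpret abelian_subgroup Z M by (rule scaled_subgroup_abelian[OF Z]) unfold_locales
  have "Z \<subseteq> carrier M" by auto
  have Zs: "r \<odot>\<^bsub>M\<^esub> x \<in> Z" if "x \<in> Z" for r x using Z that by (auto simp: scaled_subgroup_def)
  show ?thesis
  proof (rule scaled_group.intro)
    show "abelian_group (M\<lparr>carrier := Z\<rparr>)"
    proof (rule abelian_groupI)
      show "\<exists>y \<in> carrier (M\<lparr>carrier := Z\<rparr>). y \<oplus>\<^bsub>M\<lparr>carrier := Z\<rparr>\<^esub> x = \<zero>\<^bsub>M\<lparr>carrier := Z\<rparr>\<^esub>"
        if "x \<in> carrier (M\<lparr>carrier := Z\<rparr>)" for x
        using that by (intro bexI[of _ "\<ominus>\<^bsub>M\<^esub> x"]) (auto simp: l_neg)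
    qed (auto simp: a_ac)
    show "scaled_group_axioms (M\<lparr>carrier := Z\<rparr>)"
      by unfold_locales (auto simp: Zs smult_add)
  qed
qed

lemma scaled_subgroup_mono:
  assumes M: "scaled_group M" and "scaled_subgroup Z M" "scaled_subgroup N M" "N \<subseteq> Z"
  shows "scaled_subgroup N (M\<lparr>carrier := Z\<rparr>)"
proof -
  interpret scaled_group M by (rule M)
  have "subgroup N (add_monoid M\<lparr>carrier := Z\<rparr>)"
    using assms by (intro add.subgroup_incl) (auto simp: scaled_subgroup_def additive_subgroup_def)
  then show ?thesis
    using assms(3) by (auto simp: scaled_subgroup_def additive_subgroup_def)
qed

text \<open>Homology is a quotient of the record whose carrier is cut down to the cycles; as sets,
  its classes are cosets in the full chain module, which is what \<open>hclass\<close>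
  writes.\<close>

lemma a_r_coset_restrict [simp]: "N +>\<^bsub>M\<lparr>carrier := Z\<rparr>\<^esub> x = N +>\<^bsub>M\<^esub> x"
  by (simp add: a_r_coset_def')

lemma scaled_subgroup_kernel:
  assumes "scaled_group L" "scaled_group M" "h \<in> module_hom L M"
  shows "scaled_subgroup (a_kernel L M h) L"
proof -
  interpret L: scaled_group L by (rule assms)
  interpret M: scaled_group M by (rule assms)
  interpret abelian_group_hom L M h
    by (rule module_hom_group_hom[OF assms(3)]) unfold_locales
  \<comment> \<open>Obtained by cancelling in \<open>r 0 + r 0 = r 0\<close>, which is additivity of
    the action.\<close>
  have "r \<odot>\<^bsub>M\<^esub> \<zero>\<^bsub>M\<^esub> = \<zero>\<^bsub>M\<^esub>" for r
    using M.smult_add[of "\<zero>\<^bsub>M\<^esub>" "\<zero>\<^bsub>M\<^esub>" r] M.smult_closed[of "\<zero>\<^bsub>M\<^esub>" r]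
    by (metis M.add.r_cancel_one M.l_zero M.zero_closed)
  then show ?thesis
    using additive_subgroup_a_kernel
    by (auto simp: scaled_subgroup_def a_kernel_def' module_homD[OF assms(3)])
qed

lemma scaled_subgroup_image:
  assumes "scaled_group L" "scaled_group M" "h \<in> module_hom L M" "scaled_subgroup K L"
  shows "scaled_subgroup (h ` K) M"
proof -
  interpret L: scaled_group L by (rule assms)
  interpret M: scaled_group M by (rule assms)
  interpret abelian_group_hom L M h
    by (rule module_hom_group_hom[OF assms(3)]) unfold_locales
  interpret K: additive_subgroup K L using assms(4) by (simp add: scaled_subgroup_def)
  have "additive_subgroup (h ` K) M"
    using a_group_hom K.a_subgroup group_hom.subgroup_img_is_subgroup
    by (auto simp: additive_subgroup_def)
  then show ?thesis
    using assms(4) by (auto simp: scaled_subgroup_def module_homD(3)[OF assms(3), symmetric])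
qed

lemma scaled_subgroup_carrier:
  assumes "scaled_group M"
  shows "scaled_subgroup (carrier M) M"
proof -
  interpret scaled_group M by (rule assms)
  show ?thesis using add.subgroup_self by (auto simp: scaled_subgroup_def additive_subgroup_def)
qed

section \<open>Homology of chain complexes\<close>

definition scaled_complex :: "('r, 'm) chain_complex \<Rightarrow> bool" where
  "scaled_complex C \<longleftrightarrow> (\<forall>k. scaled_group (chain_mod C k) \<and>
     chain_diff C k \<in> module_hom (chain_mod C k) (chain_mod C (k - 1)) \<and>
     (\<forall>x \<in> carrier (chain_mod C k). chain_diff C (k - 1) (chain_diff C k x) = \<zero>\<^bsub>chain_mod C (k - 1 - 1)\<^esub>))"

definition subcomplex :: "(int \<Rightarrow> 'm set) \<Rightarrow> ('r, 'm) chain_complex \<Rightarrow> bool" where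
  "subcomplex N C \<longleftrightarrow> (\<forall>k. scaled_subgroup (N k) (chain_mod C k) \<and> chain_diff C k ` N k \<subseteq> N (k - 1))"

definition chain_map ::
  "('r, 'm) chain_complex \<Rightarrow> ('r, 'n) chain_complex \<Rightarrow> (int \<Rightarrow> 'm \<Rightarrow> 'n) \<Rightarrow> bool" where
  "chain_map C D \<phi> \<longleftrightarrow> (\<forall>k. \<phi> k \<in> module_hom (chain_mod C k) (chain_mod D k) \<and>
     (\<forall>x \<in> carrier (chain_mod C k). \<phi> (k - 1) (chain_diff C k x) = chain_diff D k (\<phi> k x)))"

abbreviation hclass :: "('r, 'm) chain_complex \<Rightarrow> int \<Rightarrow> 'm \<Rightarrow> 'm set" where
  "hclass C k z \<equiv> boundaries C k +>\<^bsub>chain_mod C k\<^esub> z"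

lemma chain_mapD:
  assumes "chain_map C D \<phi>"
  shows "\<phi> k \<in> module_hom (chain_mod C k) (chain_mod D k)"
    and "x \<in> carrier (chain_mod C k) \<Longrightarrow> \<phi> k x \<in> carrier (chain_mod D k)"
    and "x \<in> carrier (chain_mod C k) \<Longrightarrow> \<phi> (k - 1) (chain_diff C k x) = chain_diff D k (\<phi> k x)"
proof -
  from assms show hom: "\<phi> k \<in> module_hom (chain_mod C k) (chain_mod D k)"
    and "x \<in> carrier (chain_mod C k) \<Longrightarrow> \<phi> (k - 1) (chain_diff C k x) = chain_diff D k (\<phi> k x)"
    by (auto simp: chain_map_def)
  show "x \<in> carrier (chain_mod C k) \<Longrightarrow> \<phi> k x \<in> carrier (chain_mod D k)"
    by (rule module_homD(1)[OF hom])
qed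

lemma cycles_iff:
  "z \<in> cycles C k \<longleftrightarrow> z \<in> carrier (chain_mod C k) \<and> chain_diff C k z = \<zero>\<^bsub>chain_mod C (k - 1)\<^esub>"
  by (auto simp: cycles_def a_kernel_def')

lemma boundaries_iff:
  "z \<in> boundaries C k \<longleftrightarrow> (\<exists>e \<in> carrier (chain_mod C (k + 1)). z = chain_diff C (k + 1) e)"
  by (auto simp: boundaries_def)

context
  fixes C :: "('r, 'm) chain_complex"
  assumes C: "scaled_complex C"
begin

lemma scaled_complexD:
  shows "scaled_group (chain_mod C k)" "abelian_group (chain_mod C k)"
    and "chain_diff C k \<in> module_hom (chain_mod C k) (chain_mod C (k - 1))"
    and "x \<in> carrier (chain_mod C k) \<Longrightarrow> chain_diff C k x \<in> carrier (chain_mod C (k - 1))"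
    and "x \<in> carrier (chain_mod C k) \<Longrightarrow> chain_diff C (k - 1) (chain_diff C k x) = \<zero>\<^bsub>chain_mod C (k - 1 - 1)\<^esub>"
proof -
  from C show "scaled_group (chain_mod C k)"
    and hom: "chain_diff C k \<in> module_hom (chain_mod C k) (chain_mod C (k - 1))"
    and "x \<in> carrier (chain_mod C k) \<Longrightarrow> chain_diff C (k - 1) (chain_diff C k x) = \<zero>\<^bsub>chain_mod C (k - 1 - 1)\<^esub>"
    by (auto simp: scaled_complex_def)
  then show "abelian_group (chain_mod C k)" by (simp add: scaled_group.axioms(1))
  show "x \<in> carrier (chain_mod C k) \<Longrightarrow> chain_diff C k x \<in> carrier (chain_mod C (k - 1))"
    by (rule module_homD(1)[OF hom])
qed

text \<open>The instances at \<open>k + 1\<close> with \<open>k + 1 - 1\<close> already simplified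
  to \<open>k\<close>, the form in which boundaries of degree \<open>k\<close> occur.\<close>

lemma diff_Suc:
  shows "chain_diff C (k + 1) \<in> module_hom (chain_mod C (k + 1)) (chain_mod C k)"
    and "x \<in> carrier (chain_mod C (k + 1)) \<Longrightarrow> chain_diff C (k + 1) x \<in> carrier (chain_mod C k)"
    and "x \<in> carrier (chain_mod C (k + 1)) \<Longrightarrow> chain_diff C k (chain_diff C (k + 1) x) = \<zero>\<^bsub>chain_mod C (k - 1)\<^esub>"
  using scaled_complexD(3-5)[where k = "k + 1"] by auto

lemma cycles_subgroup: "scaled_subgroup (cycles C k) (chain_mod C k)"
  unfolding cycles_def by (rule scaled_subgroup_kernel) (rule scaled_complexD)+

lemma boundaries_subgroup: "scaled_subgroup (boundaries C k) (chain_mod C k)"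
  unfolding boundaries_def
  by (rule scaled_subgroup_image[OF scaled_complexD(1) scaled_complexD(1) diff_Suc(1)
      scaled_subgroup_carrier[OF scaled_complexD(1)]])

lemma boundaries_subset_cycles: "boundaries C k \<subseteq> cycles C k"
  using diff_Suc(2,3) by (auto simp: boundaries_iff cycles_iff)

lemma scaled_group_cycles: "scaled_group (chain_mod C k \<lparr>carrier := cycles C k\<rparr>)"
  by (rule scaled_group_subgroup[OF scaled_complexD(1) cycles_subgroup])

lemma boundaries_subgroup_cycles: "scaled_subgroup (boundaries C k) (chain_mod C k \<lparr>carrier := cycles C k\<rparr>)"
  by (rule scaled_subgroup_mono[OF scaled_complexD(1) cycles_subgroup boundaries_subgroup
      boundaries_subset_cycles])

lemmas homology_quot = scaled_group_cycles boundaries_subgroup_cycles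

lemma homology_scaled_group: "scaled_group (homology C k)"
  unfolding homology_def by (rule scaled_group_quot_module[OF homology_quot])

lemma homology_carrier: "carrier (homology C k) = {hclass C k z |z. z \<in> cycles C k}"
  using quot_module_carrier[OF homology_quot] by (simp add: homology_def)

lemma homology_zero: "\<zero>\<^bsub>homology C k\<^esub> = boundaries C k"
  by (simp add: homology_def quot_module_def)

lemma cycle_carrier: "z \<in> cycles C k \<Longrightarrow> z \<in> carrier (chain_mod C k)"
  by (simp add: cycles_iff)

lemma homology_add:
  "z \<in> cycles C k \<Longrightarrow> w \<in> cycles C k \<Longrightarrow>
    hclass C k z \<oplus>\<^bsub>homology C k\<^esub> hclass C k w = hclass C k (z \<oplus>\<^bsub>chain_mod C k\<^esub> w)"
  using quot_module_add[OF homology_quot, where x = z and y = w] by (simp add: homology_def)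

lemma homology_smult:
  "z \<in> cycles C k \<Longrightarrow> r \<odot>\<^bsub>homology C k\<^esub> hclass C k z = hclass C k (r \<odot>\<^bsub>chain_mod C k\<^esub> z)"
  using quot_module_smult[OF homology_quot, where x = z and r = r] by (simp add: homology_def)

lemma hclass_eq_iff:
  assumes "z \<in> carrier (chain_mod C k)" "w \<in> carrier (chain_mod C k)"
  shows "hclass C k z = hclass C k w \<longleftrightarrow> (\<exists>b \<in> boundaries C k. z = b \<oplus>\<^bsub>chain_mod C k\<^esub> w)"
  using quot_module_eqI[OF scaled_complexD(1) boundaries_subgroup assms]
    quot_module_eqD[OF scaled_complexD(1) boundaries_subgroup assms] by blast

lemma hclass_eq_zero_iff:
  assumes z: "z \<in> carrier (chain_mod C k)"
  shows "hclass C k z = boundaries C k \<longleftrightarrow> z \<in> boundaries C k"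
proof -
  interpret scaled_group "chain_mod C k" by (rule scaled_complexD)
  interpret abelian_subgroup "boundaries C k" "chain_mod C k"
    by (rule scaled_subgroup_abelian[OF boundaries_subgroup]) unfold_locales
  show ?thesis using a_rcos_self[OF z] a_rcos_const by blast
qed

lemma cycles_closed:
  shows "z \<in> cycles C k \<Longrightarrow> w \<in> cycles C k \<Longrightarrow> z \<oplus>\<^bsub>chain_mod C k\<^esub> w \<in> cycles C k"
    and "z \<in> cycles C k \<Longrightarrow> r \<odot>\<^bsub>chain_mod C k\<^esub> z \<in> cycles C k"
    and "z \<in> cycles C k \<Longrightarrow> \<ominus>\<^bsub>chain_mod C k\<^esub> z \<in> cycles C k"
proof -
  interpret scaled_group "chain_mod C k" by (rule scaled_complexD)
  interpret abelian_subgroup "cycles C k" "chain_mod C k"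
    by (rule scaled_subgroup_abelian[OF cycles_subgroup]) unfold_locales
  show "z \<in> cycles C k \<Longrightarrow> w \<in> cycles C k \<Longrightarrow> z \<oplus>\<^bsub>chain_mod C k\<^esub> w \<in> cycles C k"
    and "z \<in> cycles C k \<Longrightarrow> \<ominus>\<^bsub>chain_mod C k\<^esub> z \<in> cycles C k" by auto
  show "z \<in> cycles C k \<Longrightarrow> r \<odot>\<^bsub>chain_mod C k\<^esub> z \<in> cycles C k"
    using cycles_subgroup by (auto simp: scaled_subgroup_def)
qed

lemma homology_minus:
  assumes z: "z \<in> cycles C k"
  shows "\<ominus>\<^bsub>homology C k\<^esub> hclass C k z = hclass C k (\<ominus>\<^bsub>chain_mod C k\<^esub> z)"
proof -
  interpret scaled_group "chain_mod C k" by (rule scaled_complexD)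
  interpret abelian_subgroup "boundaries C k" "chain_mod C k"
    by (rule scaled_subgroup_abelian[OF boundaries_subgroup]) unfold_locales
  interpret H: scaled_group "homology C k" by (rule homology_scaled_group)
  have "hclass C k (\<ominus>\<^bsub>chain_mod C k\<^esub> z) \<oplus>\<^bsub>homology C k\<^esub> hclass C k z = \<zero>\<^bsub>homology C k\<^esub>"
    using z by (simp add: homology_add cycles_closed homology_zero cycle_carrier l_neg
      a_rcos_const[OF zero_closed])
  then show ?thesis
    using z cycles_closed(3) by (intro H.minus_equality) (auto simp: homology_carrier)
qed

end

lemma chain_map_cycles:
  assumes "scaled_complex C" "scaled_complex D" "chain_map C D \<phi>" "z \<in> cycles C k"
  shows "\<phi> k z \<in> cycles D k"
  using assms(4) chain_mapD(2)[OF assms(3), of z k] chain_mapD(3)[OF assms(3), of z k]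
    module_hom_zero[OF chain_mapD(1)[OF assms(3)] scaled_complexD(2)[OF assms(1)]
      scaled_complexD(2)[OF assms(2)], of "k - 1"]
  by (auto simp: cycles_iff)

lemma chain_map_boundaries:
  assumes "chain_map C D \<phi>"
  shows "\<phi> k ` boundaries C k \<subseteq> boundaries D k"
  using chain_mapD(2,3)[OF assms, of _ "k + 1"] by (force simp: boundaries_iff)

lemma homology_map_hclass:
  assumes C: "scaled_complex C" and D: "scaled_complex D" and \<phi>: "chain_map C D \<phi>" and z: "z \<in> cycles C k"
  shows "homology_map D \<phi> k (hclass C k z) = hclass D k (\<phi> k z)"
  unfolding homology_map_def
  using chain_mapD(1)[OF \<phi>, of k] boundaries_subgroup[OF C, of k] cycle_carrier[OF C z]
  by (intro quot_map_coset[OF scaled_complexD(1)[OF D] boundaries_subgroup[OF D] _ _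
        chain_map_boundaries[OF \<phi>]])
    (auto simp: module_hom_def scaled_subgroup_def)

lemma homology_map_hom:
  assumes C: "scaled_complex C" and D: "scaled_complex D" and \<phi>: "chain_map C D \<phi>"
  shows "homology_map D \<phi> k \<in> module_hom (homology C k) (homology D k)"
proof (rule module_homI)
  note [simp] = homology_map_hclass[OF C D \<phi>] chain_map_cycles[OF C D \<phi>] cycles_closed[OF C]
    homology_add[OF C] homology_add[OF D] homology_smult[OF C] homology_smult[OF D] cycle_carrier[OF C]
    module_homD[OF chain_mapD(1)[OF \<phi>]]
  show "homology_map D \<phi> k x \<in> carrier (homology D k)" if "x \<in> carrier (homology C k)" for x
    using that by (auto simp: homology_carrier[OF C] homology_carrier[OF D])
  show "homology_map D \<phi> k (x \<oplus>\<^bsub>homology C k\<^esub> y)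
      = homology_map D \<phi> k x \<oplus>\<^bsub>homology D k\<^esub> homology_map D \<phi> k y"
    if "x \<in> carrier (homology C k)" "y \<in> carrier (homology C k)" for x y
    using that by (auto simp: homology_carrier[OF C])
  show "homology_map D \<phi> k (r \<odot>\<^bsub>homology C k\<^esub> x) = r \<odot>\<^bsub>homology D k\<^esub> homology_map D \<phi> k x"
    if "x \<in> carrier (homology C k)" for r x
    using that by (auto simp: homology_carrier[OF C])
qed

text \<open>Both assumptions are about chains, and the first treats only classes that become zero:
  an additive map with trivial kernel is injective.\<close>

lemma homology_map_iso:
  assumes C: "scaled_complex C" and D: "scaled_complex D" and \<phi>: "chain_map C D \<phi>"
    and inj: "\<And>z. z \<in> cycles C k \<Longrightarrow> \<phi> k z \<in> boundaries D k \<Longrightarrow> z \<in> boundaries C k"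
    and surj: "\<And>w. w \<in> cycles D k \<Longrightarrow>
      \<exists>z \<in> cycles C k. \<exists>b \<in> boundaries D k. w = b \<oplus>\<^bsub>chain_mod D k\<^esub> \<phi> k z"
  shows "homology_map D \<phi> k \<in> module_iso (homology C k) (homology D k)"
proof -
  interpret HC: scaled_group "homology C k" by (rule homology_scaled_group[OF C])
  interpret HD: scaled_group "homology D k" by (rule homology_scaled_group[OF D])
  have hom: "homology_map D \<phi> k \<in> module_hom (homology C k) (homology D k)"
    by (rule homology_map_hom[OF C D \<phi>])
  interpret abelian_group_hom "homology C k" "homology D k" "homology_map D \<phi> k"
    by (rule module_hom_group_hom[OF hom]) unfold_locales
  note [simp] = homology_map_hclass[OF C D \<phi>] chain_map_cycles[OF C D \<phi>] cycle_carrier[OF D]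
    cycle_carrier[OF C]
  have "inj_on (homology_map D \<phi> k) (carrier (homology C k))"
  proof (rule inj_onI)
    fix x y assume xy: "x \<in> carrier (homology C k)" "y \<in> carrier (homology C k)"
      and eq: "homology_map D \<phi> k x = homology_map D \<phi> k y"
    have "homology_map D \<phi> k (x \<ominus>\<^bsub>homology C k\<^esub> y) = boundaries D k"
      using xy eq by (simp add: a_minus_def HD.r_neg homology_zero[OF D])
    moreover obtain z where z: "z \<in> cycles C k" "x \<ominus>\<^bsub>homology C k\<^esub> y = hclass C k z"
      using xy HC.minus_closed[OF xy] by (auto simp: homology_carrier[OF C])
    ultimately have "\<phi> k z \<in> boundaries D k"
      using hclass_eq_zero_iff[OF D, of "\<phi> k z" k] by simp
    then have "x \<ominus>\<^bsub>homology C k\<^esub> y = \<zero>\<^bsub>homology C k\<^esub>"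
      using z inj hclass_eq_zero_iff[OF C, of z k] by (simp add: homology_zero[OF C])
    moreover have "x = (x \<ominus>\<^bsub>homology C k\<^esub> y) \<oplus>\<^bsub>homology C k\<^esub> y"
      using xy by (simp add: a_minus_def HC.a_assoc HC.l_neg)
    ultimately show "x = y" using xy by simp
  qed
  moreover have "carrier (homology D k) \<subseteq> homology_map D \<phi> k ` carrier (homology C k)"
  proof
    fix y assume "y \<in> carrier (homology D k)"
    then obtain w where w: "w \<in> cycles D k" "y = hclass D k w" by (auto simp: homology_carrier[OF D])
    obtain z b where z: "z \<in> cycles C k" "b \<in> boundaries D k" "w = b \<oplus>\<^bsub>chain_mod D k\<^esub> \<phi> k z"
      using surj[OF w(1)] by blast
    then have "y = homology_map D \<phi> k (hclass C k z)"
      using w hclass_eq_iff[OF D, of w k "\<phi> k z"] by auto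
    then show "y \<in> homology_map D \<phi> k ` carrier (homology C k)"
      using z(1) by (intro image_eqI) (auto simp: homology_carrier[OF C])
  qed
  ultimately show ?thesis
    using hom module_homD(1)[OF hom] by (auto simp: module_iso_def bij_betw_def)
qed

section \<open>Quotient complexes and the chain maps between them\<close>

context
  fixes C :: "('r, 'm) chain_complex" and N
  assumes C: "scaled_complex C" and N: "subcomplex N C"
begin

lemma subcomplexD:
  shows "scaled_subgroup (N k) (chain_mod C k)" "chain_diff C k ` N k \<subseteq> N (k - 1)"
    "additive_subgroup (N k) (chain_mod C k)"
  using N by (auto simp: subcomplex_def scaled_subgroup_def)

lemmas subcomplex_quot = scaled_complexD(1)[OF C] subcomplexD(1)

lemma quot_complex_carrier:
  "carrier (chain_mod (quot_complex C N) k) = {N k +>\<^bsub>chain_mod C k\<^esub> x |x. x \<in> carrier (chain_mod C k)}"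
  by (simp add: quot_complex_def quot_module_carrier[OF subcomplex_quot])

lemma quot_complex_diff:
  "x \<in> carrier (chain_mod C k) \<Longrightarrow> chain_diff (quot_complex C N) k (N k +>\<^bsub>chain_mod C k\<^esub> x)
     = N (k - 1) +>\<^bsub>chain_mod C (k - 1)\<^esub> chain_diff C k x"
  using scaled_complexD(3)[OF C, of k]
  by (simp add: quot_complex_def quot_map_coset[OF subcomplex_quot _ subcomplexD(3,2)] module_hom_def)

lemma quot_complex_scaled_complex: "scaled_complex (quot_complex C N)"
  unfolding scaled_complex_def
proof (intro allI conjI ballI)
  fix k
  show "scaled_group (chain_mod (quot_complex C N) k)"
    by (simp add: quot_complex_def scaled_group_quot_module[OF subcomplex_quot])
  show "chain_diff (quot_complex C N) k
      \<in> module_hom (chain_mod (quot_complex C N) k) (chain_mod (quot_complex C N) (k - 1))"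
    by (simp add: quot_complex_def
        quot_map_hom[OF subcomplex_quot subcomplex_quot scaled_complexD(3)[OF C] subcomplexD(2)])
  fix x assume "x \<in> carrier (chain_mod (quot_complex C N) k)"
  then obtain y where y: "y \<in> carrier (chain_mod C k)" "x = N k +>\<^bsub>chain_mod C k\<^esub> y"
    by (auto simp: quot_complex_carrier)
  then show "chain_diff (quot_complex C N) (k - 1) (chain_diff (quot_complex C N) k x)
      = \<zero>\<^bsub>chain_mod (quot_complex C N) (k - 1 - 1)\<^esub>"
    using scaled_complexD(4,5)[OF C, of y k] quot_module_coset_zero[OF subcomplex_quot, of "k - 1 - 1"]
    by (simp add: quot_complex_diff) (simp add: quot_complex_def quot_module_def)
qed

lemma quot_complex_cycles:
  "cycles (quot_complex C N) k
    = {N k +>\<^bsub>chain_mod C k\<^esub> x |x. x \<in> carrier (chain_mod C k) \<and> chain_diff C k x \<in> N (k - 1)}"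
proof -
  have "N (k - 1) +>\<^bsub>chain_mod C (k - 1)\<^esub> y = N (k - 1) \<longleftrightarrow> y \<in> N (k - 1)"
    if "y \<in> carrier (chain_mod C (k - 1))" for y
  proof -
    interpret abelian_subgroup "N (k - 1)" "chain_mod C (k - 1)"
      by (rule scaled_subgroup_abelian[OF subcomplexD(1) scaled_complexD(2)[OF C]])
    show ?thesis using a_rcos_self[OF that] a_rcos_const by blast
  qed
  moreover have "\<zero>\<^bsub>chain_mod (quot_complex C N) (k - 1)\<^esub> = N (k - 1)"
    by (simp add: quot_complex_def quot_module_def)
  ultimately show ?thesis
    using scaled_complexD(4)[OF C] by (fastforce simp: cycles_iff quot_complex_carrier quot_complex_diff)
qed

lemma quot_complex_boundaries:
  "boundaries (quot_complex C N) k
    = {N k +>\<^bsub>chain_mod C k\<^esub> chain_diff C (k + 1) e |e. e \<in> carrier (chain_mod C (k + 1))}"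
  using quot_complex_diff[of _ "k + 1"] by (fastforce simp: boundaries_iff quot_complex_carrier)

end

context
  fixes C :: "('r, 'm) chain_complex" and N and D :: "('r, 'n) chain_complex" and M \<phi>
  assumes C: "scaled_complex C" and N: "subcomplex N C"
    and D: "scaled_complex D" and M: "subcomplex M D"
    and \<phi>: "chain_map C D \<phi>" and \<phi>N: "\<And>k. \<phi> k ` N k \<subseteq> M k"
begin

lemma quot_chain_map_coset:
  "x \<in> carrier (chain_mod C k) \<Longrightarrow>
    quot_map (chain_mod D k) (M k) (\<phi> k) (N k +>\<^bsub>chain_mod C k\<^esub> x) = M k +>\<^bsub>chain_mod D k\<^esub> \<phi> k x"
  using chain_mapD(1)[OF \<phi>, of k]
  by (simp add: quot_map_coset[OF subcomplex_quot[OF D M] _ subcomplexD(3)[OF C N] \<phi>N] module_hom_def)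

lemma quot_chain_map:
  "chain_map (quot_complex C N) (quot_complex D M) (\<lambda>k. quot_map (chain_mod D k) (M k) (\<phi> k))"
  unfolding chain_map_def
proof (intro allI conjI ballI)
  fix k
  show "quot_map (chain_mod D k) (M k) (\<phi> k)
      \<in> module_hom (chain_mod (quot_complex C N) k) (chain_mod (quot_complex D M) k)"
    by (simp add: quot_complex_def
        quot_map_hom[OF subcomplex_quot[OF C N] subcomplex_quot[OF D M] chain_mapD(1)[OF \<phi>] \<phi>N])
  fix x assume "x \<in> carrier (chain_mod (quot_complex C N) k)"
  then obtain y where "y \<in> carrier (chain_mod C k)" "x = N k +>\<^bsub>chain_mod C k\<^esub> y"
    by (auto simp: quot_complex_carrier[OF C N])
  then show "quot_map (chain_mod D (k - 1)) (M (k - 1)) (\<phi> (k - 1)) (chain_diff (quot_complex C N) k x)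
      = chain_diff (quot_complex D M) k (quot_map (chain_mod D k) (M k) (\<phi> k) x)"
    using scaled_complexD(4)[OF C] chain_mapD(2,3)[OF \<phi>]
    by (simp add: quot_complex_diff[OF C N] quot_complex_diff[OF D M] quot_chain_map_coset)
qed

text \<open>A class is here a coset of cosets, once by the subcomplex and once by the boundaries.
  The assumptions unfold both levels, so that an isomorphism of relative homology can be checked by
  computing with chains of \<open>C\<close> and \<open>D\<close>.\<close>

lemma quot_homology_map_iso:
  assumes inj: "\<And>c e m. \<lbrakk>c \<in> carrier (chain_mod C k); chain_diff C k c \<in> N (k - 1);
      e \<in> carrier (chain_mod D (k + 1)); m \<in> M k;
      \<phi> k c = m \<oplus>\<^bsub>chain_mod D k\<^esub> chain_diff D (k + 1) e\<rbrakk>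
      \<Longrightarrow> \<exists>n \<in> N k. \<exists>e' \<in> carrier (chain_mod C (k + 1)). c = n \<oplus>\<^bsub>chain_mod C k\<^esub> chain_diff C (k + 1) e'"
    and surj: "\<And>d. \<lbrakk>d \<in> carrier (chain_mod D k); chain_diff D k d \<in> M (k - 1)\<rbrakk>
      \<Longrightarrow> \<exists>c \<in> carrier (chain_mod C k). chain_diff C k c \<in> N (k - 1) \<and>
        (\<exists>m \<in> M k. \<exists>e \<in> carrier (chain_mod D (k + 1)).
          d = m \<oplus>\<^bsub>chain_mod D k\<^esub> (chain_diff D (k + 1) e \<oplus>\<^bsub>chain_mod D k\<^esub> \<phi> k c))"
  shows "homology_map (quot_complex D M) (\<lambda>k. quot_map (chain_mod D k) (M k) (\<phi> k)) k
    \<in> module_iso (homology (quot_complex C N) k) (homology (quot_complex D M) k)"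
proof (rule homology_map_iso[OF quot_complex_scaled_complex[OF C N] quot_complex_scaled_complex[OF D M]
      quot_chain_map])
  note qC = subcomplex_quot[OF C N] and qD = subcomplex_quot[OF D M]
  fix z assume "z \<in> cycles (quot_complex C N) k"
    and bd: "quot_map (chain_mod D k) (M k) (\<phi> k) z \<in> boundaries (quot_complex D M) k"
  then obtain c where c: "c \<in> carrier (chain_mod C k)" "chain_diff C k c \<in> N (k - 1)"
    and z: "z = N k +>\<^bsub>chain_mod C k\<^esub> c"
    by (auto simp: quot_complex_cycles[OF C N])
  from bd obtain e where e: "e \<in> carrier (chain_mod D (k + 1))"
    and "M k +>\<^bsub>chain_mod D k\<^esub> \<phi> k c = M k +>\<^bsub>chain_mod D k\<^esub> chain_diff D (k + 1) e"
    by (auto simp: quot_complex_boundaries[OF D M] z quot_chain_map_coset[OF c(1)])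
  then obtain m where "m \<in> M k" "\<phi> k c = m \<oplus>\<^bsub>chain_mod D k\<^esub> chain_diff D (k + 1) e"
    using quot_module_eqD[OF qD] chain_mapD(2)[OF \<phi> c(1)] diff_Suc(2)[OF D e] by blast
  then obtain n e' where "n \<in> N k" "e' \<in> carrier (chain_mod C (k + 1))"
    "c = n \<oplus>\<^bsub>chain_mod C k\<^esub> chain_diff C (k + 1) e'"
    using inj[OF c e] by blast
  then show "z \<in> boundaries (quot_complex C N) k"
    using quot_module_eqI[OF qC c(1)] diff_Suc(2)[OF C] z by (auto simp: quot_complex_boundaries[OF C N])
next
  note qC = subcomplex_quot[OF C N] and qD = subcomplex_quot[OF D M]
  fix w assume "w \<in> cycles (quot_complex D M) k"
  then obtain d where d: "d \<in> carrier (chain_mod D k)" "chain_diff D k d \<in> M (k - 1)"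
    and w: "w = M k +>\<^bsub>chain_mod D k\<^esub> d"
    by (auto simp: quot_complex_cycles[OF D M])
  obtain c m e where c: "c \<in> carrier (chain_mod C k)" "chain_diff C k c \<in> N (k - 1)" and m: "m \<in> M k"
    and e: "e \<in> carrier (chain_mod D (k + 1))"
    and deq: "d = m \<oplus>\<^bsub>chain_mod D k\<^esub> (chain_diff D (k + 1) e \<oplus>\<^bsub>chain_mod D k\<^esub> \<phi> k c)"
    using surj[OF d] by blast
  interpret D: scaled_group "chain_mod D k" by (rule scaled_complexD[OF D])
  have b: "chain_diff D (k + 1) e \<in> carrier (chain_mod D k)" and \<phi>c: "\<phi> k c \<in> carrier (chain_mod D k)"
    using diff_Suc(2)[OF D e] chain_mapD(2)[OF \<phi> c(1)] .
  have "w = M k +>\<^bsub>chain_mod D k\<^esub> (chain_diff D (k + 1) e \<oplus>\<^bsub>chain_mod D k\<^esub> \<phi> k c)"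
    using quot_module_eqI[OF qD d(1) _ m deq] b \<phi>c w by simp
  also have "\<dots> = (M k +>\<^bsub>chain_mod D k\<^esub> chain_diff D (k + 1) e)
      \<oplus>\<^bsub>chain_mod (quot_complex D M) k\<^esub> (M k +>\<^bsub>chain_mod D k\<^esub> \<phi> k c)"
    using quot_module_add[OF qD b \<phi>c] by (simp add: quot_complex_def)
  finally show "\<exists>z \<in> cycles (quot_complex C N) k. \<exists>b \<in> boundaries (quot_complex D M) k.
      w = b \<oplus>\<^bsub>chain_mod (quot_complex D M) k\<^esub> quot_map (chain_mod D k) (M k) (\<phi> k) z"
    using c e by (intro bexI[of _ "N k +>\<^bsub>chain_mod C k\<^esub> c"]
        bexI[of _ "M k +>\<^bsub>chain_mod D k\<^esub> chain_diff D (k + 1) e"])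
      (auto simp: quot_chain_map_coset quot_complex_boundaries[OF D M] quot_complex_cycles[OF C N])
qed

end

section \<open>The Mayer--Vietoris sequence of an excisive square\<close>

text \<open>Once the additive operations of the records are those of the type class,
  \<open>algebra_simps\<close> can be used on chains. Scalar multiplication stays that of the
  record.\<close>

definition additive_complex :: "('r, 'm::ab_group_add) chain_complex \<Rightarrow> bool" where
  "additive_complex C \<longleftrightarrow> scaled_complex C \<and> (\<forall>k. zero (chain_mod C k) = 0 \<and> add (chain_mod C k) = (+))"

context
  fixes C :: "('r, 'm::ab_group_add) chain_complex"
  assumes C: "additive_complex C"
begin

lemma additive_complex_scaled: "scaled_complex C"
  using C by (simp add: additive_complex_def)

lemma additive_complex_ops:
  "\<zero>\<^bsub>chain_mod C k\<^esub> = 0" "x \<oplus>\<^bsub>chain_mod C k\<^esub> y = x + y"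
  using C by (simp_all add: additive_complex_def)

lemma additive_complex_uminus:
  assumes "x \<in> carrier (chain_mod C k)"
  shows "\<ominus>\<^bsub>chain_mod C k\<^esub> x = - x"
proof -
  interpret abelian_group "chain_mod C k" by (rule scaled_complexD[OF additive_complex_scaled])
  have "\<ominus>\<^bsub>chain_mod C k\<^esub> x + x = 0"
    using l_neg[OF assms] by (simp add: additive_complex_ops)
  then show ?thesis by (simp add: eq_neg_iff_add_eq_0)
qed

lemma additive_complex_closed:
  shows "0 \<in> carrier (chain_mod C k)"
    and "x \<in> carrier (chain_mod C k) \<Longrightarrow> y \<in> carrier (chain_mod C k) \<Longrightarrow> x + y \<in> carrier (chain_mod C k)"
    and "x \<in> carrier (chain_mod C k) \<Longrightarrow> - x \<in> carrier (chain_mod C k)"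
    and "x \<in> carrier (chain_mod C k) \<Longrightarrow> y \<in> carrier (chain_mod C k) \<Longrightarrow> x - y \<in> carrier (chain_mod C k)"
    and "x \<in> carrier (chain_mod C k) \<Longrightarrow> r \<odot>\<^bsub>chain_mod C k\<^esub> x \<in> carrier (chain_mod C k)"
proof -
  interpret scaled_group "chain_mod C k" by (rule scaled_complexD[OF additive_complex_scaled])
  show "0 \<in> carrier (chain_mod C k)"
    using zero_closed by (simp add: additive_complex_ops)
  show *: "x \<in> carrier (chain_mod C k) \<Longrightarrow> y \<in> carrier (chain_mod C k) \<Longrightarrow> x + y \<in> carrier (chain_mod C k)" for x y
    using a_closed by (simp add: additive_complex_ops)
  show **: "x \<in> carrier (chain_mod C k) \<Longrightarrow> - x \<in> carrier (chain_mod C k)" for x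
    using a_inv_closed by (simp add: additive_complex_uminus[symmetric])
  show "x \<in> carrier (chain_mod C k) \<Longrightarrow> y \<in> carrier (chain_mod C k) \<Longrightarrow> x - y \<in> carrier (chain_mod C k)"
    using *[OF _ **, of x y] by simp
  show "x \<in> carrier (chain_mod C k) \<Longrightarrow> r \<odot>\<^bsub>chain_mod C k\<^esub> x \<in> carrier (chain_mod C k)"
    by simp
qed

lemma additive_complex_smult_add:
  "x \<in> carrier (chain_mod C k) \<Longrightarrow> y \<in> carrier (chain_mod C k) \<Longrightarrow>
    r \<odot>\<^bsub>chain_mod C k\<^esub> (x + y) = r \<odot>\<^bsub>chain_mod C k\<^esub> x + r \<odot>\<^bsub>chain_mod C k\<^esub> y"
  using scaled_group.smult_add[OF scaled_complexD(1)[OF additive_complex_scaled, of k]]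
  by (simp add: additive_complex_ops)

lemma additive_cycles_iff: "z \<in> cycles C k \<longleftrightarrow> z \<in> carrier (chain_mod C k) \<and> chain_diff C k z = 0"
  by (simp add: cycles_iff additive_complex_ops)

lemma additive_hclass_eq_iff:
  assumes "z \<in> carrier (chain_mod C k)" "w \<in> carrier (chain_mod C k)"
  shows "hclass C k z = hclass C k w \<longleftrightarrow> (\<exists>e \<in> carrier (chain_mod C (k + 1)). z = chain_diff C (k + 1) e + w)"
  using hclass_eq_iff[OF additive_complex_scaled assms]
  by (auto simp: additive_complex_ops boundaries_iff)

end

lemma additive_hom:
  assumes "additive_complex C" "additive_complex D" "h \<in> module_hom (chain_mod C k) (chain_mod D l)"
  shows "h 0 = 0"
    and "x \<in> carrier (chain_mod C k) \<Longrightarrow> y \<in> carrier (chain_mod C k) \<Longrightarrow> h (x + y) = h x + h y"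
    and "x \<in> carrier (chain_mod C k) \<Longrightarrow> h (- x) = - h x"
    and "x \<in> carrier (chain_mod C k) \<Longrightarrow> y \<in> carrier (chain_mod C k) \<Longrightarrow> h (x - y) = h x - h y"
proof -
  show add: "x \<in> carrier (chain_mod C k) \<Longrightarrow> y \<in> carrier (chain_mod C k) \<Longrightarrow> h (x + y) = h x + h y" for x y
    using module_homD(2)[OF assms(3)] by (simp add: additive_complex_ops[OF assms(1)] additive_complex_ops[OF assms(2)])
  note cl = additive_complex_closed[OF assms(1)]
  show zero: "h 0 = 0" using add[of 0 0] cl(1) by simp
  show uminus: "x \<in> carrier (chain_mod C k) \<Longrightarrow> h (- x) = - h x" for x
    using add[of x "- x"] cl(3) zero by (simp add: minus_unique)
  show "x \<in> carrier (chain_mod C k) \<Longrightarrow> y \<in> carrier (chain_mod C k) \<Longrightarrow> h (x - y) = h x - h y"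
    using add[of x "- y"] cl(3) uminus by simp
qed

lemma module_prod_simps [simp]:
  "carrier (module_prod M N) = carrier M \<times> carrier N"
  "\<zero>\<^bsub>module_prod M N\<^esub> = (\<zero>\<^bsub>M\<^esub>, \<zero>\<^bsub>N\<^esub>)"
  "(x, y) \<oplus>\<^bsub>module_prod M N\<^esub> (x', y') = (x \<oplus>\<^bsub>M\<^esub> x', y \<oplus>\<^bsub>N\<^esub> y')"
  "r \<odot>\<^bsub>module_prod M N\<^esub> (x, y) = (r \<odot>\<^bsub>M\<^esub> x, r \<odot>\<^bsub>N\<^esub> y)"
  by (simp_all add: module_prod_def)

text \<open>The last two assumptions say on representatives that \<open>\<gamma>\<close> induces an injective and a surjective map
  from the homology of \<open>CX / CA\<close> to that of \<open>CP / CY\<close>.\<close>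

locale excisive_square =
  fixes CA :: "('r, 'a::ab_group_add) chain_complex" and CX :: "('r, 'x::ab_group_add) chain_complex"
    and CY :: "('r, 'y::ab_group_add) chain_complex" and CP :: "('r, 'p::ab_group_add) chain_complex"
    and \<alpha> :: "int \<Rightarrow> 'a \<Rightarrow> 'x" and \<beta> :: "int \<Rightarrow> 'a \<Rightarrow> 'y" and \<gamma> :: "int \<Rightarrow> 'x \<Rightarrow> 'p" and \<eta> :: "int \<Rightarrow> 'y \<Rightarrow> 'p"
  assumes complexes: "additive_complex CA" "additive_complex CX" "additive_complex CY" "additive_complex CP"
    and maps: "chain_map CA CX \<alpha>" "chain_map CA CY \<beta>" "chain_map CX CP \<gamma>" "chain_map CY CP \<eta>"
    and commutes: "a \<in> carrier (chain_mod CA k) \<Longrightarrow> \<gamma> k (\<alpha> k a) = \<eta> k (\<beta> k a)"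
    and inj_\<alpha>: "a \<in> carrier (chain_mod CA k) \<Longrightarrow> \<alpha> k a = 0 \<Longrightarrow> a = 0"
    and inj_\<eta>: "y \<in> carrier (chain_mod CY k) \<Longrightarrow> \<eta> k y = 0 \<Longrightarrow> y = 0"
    and rel_inj: "\<lbrakk>c \<in> carrier (chain_mod CX k); chain_diff CX k c \<in> \<alpha> (k - 1) ` carrier (chain_mod CA (k - 1));
      e \<in> carrier (chain_mod CP (k + 1)); m \<in> \<eta> k ` carrier (chain_mod CY k);
      \<gamma> k c = m + chain_diff CP (k + 1) e\<rbrakk>
      \<Longrightarrow> \<exists>n \<in> \<alpha> k ` carrier (chain_mod CA k). \<exists>e' \<in> carrier (chain_mod CX (k + 1)). c = n + chain_diff CX (k + 1) e'"
    and rel_surj: "\<lbrakk>d \<in> carrier (chain_mod CP k); chain_diff CP k d \<in> \<eta> (k - 1) ` carrier (chain_mod CY (k - 1))\<rbrakk>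
      \<Longrightarrow> \<exists>c \<in> carrier (chain_mod CX k). chain_diff CX k c \<in> \<alpha> (k - 1) ` carrier (chain_mod CA (k - 1)) \<and>
        (\<exists>m \<in> \<eta> k ` carrier (chain_mod CY k). \<exists>e \<in> carrier (chain_mod CP (k + 1)).
          d = m + (chain_diff CP (k + 1) e + \<gamma> k c))"
begin

lemmas scaled = complexes[THEN additive_complex_scaled]

lemmas diff_closed = diff_Suc(2)[OF scaled(1)] diff_Suc(2)[OF scaled(2)] diff_Suc(2)[OF scaled(3)]
  diff_Suc(2)[OF scaled(4)]
  scaled_complexD(4)[OF scaled(1)] scaled_complexD(4)[OF scaled(2)] scaled_complexD(4)[OF scaled(3)]
  scaled_complexD(4)[OF scaled(4)]
lemmas map_closed = maps[THEN chain_mapD(2)]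
lemmas group_closed = complexes[THEN additive_complex_closed(1)] complexes[THEN additive_complex_closed(2)]
  complexes[THEN additive_complex_closed(3)] complexes[THEN additive_complex_closed(4)]
  complexes[THEN additive_complex_closed(5)]
lemmas closed = diff_closed map_closed group_closed

lemmas ops = additive_complex_ops[OF complexes(1)] additive_complex_ops[OF complexes(2)]
  additive_complex_ops[OF complexes(3)] additive_complex_ops[OF complexes(4)]
lemmas diff_hom_Suc = additive_hom[OF complexes(1) complexes(1) diff_Suc(1)[OF scaled(1)]]
  additive_hom[OF complexes(2) complexes(2) diff_Suc(1)[OF scaled(2)]]
  additive_hom[OF complexes(3) complexes(3) diff_Suc(1)[OF scaled(3)]]
  additive_hom[OF complexes(4) complexes(4) diff_Suc(1)[OF scaled(4)]]
lemmas diff_hom = additive_hom[OF complexes(1) complexes(1) scaled_complexD(3)[OF scaled(1)]]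
  additive_hom[OF complexes(2) complexes(2) scaled_complexD(3)[OF scaled(2)]]
  additive_hom[OF complexes(3) complexes(3) scaled_complexD(3)[OF scaled(3)]]
  additive_hom[OF complexes(4) complexes(4) scaled_complexD(3)[OF scaled(4)]]
lemmas map_hom = additive_hom[OF complexes(1) complexes(2) chain_mapD(1)[OF maps(1)]]
  additive_hom[OF complexes(1) complexes(3) chain_mapD(1)[OF maps(2)]]
  additive_hom[OF complexes(2) complexes(4) chain_mapD(1)[OF maps(3)]]
  additive_hom[OF complexes(3) complexes(4) chain_mapD(1)[OF maps(4)]]
lemmas homs = diff_hom diff_hom_Suc map_hom
lemmas map_smult = maps[THEN chain_mapD(1), THEN module_homD(3)]
lemmas diff_smult = scaled[THEN scaled_complexD(3), THEN module_homD(3)]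
  scaled[THEN diff_Suc(1), THEN module_homD(3)]
lemmas smult_simps = complexes[THEN additive_complex_smult_add] map_smult diff_smult

lemmas diff_diff = diff_Suc(3)[OF scaled(1), unfolded ops] diff_Suc(3)[OF scaled(2), unfolded ops]
  diff_Suc(3)[OF scaled(3), unfolded ops] diff_Suc(3)[OF scaled(4), unfolded ops]
  scaled_complexD(5)[OF scaled(1), unfolded ops] scaled_complexD(5)[OF scaled(2), unfolded ops]
  scaled_complexD(5)[OF scaled(3), unfolded ops] scaled_complexD(5)[OF scaled(4), unfolded ops]

lemmas map_diff = maps[THEN chain_mapD(3)]

lemma map_diff_Suc:
  "x \<in> carrier (chain_mod CA (k + 1)) \<Longrightarrow> \<alpha> k (chain_diff CA (k + 1) x) = chain_diff CX (k + 1) (\<alpha> (k + 1) x)"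
  "x \<in> carrier (chain_mod CA (k + 1)) \<Longrightarrow> \<beta> k (chain_diff CA (k + 1) x) = chain_diff CY (k + 1) (\<beta> (k + 1) x)"
  "x' \<in> carrier (chain_mod CX (k + 1)) \<Longrightarrow> \<gamma> k (chain_diff CX (k + 1) x') = chain_diff CP (k + 1) (\<gamma> (k + 1) x')"
  "y \<in> carrier (chain_mod CY (k + 1)) \<Longrightarrow> \<eta> k (chain_diff CY (k + 1) y) = chain_diff CP (k + 1) (\<eta> (k + 1) y)"
  using map_diff[of _ "k + 1"] by simp_all

text \<open>\<open>algebra_simps\<close> also rewrites the degree \<open>k + 1\<close> to
  \<open>1 + k\<close>; these copies keep the rules applicable afterwards.\<close>

lemmas Suc_commuted = diff_closed(1-4)[unfolded add.commute[of _ "1::int"]]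
  diff_hom_Suc[unfolded add.commute[of _ "1::int"]] map_diff_Suc[unfolded add.commute[of _ "1::int"]]
  diff_diff(1-4)[unfolded add.commute[of _ "1::int"]]

lemmas hclass_eq = complexes[THEN additive_hclass_eq_iff]
lemmas cyc = complexes[THEN additive_cycles_iff]

section \<open>The connecting homomorphism\<close>

text \<open>A relation between cycles that descends to the connecting map.\<close>

definition connecting :: "int \<Rightarrow> 'p \<Rightarrow> 'a \<Rightarrow> bool" where
  "connecting k z a \<longleftrightarrow> a \<in> carrier (chain_mod CA (k - 1)) \<and>
     (\<exists>c \<in> carrier (chain_mod CX k). \<exists>y \<in> carrier (chain_mod CY k). \<exists>e \<in> carrier (chain_mod CP (k + 1)).
       z = \<eta> k y + (chain_diff CP (k + 1) e + \<gamma> k c) \<and> chain_diff CX k c = \<alpha> (k - 1) a)"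

lemma \<alpha>_eqD:
  assumes "a \<in> carrier (chain_mod CA k)" "b \<in> carrier (chain_mod CA k)" "\<alpha> k a = \<alpha> k b"
  shows "a = b"
  using inj_\<alpha>[of "a - b" k] assms by (simp add: closed homs)

text \<open>\<open>\<alpha>\<close> is injective and sends the boundary of \<open>a\<close> to
  \<open>\<partial>\<partial>c = 0\<close>.\<close>

lemma connecting_cycle:
  assumes "connecting k z a"
  shows "a \<in> cycles CA (k - 1)"
proof -
  obtain c where a: "a \<in> carrier (chain_mod CA (k - 1))" and c: "c \<in> carrier (chain_mod CX k)"
    and "chain_diff CX k c = \<alpha> (k - 1) a"
    using assms by (auto simp: connecting_def)
  then have "\<alpha> (k - 1 - 1) (chain_diff CA (k - 1) a) = 0"
    using map_diff(1)[OF a] diff_diff(6)[OF c] by simp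
  then have "chain_diff CA (k - 1) a = 0"
    by (rule inj_\<alpha>[OF scaled_complexD(4)[OF scaled(1) a]])
  then show ?thesis using a by (simp add: cyc)
qed

text \<open>Applying the differential to the decomposition of \<open>z\<close> gives
  \<open>\<eta> (\<partial>y + \<beta> a) = 0\<close>, because
  \<open>\<gamma> (\<alpha> a) = \<eta> (\<beta> a)\<close>, and \<open>\<eta>\<close> is injective.
  The sign agrees with the one in \<open>to_sum\<close>: \<open>(- \<alpha> a, \<beta> a)\<close> is
  the boundary of \<open>(- c, - y)\<close>.\<close>

lemma connecting_\<beta>:
  assumes z: "z \<in> cycles CP k" and eq: "z = \<eta> k y + (chain_diff CP (k + 1) e + \<gamma> k c)"
    and dc: "chain_diff CX k c = \<alpha> (k - 1) a"
    and cl: "a \<in> carrier (chain_mod CA (k - 1))" "c \<in> carrier (chain_mod CX k)"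
      "y \<in> carrier (chain_mod CY k)" "e \<in> carrier (chain_mod CP (k + 1))"
  shows "\<beta> (k - 1) a = - chain_diff CY k y"
proof -
  have "0 = chain_diff CP k z" using z by (simp add: cyc)
  also have "\<dots> = \<eta> (k - 1) (chain_diff CY k y) + \<gamma> (k - 1) (\<alpha> (k - 1) a)"
    using cl by (simp add: eq homs closed diff_diff map_diff[symmetric] dc)
  also have "\<dots> = \<eta> (k - 1) (chain_diff CY k y + \<beta> (k - 1) a)"
    using cl by (simp add: homs closed commutes)
  finally have "chain_diff CY k y + \<beta> (k - 1) a = 0"
    using inj_\<eta>[of "chain_diff CY k y + \<beta> (k - 1) a" "k - 1"] cl by (simp add: closed)
  then show ?thesis by (simp add: eq_neg_iff_add_eq_0 add.commute)
qed

lemma connecting_exists: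
  assumes "z \<in> cycles CP k"
  shows "\<exists>a. connecting k z a"
proof -
  \<comment> \<open>A cycle is a relative cycle: its boundary is the image of
    \<open>0\<close>.\<close>
  have "chain_diff CP k z \<in> \<eta> (k - 1) ` carrier (chain_mod CY (k - 1))"
    using assms by (auto simp: cyc homs closed intro!: image_eqI[of _ _ 0])
  then show ?thesis
    using rel_surj[of z k] assms unfolding connecting_def cyc by blast
qed

lemma connecting_add:
  assumes "connecting k z a" "connecting k z' a'"
  shows "connecting k (z + z') (a + a')"
proof -
  obtain c y e where 1: "c \<in> carrier (chain_mod CX k)" "y \<in> carrier (chain_mod CY k)"
      "e \<in> carrier (chain_mod CP (k + 1))" "z = \<eta> k y + (chain_diff CP (k + 1) e + \<gamma> k c)"
      "chain_diff CX k c = \<alpha> (k - 1) a" and a: "a \<in> carrier (chain_mod CA (k - 1))"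
    using assms(1) by (auto simp: connecting_def)
  obtain c' y' e' where 2: "c' \<in> carrier (chain_mod CX k)" "y' \<in> carrier (chain_mod CY k)"
      "e' \<in> carrier (chain_mod CP (k + 1))" "z' = \<eta> k y' + (chain_diff CP (k + 1) e' + \<gamma> k c')"
      "chain_diff CX k c' = \<alpha> (k - 1) a'" and a': "a' \<in> carrier (chain_mod CA (k - 1))"
    using assms(2) by (auto simp: connecting_def)
  show ?thesis
    unfolding connecting_def using 1 2 a a'
    by (intro conjI bexI[of _ "c + c'"] bexI[of _ "y + y'"] bexI[of _ "e + e'"])
      (simp_all add: closed homs algebra_simps)
qed

lemma connecting_uminus:
  assumes "connecting k z a"
  shows "connecting k (- z) (- a)"
proof -
  obtain c y e where 1: "c \<in> carrier (chain_mod CX k)" "y \<in> carrier (chain_mod CY k)"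
      "e \<in> carrier (chain_mod CP (k + 1))" "z = \<eta> k y + (chain_diff CP (k + 1) e + \<gamma> k c)"
      "chain_diff CX k c = \<alpha> (k - 1) a" and a: "a \<in> carrier (chain_mod CA (k - 1))"
    using assms(1) by (auto simp: connecting_def)
  show ?thesis
    unfolding connecting_def using 1 a
    by (intro conjI bexI[of _ "- c"] bexI[of _ "- y"] bexI[of _ "- e"])
      (simp_all add: closed homs algebra_simps)
qed

lemma connecting_smult:
  assumes "connecting k z a"
  shows "connecting k (r \<odot>\<^bsub>chain_mod CP k\<^esub> z) (r \<odot>\<^bsub>chain_mod CA (k - 1)\<^esub> a)"
proof -
  obtain c y e where 1: "c \<in> carrier (chain_mod CX k)" "y \<in> carrier (chain_mod CY k)"
      "e \<in> carrier (chain_mod CP (k + 1))" "z = \<eta> k y + (chain_diff CP (k + 1) e + \<gamma> k c)"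
      "chain_diff CX k c = \<alpha> (k - 1) a" and a: "a \<in> carrier (chain_mod CA (k - 1))"
    using assms(1) by (auto simp: connecting_def)
  have "chain_diff CP (k + 1) (r \<odot>\<^bsub>chain_mod CP (k + 1)\<^esub> e) = r \<odot>\<^bsub>chain_mod CP k\<^esub> chain_diff CP (k + 1) e"
    using diff_smult(8)[OF 1(3)] .
  then show ?thesis
    unfolding connecting_def using 1 a
    by (intro conjI bexI[of _ "r \<odot>\<^bsub>chain_mod CX k\<^esub> c"] bexI[of _ "r \<odot>\<^bsub>chain_mod CY k\<^esub> y"]
         bexI[of _ "r \<odot>\<^bsub>chain_mod CP (k + 1)\<^esub> e"])
      (simp_all add: closed smult_simps)
qed

text \<open>As \<open>connecting\<close> is additive, this makes its value unique up to boundaries.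
  The relation says that \<open>\<gamma> c\<close> is a relative boundary; by \<open>rel_inj\<close>
  so is \<open>c\<close>, say \<open>c = \<alpha> b + \<partial>e'\<close>, and then
  \<open>\<alpha> a = \<partial>c = \<alpha> (\<partial>b)\<close>.\<close>

lemma connecting_boundary:
  assumes w: "w \<in> carrier (chain_mod CP (k + 1))" and "connecting k (chain_diff CP (k + 1) w) a"
  shows "\<exists>b \<in> carrier (chain_mod CA k). a = chain_diff CA k b"
proof -
  obtain c y e where c: "c \<in> carrier (chain_mod CX k)" and y: "y \<in> carrier (chain_mod CY k)"
    and e: "e \<in> carrier (chain_mod CP (k + 1))"
    and eq: "chain_diff CP (k + 1) w = \<eta> k y + (chain_diff CP (k + 1) e + \<gamma> k c)"
    and dc: "chain_diff CX k c = \<alpha> (k - 1) a" and a: "a \<in> carrier (chain_mod CA (k - 1))"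
    using assms(2) by (auto simp: connecting_def)
  have "\<gamma> k c = \<eta> k (- y) + chain_diff CP (k + 1) (w - e)"
    using w y e eq by (simp add: homs Suc_commuted algebra_simps)
  then obtain b e' where b: "b \<in> carrier (chain_mod CA k)" and e': "e' \<in> carrier (chain_mod CX (k + 1))"
    and ceq: "c = \<alpha> k b + chain_diff CX (k + 1) e'"
    using rel_inj[OF c, of "w - e" "\<eta> k (- y)"] dc a w e y by (auto simp: closed)
  have "\<alpha> (k - 1) a = \<alpha> (k - 1) (chain_diff CA k b)"
    using b e' by (simp add: dc[symmetric] ceq homs closed diff_diff map_diff)
  then have "a = chain_diff CA k b" by (rule \<alpha>_eqD[OF a scaled_complexD(4)[OF scaled(1) b]])
  then show ?thesis using b by blast
qed

text \<open>The choice runs at once over all cycles that represent \<open>u\<close> and over all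
  values of the relation at them; \<open>connecting_map_hclass\<close> shows that it does not
  matter.\<close>

definition connecting_map :: "int \<Rightarrow> 'p set \<Rightarrow> 'a set" where
  "connecting_map k u = hclass CA (k - 1) (SOME a. \<exists>z \<in> cycles CP k. u = hclass CP k z \<and> connecting k z a)"

lemma connecting_map_hclass:
  assumes z: "z \<in> cycles CP k" and "connecting k z a"
  shows "connecting_map k (hclass CP k z) = hclass CA (k - 1) a"
proof -
  define a' where "a' = (SOME a. \<exists>z' \<in> cycles CP k. hclass CP k z = hclass CP k z' \<and> connecting k z' a)"
  have "\<exists>z' \<in> cycles CP k. hclass CP k z = hclass CP k z' \<and> connecting k z' a'"
    unfolding a'_def by (rule someI[of _ a]) (use assms in blast)
  then obtain z' where z': "z' \<in> cycles CP k" "hclass CP k z' = hclass CP k z" and con: "connecting k z' a'"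
    by metis
  then obtain w where w: "w \<in> carrier (chain_mod CP (k + 1))" "z' = chain_diff CP (k + 1) w + z"
    using z by (auto simp: cyc hclass_eq)
  \<comment> \<open>The two representatives differ by a boundary, so by additivity the difference of
    the two values is a value at that boundary.\<close>
  have "connecting k (chain_diff CP (k + 1) w) (a' - a)"
    using connecting_add[OF con connecting_uminus[OF assms(2)]] w(2) by simp
  then obtain b where "b \<in> carrier (chain_mod CA k)" "a' - a = chain_diff CA k b"
    using connecting_boundary[OF w(1)] by blast
  then have "hclass CA (k - 1) a' = hclass CA (k - 1) a"
    using connecting_cycle[OF con] connecting_cycle[OF assms(2)]
    by (subst hclass_eq) (auto simp: cyc Suc_commuted algebra_simps)
  then show ?thesis by (simp add: connecting_map_def a'_def)
qed

lemma connecting_map_cases: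
  assumes "u \<in> carrier (homology CP k)"
  obtains z a where "z \<in> cycles CP k" "u = hclass CP k z" "connecting k z a"
    "connecting_map k u = hclass CA (k - 1) a" "a \<in> cycles CA (k - 1)"
  using assms connecting_exists connecting_map_hclass connecting_cycle
  unfolding homology_carrier[OF scaled(4)] by blast

lemmas homology_simps = scaled[THEN homology_add] scaled[THEN homology_smult] scaled[THEN homology_carrier]
  scaled[THEN homology_minus] scaled[THEN homology_zero]
lemmas cycles_cl = scaled[THEN cycles_closed(1)] scaled[THEN cycles_closed(2)] scaled[THEN cycles_closed(3)]
lemmas maps_cycles = chain_map_cycles[OF scaled(1) scaled(2) maps(1)] chain_map_cycles[OF scaled(1) scaled(3) maps(2)]
  chain_map_cycles[OF scaled(2) scaled(4) maps(3)] chain_map_cycles[OF scaled(3) scaled(4) maps(4)]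
lemmas maps_hclass = homology_map_hclass[OF scaled(1) scaled(2) maps(1)] homology_map_hclass[OF scaled(1) scaled(3) maps(2)]
  homology_map_hclass[OF scaled(2) scaled(4) maps(3)] homology_map_hclass[OF scaled(3) scaled(4) maps(4)]

lemma connecting_map_hom: "connecting_map k \<in> module_hom (homology CP k) (homology CA (k - 1))"
proof (rule module_homI)
  fix u assume u: "u \<in> carrier (homology CP k)"
  from u obtain z a where 1: "z \<in> cycles CP k" "u = hclass CP k z" "connecting k z a"
    "connecting_map k u = hclass CA (k - 1) a" "a \<in> cycles CA (k - 1)" by (rule connecting_map_cases)
  show "connecting_map k u \<in> carrier (homology CA (k - 1))"
    using 1 by (auto simp: homology_simps)
  show "connecting_map k (r \<odot>\<^bsub>homology CP k\<^esub> u) = r \<odot>\<^bsub>homology CA (k - 1)\<^esub> connecting_map k u" for r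
    using 1 connecting_map_hclass[OF _ connecting_smult[OF 1(3)], of r]
    by (simp add: homology_simps cycles_cl)
  fix v assume "v \<in> carrier (homology CP k)"
  then obtain z' a' where 2: "z' \<in> cycles CP k" "v = hclass CP k z'" "connecting k z' a'"
    "connecting_map k v = hclass CA (k - 1) a'" "a' \<in> cycles CA (k - 1)" by (rule connecting_map_cases)
  have "z + z' \<in> cycles CP k" using cycles_cl(4)[OF 1(1) 2(1)] by (simp add: ops)
  from connecting_map_hclass[OF this connecting_add[OF 1(3) 2(3)]]
  show "connecting_map k (u \<oplus>\<^bsub>homology CP k\<^esub> v)
      = connecting_map k u \<oplus>\<^bsub>homology CA (k - 1)\<^esub> connecting_map k v"
    using 1 2 by (simp add: homology_simps ops)
qed

section \<open>The maps to and from the direct sum, and exactness\<close>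

definition to_sum :: "int \<Rightarrow> 'a set \<Rightarrow> 'x set \<times> 'y set" where
  "to_sum k a = (\<ominus>\<^bsub>homology CX k\<^esub> homology_map CX \<alpha> k a, homology_map CY \<beta> k a)"

definition from_sum :: "int \<Rightarrow> 'x set \<times> 'y set \<Rightarrow> 'p set" where
  "from_sum k = (\<lambda>(x, y). homology_map CP \<gamma> k x \<oplus>\<^bsub>homology CP k\<^esub> homology_map CP \<eta> k y)"

abbreviation sum_homology :: "int \<Rightarrow> ('r, 'x set \<times> 'y set) module" where
  "sum_homology k \<equiv> module_prod (homology CX k) (homology CY k)"

lemma to_sum_hclass:
  "a \<in> cycles CA k \<Longrightarrow> to_sum k (hclass CA k a) = (hclass CX k (- \<alpha> k a), hclass CY k (\<beta> k a))"
  using maps_cycles(1)[of a k] additive_complex_uminus[OF complexes(2), of "\<alpha> k a" k]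
  by (simp add: to_sum_def maps_hclass homology_simps cyc)

lemma from_sum_hclass:
  "x \<in> cycles CX k \<Longrightarrow> y \<in> cycles CY k \<Longrightarrow> from_sum k (hclass CX k x, hclass CY k y) = hclass CP k (\<gamma> k x + \<eta> k y)"
  using maps_cycles(3)[of x k] maps_cycles(4)[of y k]
  by (simp add: from_sum_def maps_hclass homology_simps ops)

lemma to_sum_hom: "to_sum k \<in> module_hom (homology CA k) (sum_homology k)"
proof (rule module_homI)
  fix u assume "u \<in> carrier (homology CA k)"
  then obtain a where a: "a \<in> cycles CA k" "u = hclass CA k a" by (auto simp: homology_simps)
  have ma: "- \<alpha> k a \<in> cycles CX k" "\<beta> k a \<in> cycles CY k"
    using maps_cycles(1)[OF a(1)] maps_cycles(2)[OF a(1)] by (auto simp: cyc homs closed)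
  show "to_sum k u \<in> carrier (sum_homology k)"
    using a ma by (auto simp: to_sum_hclass homology_simps)
  \<comment> \<open>That the action commutes with negation has to be derived from its
    additivity.\<close>
  have "r \<odot>\<^bsub>chain_mod CX k\<^esub> (- \<alpha> k a) = - (r \<odot>\<^bsub>chain_mod CX k\<^esub> \<alpha> k a)" for r
  proof -
    have "r \<odot>\<^bsub>chain_mod CX k\<^esub> 0 = 0"
      using smult_simps(2)[of 0 k 0 r] by (simp add: closed)
    then have "r \<odot>\<^bsub>chain_mod CX k\<^esub> \<alpha> k a + r \<odot>\<^bsub>chain_mod CX k\<^esub> (- \<alpha> k a) = 0"
      using smult_simps(2)[of "\<alpha> k a" k "- \<alpha> k a" r] a by (simp add: closed cyc)
    then show ?thesis by (simp add: minus_unique)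
  qed
  then show "to_sum k (r \<odot>\<^bsub>homology CA k\<^esub> u) = r \<odot>\<^bsub>sum_homology k\<^esub> to_sum k u" for r
    using a ma cycles_cl(5)[OF a(1), of r]
    by (simp add: to_sum_hclass homology_simps) (simp add: cyc map_smult)
  fix v assume "v \<in> carrier (homology CA k)"
  then obtain b where b: "b \<in> cycles CA k" "v = hclass CA k b" by (auto simp: homology_simps)
  have mb: "- \<alpha> k b \<in> cycles CX k" "\<beta> k b \<in> cycles CY k"
    using maps_cycles(1)[OF b(1)] maps_cycles(2)[OF b(1)] by (auto simp: cyc homs closed)
  show "to_sum k (u \<oplus>\<^bsub>homology CA k\<^esub> v) = to_sum k u \<oplus>\<^bsub>sum_homology k\<^esub> to_sum k v"
    using a b ma mb cycles_cl(1)[OF a(1) b(1)]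
    by (simp add: to_sum_hclass homology_simps ops) (simp add: cyc homs)
qed

lemma from_sum_hom: "from_sum k \<in> module_hom (sum_homology k) (homology CP k)"
proof (rule module_homI)
  fix u assume "u \<in> carrier (sum_homology k)"
  then obtain x y where u: "x \<in> cycles CX k" "y \<in> cycles CY k" "u = (hclass CX k x, hclass CY k y)"
    by (auto simp: homology_simps)
  have mu: "\<gamma> k x + \<eta> k y \<in> cycles CP k"
    using maps_cycles(3)[OF u(1)] maps_cycles(4)[OF u(2)] by (auto simp: cyc homs closed)
  show "from_sum k u \<in> carrier (homology CP k)"
    using u mu by (auto simp: from_sum_hclass homology_simps)
  show "from_sum k (r \<odot>\<^bsub>sum_homology k\<^esub> u) = r \<odot>\<^bsub>homology CP k\<^esub> from_sum k u" for r
    using u mu cycles_cl(6)[OF u(1), of r] cycles_cl(7)[OF u(2), of r]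
    by (simp add: from_sum_hclass homology_simps) (simp add: cyc smult_simps closed)
  fix v assume "v \<in> carrier (sum_homology k)"
  then obtain x' y' where v: "x' \<in> cycles CX k" "y' \<in> cycles CY k" "v = (hclass CX k x', hclass CY k y')"
    by (auto simp: homology_simps)
  have mv: "\<gamma> k x' + \<eta> k y' \<in> cycles CP k"
    using maps_cycles(3)[OF v(1)] maps_cycles(4)[OF v(2)] by (auto simp: cyc homs closed)
  show "from_sum k (u \<oplus>\<^bsub>sum_homology k\<^esub> v) = from_sum k u \<oplus>\<^bsub>homology CP k\<^esub> from_sum k v"
    using u v mu mv cycles_cl(2)[OF u(1) v(1)] cycles_cl(3)[OF u(2) v(2)]
    by (simp add: from_sum_hclass homology_simps ops) (simp add: cyc homs closed Suc_commuted algebra_simps)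
qed

lemma hclass_eq_zero:
  "z \<in> carrier (chain_mod CX k) \<Longrightarrow> hclass CX k z = boundaries CX k \<longleftrightarrow> z \<in> boundaries CX k"
  "y \<in> carrier (chain_mod CY k) \<Longrightarrow> hclass CY k y = boundaries CY k \<longleftrightarrow> y \<in> boundaries CY k"
  "p \<in> carrier (chain_mod CP k) \<Longrightarrow> hclass CP k p = boundaries CP k \<longleftrightarrow> p \<in> boundaries CP k"
  "a \<in> carrier (chain_mod CA k) \<Longrightarrow> hclass CA k a = boundaries CA k \<longleftrightarrow> a \<in> boundaries CA k"
  by (rule scaled[THEN hclass_eq_zero_iff]; assumption)+

text \<open>The hard inclusion needs both halves of excision. Injectivity writes \<open>x\<close> as
  \<open>\<alpha> a\<close> plus a boundary, but then \<open>\<beta> a + y\<close> is only known to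
  become a boundary in \<open>CP\<close>, not in \<open>CY\<close>. The chain bounding it there is a
  relative cycle of degree \<open>k + 1\<close>; surjectivity replaces it by a relative cycle
  \<open>c\<close> of \<open>CX\<close>, and the boundary \<open>\<alpha> a'\<close> of
  \<open>c\<close> tells how \<open>a\<close> must be corrected.\<close>

lemma exact_at_sum: "exact_at (homology CA k) (to_sum k) (sum_homology k) (from_sum k) (homology CP k)"
  unfolding exact_at_def
proof (intro conjI to_sum_hom from_sum_hom equalityI subsetI)
  fix u assume "u \<in> to_sum k ` carrier (homology CA k)"
  then obtain a where a: "a \<in> cycles CA k" "u = to_sum k (hclass CA k a)"
    by (auto simp: homology_simps)
  then have ma: "- \<alpha> k a \<in> cycles CX k" "\<beta> k a \<in> cycles CY k"
    using maps_cycles(1)[OF a(1)] maps_cycles(2)[OF a(1)] by (auto simp: cyc homs closed)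
  have "\<gamma> k (- \<alpha> k a) + \<eta> k (\<beta> k a) = 0"
    using a(1) by (simp add: cyc homs closed commutes)
  then have "from_sum k u = boundaries CP k"
    using a ma by (simp add: to_sum_hclass from_sum_hclass hclass_eq_zero closed)
      (auto simp: boundaries_iff homs closed intro!: bexI[of _ 0])
  then show "u \<in> a_kernel (sum_homology k) (homology CP k) (from_sum k)"
    using a ma by (auto simp: a_kernel_def' to_sum_hclass homology_simps)
next
  fix u assume "u \<in> a_kernel (sum_homology k) (homology CP k) (from_sum k)"
  then obtain x y where x: "x \<in> cycles CX k" and y: "y \<in> cycles CY k" and u: "u = (hclass CX k x, hclass CY k y)"
    and "from_sum k u = boundaries CP k"
    by (auto simp: homology_simps a_kernel_def')
  then obtain w where w: "w \<in> carrier (chain_mod CP (k + 1))"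
    and weq: "\<gamma> k x + \<eta> k y = chain_diff CP (k + 1) w"
    by (auto simp: from_sum_hclass hclass_eq_zero closed cyc boundaries_iff)
  have xc: "x \<in> carrier (chain_mod CX k)" "chain_diff CX k x = 0"
    and yc: "y \<in> carrier (chain_mod CY k)" "chain_diff CY k y = 0" using x y by (auto simp: cyc)
  have "chain_diff CX k x \<in> \<alpha> (k - 1) ` carrier (chain_mod CA (k - 1))"
    using xc by (auto simp: homs closed intro!: image_eqI[of _ _ 0])
  moreover have "\<gamma> k x = \<eta> k (- y) + chain_diff CP (k + 1) w"
    using weq yc by (simp add: homs Suc_commuted algebra_simps)
  ultimately obtain a e' where a: "a \<in> carrier (chain_mod CA k)" and e': "e' \<in> carrier (chain_mod CX (k + 1))"
    and xeq: "x = \<alpha> k a + chain_diff CX (k + 1) e'"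
    using rel_inj[OF xc(1), of w "\<eta> k (- y)"] w yc by (auto simp: closed)
  \<comment> \<open>Removing \<open>\<gamma> e'\<close> leaves a chain whose boundary comes from
    \<open>CY\<close>, that is, a relative cycle to which \<open>rel_surj\<close> applies.\<close>
  define v where "v = w - \<gamma> (k + 1) e'"
  have v: "v \<in> carrier (chain_mod CP (k + 1))" using w e' by (simp add: v_def closed)
  have dv: "chain_diff CP (k + 1) v = \<eta> k (\<beta> k a + y)"
    using w e' a yc weq[symmetric] xeq
    by (simp add: v_def homs closed map_diff_Suc commutes Suc_commuted algebra_simps)
  then have "chain_diff CP (k + 1) v \<in> \<eta> (k + 1 - 1) ` carrier (chain_mod CY (k + 1 - 1))"
    using a yc by (simp add: closed)
  from rel_surj[OF v this] obtain c a' y' e where c: "c \<in> carrier (chain_mod CX (k + 1))"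
    and a': "a' \<in> carrier (chain_mod CA k)" and dc: "chain_diff CX (k + 1) c = \<alpha> k a'"
    and y': "y' \<in> carrier (chain_mod CY (k + 1))" and e: "e \<in> carrier (chain_mod CP (k + 1 + 1))"
    and veq: "v = \<eta> (k + 1) y' + (chain_diff CP (k + 1 + 1) e + \<gamma> (k + 1) c)"
    by auto
  have "chain_diff CP (k + 1) v = \<eta> k (chain_diff CY (k + 1) y' + \<beta> k a')"
    using c y' e a' diff_Suc(3)[OF scaled(4), of e "k + 1"] diff_closed(4)[OF e]
    by (simp add: veq homs closed map_diff_Suc[symmetric] dc commutes ops)
  then have "\<eta> k (\<beta> k a + y - (chain_diff CY (k + 1) y' + \<beta> k a')) = 0"
    using dv a a' yc y' by (simp add: homs closed)
  then have yeq: "\<beta> k a + y - (chain_diff CY (k + 1) y' + \<beta> k a') = 0"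
    using a a' yc y' by (intro inj_\<eta>[of _ k]) (simp_all add: closed)
  \<comment> \<open>\<open>a\<close> accounts for \<open>x\<close>, and \<open>a'\<close> is the
    correction that \<open>y\<close> requires; the order of the difference matches the sign of
    \<open>\<alpha>\<close> in \<open>to_sum\<close>.\<close>
  define b where "b = a' - a"
  have "\<alpha> (k - 1) (chain_diff CA k b) = chain_diff CX k (chain_diff CX (k + 1) c) - chain_diff CX k x"
    using a a' c e' by (simp add: b_def homs closed map_diff dc xeq diff_diff)
  then have "chain_diff CA k b = 0"
    using a a' c xc inj_\<alpha>[of "chain_diff CA k b" "k - 1"] by (simp add: b_def closed diff_diff)
  then have bz: "b \<in> cycles CA k" using a a' by (simp add: b_def cyc closed)
  have "hclass CX k x = hclass CX k (- \<alpha> k b)"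
    using a a' xc c e'
    by (subst hclass_eq) (auto simp: b_def closed homs xeq dc[symmetric] Suc_commuted algebra_simps intro!: bexI[of _ "e' + c"])
  moreover have "hclass CY k y = hclass CY k (\<beta> k b)"
    using a a' yc y' yeq
    by (subst hclass_eq) (auto simp: b_def closed homs Suc_commuted algebra_simps intro!: bexI[of _ "y'"])
  ultimately have "u = to_sum k (hclass CA k b)" using bz u by (simp add: to_sum_hclass)
  then show "u \<in> to_sum k ` carrier (homology CA k)"
    using bz by (auto simp: homology_simps)
qed

text \<open>If \<open>a = \<partial>b\<close>, subtracting \<open>\<alpha> b\<close> from
  \<open>c\<close> and adding \<open>\<beta> b\<close> to \<open>y\<close> turns both into cycles
  without changing \<open>\<gamma> c + \<eta> y\<close>, because the square commutes.\<close>

lemma exact_at_total: "exact_at (sum_homology k) (from_sum k) (homology CP k) (connecting_map k) (homology CA (k - 1))"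
  unfolding exact_at_def
proof (intro conjI connecting_map_hom from_sum_hom equalityI subsetI)
  fix u assume "u \<in> from_sum k ` carrier (sum_homology k)"
  then obtain x y where x: "x \<in> cycles CX k" and y: "y \<in> cycles CY k" and u: "u = hclass CP k (\<gamma> k x + \<eta> k y)"
    by (auto simp: homology_simps from_sum_hclass)
  have z: "\<gamma> k x + \<eta> k y \<in> cycles CP k"
    using maps_cycles(3)[OF x] maps_cycles(4)[OF y] by (auto simp: cyc homs closed)
  have "connecting k (\<gamma> k x + \<eta> k y) 0"
    unfolding connecting_def using x y
    by (intro conjI bexI[of _ x] bexI[of _ y] bexI[of _ 0]) (auto simp: cyc homs closed)
  from connecting_map_hclass[OF z this] have "connecting_map k u = boundaries CA (k - 1)"
    by (simp add: u hclass_eq_zero closed) (auto simp: boundaries_iff homs closed intro!: bexI[of _ 0])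
  then show "u \<in> a_kernel (homology CP k) (homology CA (k - 1)) (connecting_map k)"
    using z u by (auto simp: a_kernel_def' homology_simps)
next
  fix u assume "u \<in> a_kernel (homology CP k) (homology CA (k - 1)) (connecting_map k)"
  then have u: "u \<in> carrier (homology CP k)" "connecting_map k u = boundaries CA (k - 1)"
    by (auto simp: a_kernel_def' homology_simps)
  from u(1) obtain z a where z: "z \<in> cycles CP k" "u = hclass CP k z" and con: "connecting k z a"
    and "connecting_map k u = hclass CA (k - 1) a" "a \<in> cycles CA (k - 1)"
    by (rule connecting_map_cases)
  then have "a \<in> boundaries CA (k - 1)" using u(2) by (simp add: hclass_eq_zero cyc)
  then obtain b where b: "b \<in> carrier (chain_mod CA k)" "a = chain_diff CA k b"
    by (auto simp: boundaries_iff)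
  obtain c y e where c: "c \<in> carrier (chain_mod CX k)" and y: "y \<in> carrier (chain_mod CY k)"
    and e: "e \<in> carrier (chain_mod CP (k + 1))"
    and eq: "z = \<eta> k y + (chain_diff CP (k + 1) e + \<gamma> k c)"
    and dc: "chain_diff CX k c = \<alpha> (k - 1) a" and a: "a \<in> carrier (chain_mod CA (k - 1))"
    using con by (auto simp: connecting_def)
  have "c - \<alpha> k b \<in> cycles CX k"
    using b c dc by (simp add: cyc closed homs map_diff)
  moreover have "y + \<beta> k b \<in> cycles CY k"
    using connecting_\<beta>[OF z(1) eq dc a c y e] b y by (simp add: cyc closed homs map_diff[symmetric])
  moreover have "hclass CP k z = hclass CP k (\<gamma> k (c - \<alpha> k b) + \<eta> k (y + \<beta> k b))"
    using b c y e
    by (subst hclass_eq) (auto simp: eq closed homs commutes Suc_commuted algebra_simps intro!: bexI[of _ e])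
  ultimately have "u = from_sum k (hclass CX k (c - \<alpha> k b), hclass CY k (y + \<beta> k b))"
    using z(2) by (simp add: from_sum_hclass)
  then show "u \<in> from_sum k ` carrier (sum_homology k)"
    using \<open>c - \<alpha> k b \<in> cycles CX k\<close> \<open>y + \<beta> k b \<in> cycles CY k\<close> by (auto simp: homology_simps)
qed

text \<open>Chains bounding \<open>- \<alpha> a\<close> and \<open>\<beta> a\<close> glue, up to
  sign, to a cycle of \<open>CP\<close> that \<open>connecting\<close> relates to
  \<open>a\<close>.\<close>

lemma exact_at_intersection:
  "exact_at (homology CP k) (connecting_map k) (homology CA (k - 1)) (to_sum (k - 1)) (sum_homology (k - 1))"
  unfolding exact_at_def
proof (intro conjI connecting_map_hom to_sum_hom equalityI subsetI)
  fix v assume "v \<in> connecting_map k ` carrier (homology CP k)"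
  then obtain u where u: "u \<in> carrier (homology CP k)" "v = connecting_map k u" by blast
  from u(1) obtain z a where z: "z \<in> cycles CP k" and con: "connecting k z a"
    and va: "connecting_map k u = hclass CA (k - 1) a" and a: "a \<in> cycles CA (k - 1)"
    by (rule connecting_map_cases)
  obtain c y e where c: "c \<in> carrier (chain_mod CX k)" and y: "y \<in> carrier (chain_mod CY k)"
    and e: "e \<in> carrier (chain_mod CP (k + 1))"
    and eq: "z = \<eta> k y + (chain_diff CP (k + 1) e + \<gamma> k c)"
    and dc: "chain_diff CX k c = \<alpha> (k - 1) a" and ac: "a \<in> carrier (chain_mod CA (k - 1))"
    using con by (auto simp: connecting_def)
  have "- \<alpha> (k - 1) a = chain_diff CX k (- c)" "\<beta> (k - 1) a = chain_diff CY k (- y)"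
    using connecting_\<beta>[OF z eq dc ac c y e] c y dc by (simp_all add: homs)
  then have "to_sum (k - 1) v = (boundaries CX (k - 1), boundaries CY (k - 1))"
    using a ac c y u(2) va by (simp add: to_sum_hclass hclass_eq_zero closed)
      (auto simp: boundaries_iff closed intro!: bexI[of _ "- c"] bexI[of _ "- y"])
  then show "v \<in> a_kernel (homology CA (k - 1)) (sum_homology (k - 1)) (to_sum (k - 1))"
    using a u(2) va by (auto simp: a_kernel_def' homology_simps)
next
  fix v assume "v \<in> a_kernel (homology CA (k - 1)) (sum_homology (k - 1)) (to_sum (k - 1))"
  then obtain a where a: "a \<in> cycles CA (k - 1)" "v = hclass CA (k - 1) a"
    and "to_sum (k - 1) v = (boundaries CX (k - 1), boundaries CY (k - 1))"
    by (auto simp: a_kernel_def' homology_simps)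
  moreover have ac: "a \<in> carrier (chain_mod CA (k - 1))" using a by (simp add: cyc)
  ultimately have "- \<alpha> (k - 1) a \<in> boundaries CX (k - 1)" "\<beta> (k - 1) a \<in> boundaries CY (k - 1)"
    by (auto simp: to_sum_hclass hclass_eq_zero closed)
  then obtain c y where c: "c \<in> carrier (chain_mod CX k)" "- \<alpha> (k - 1) a = chain_diff CX k c"
    and y: "y \<in> carrier (chain_mod CY k)" "\<beta> (k - 1) a = chain_diff CY k y"
    by (auto simp: boundaries_iff)
  have dc: "chain_diff CX k (- c) = \<alpha> (k - 1) a" using c by (simp add: homs flip: c(2))
  define z where "z = \<eta> k (- y) + \<gamma> k (- c)"
  have z: "z \<in> cycles CP k"
    using c y ac dc by (simp add: z_def cyc closed homs map_diff[symmetric] commutes flip: c(2) y(2))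
  have con: "connecting k z a"
    unfolding connecting_def using c y ac dc
    by (intro conjI bexI[of _ "- c"] bexI[of _ "- y"] bexI[of _ 0]) (auto simp: z_def closed homs)
  have "v = connecting_map k (hclass CP k z)"
    using connecting_map_hclass[OF z con] a by simp
  then show "v \<in> connecting_map k ` carrier (homology CP k)"
    using z by (auto simp: homology_simps)
qed

end

section \<open>Reachability in the pushout\<close>

text \<open>Stationary steps are absorbed by reflexivity of the closure; the condition on
  \<open>u\<close> rules out the trivial path at a point that is not a vertex.\<close>

lemma has_path_iff_rtrancl:
  assumes "pair_wf_digraph G"
  shows "has_path G u v \<longleftrightarrow> u \<in> pverts G \<and> (u, v) \<in> (parcs G)\<^sup>*"
proof
  assume "has_path G u v"
  then obtain p where p: "dipath G p" "hd p = u" "last p = v" by (auto simp: has_path_def)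
  then have "u \<in> pverts G" by (auto simp: dipath_def)
  moreover have "(hd p, last p) \<in> (parcs G)\<^sup>*"
    if "p \<noteq> []" "successively (\<lambda>u v. u = v \<or> (u, v) \<in> parcs G) p" for p
    using that
  proof (induction p)
    case (Cons a p)
    then show ?case
      by (cases "p = []") (auto simp: successively_Cons intro: converse_rtrancl_into_rtrancl)
  qed simp
  ultimately show "u \<in> pverts G \<and> (u, v) \<in> (parcs G)\<^sup>*" using p by (auto simp: dipath_def)
next
  assume uv: "u \<in> pverts G \<and> (u, v) \<in> (parcs G)\<^sup>*"
  then have "(u, v) \<in> (parcs G)\<^sup>*" and "u \<in> pverts G" by auto
  then show "has_path G u v"
  proof (induction rule: rtrancl_induct)
    case base
    then show ?case
      unfolding has_path_def by (intro exI[of _ "[u]"]) (auto simp: dipath_def)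
  next
    case (step w v)
    then obtain p where "dipath G p" "hd p = u" "last p = w" by (auto simp: has_path_def)
    moreover have "v \<in> pverts G" using step assms by (auto dest: pair_wf_digraph.in_arcsD2)
    ultimately show ?case
      unfolding has_path_def using step
      by (intro exI[of _ "p @ [v]"]) (auto simp: dipath_def successively_append_iff)
  qed
qed

lemma has_path_pverts:
  assumes "has_path G u v"
  shows "u \<in> pverts G" "v \<in> pverts G"
  using assms by (auto simp: has_path_def dipath_def)

lemma has_path_refl: "u \<in> pverts G \<Longrightarrow> has_path G u u"
  unfolding has_path_def by (rule exI[of _ "[u]"]) (simp add: dipath_def)

lemma has_path_arc:
  assumes "pair_wf_digraph G" "(u, v) \<in> parcs G"
  shows "has_path G u v"
  using assms by (auto simp: has_path_iff_rtrancl dest: pair_wf_digraph.in_arcsD1)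

lemma has_path_trans:
  assumes "pair_wf_digraph G" "has_path G u v" "has_path G v w"
  shows "has_path G u w"
  using assms by (auto simp: has_path_iff_rtrancl)

lemma digraph_map_has_path:
  assumes G: "pair_wf_digraph G" and H: "pair_wf_digraph H" and f: "digraph_map G H f"
    and "has_path G u v"
  shows "has_path H (f u) (f v)"
proof -
  have "(u, v) \<in> (parcs G)\<^sup>*" "f u \<in> pverts H"
    using assms(4) f by (auto simp: has_path_iff_rtrancl[OF G] digraph_map_def)
  then have "(f u, f v) \<in> (parcs H)\<^sup>*"
    using f by (induction rule: rtrancl_induct)
      (auto simp: digraph_map_def dest!: bspec intro: rtrancl_into_rtrancl)
  then show ?thesis using \<open>f u \<in> pverts H\<close> by (simp add: has_path_iff_rtrancl[OF H])
qed

lemma long_cofibration_arcs: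
  assumes "long_cofibration A X"
  shows "pverts A \<subseteq> pverts X" "pair_wf_digraph A"
    "parcs A = {(u, v) \<in> parcs X. u \<in> pverts A \<and> v \<in> pverts A}"
proof -
  have ind: "induced_subgraph (with_proj A) (with_proj X)"
    using assms by (simp add: long_cofibration_def)
  then show "pverts A \<subseteq> pverts X" "parcs A = {(u, v) \<in> parcs X. u \<in> pverts A \<and> v \<in> pverts A}"
    by (auto simp: induced_subgraph_def subgraph_def)
  have "wf_digraph (with_proj A)" using ind by (auto simp: induced_subgraph_def subgraph_def)
  then show "pair_wf_digraph A"
    by (auto simp: pair_wf_digraph_def wf_digraph_def)
qed

text \<open>A path that leaves \<open>A\<close> cannot come back, and \<open>A\<close> is induced,
  so a path of \<open>X\<close> between vertices of \<open>A\<close> is one of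
  \<open>A\<close>.\<close>

lemma long_cofibration_has_path:
  assumes X: "pair_wf_digraph X" and A: "long_cofibration A X" and a: "a \<in> pverts A" "b \<in> pverts A"
  shows "has_path A a b \<longleftrightarrow> has_path X a b"
proof
  note A' = long_cofibration_arcs[OF A]
  assume "has_path A a b"
  then have "has_path X (id a) (id b)"
    by (rule digraph_map_has_path[OF A'(2) X, rotated]) (use A' in \<open>auto simp: digraph_map_def\<close>)
  then show "has_path X a b" by simp
next
  note A' = long_cofibration_arcs[OF A]
  assume "has_path X a b"
  then have "(a, b) \<in> (parcs X)\<^sup>*" by (simp add: has_path_iff_rtrancl[OF X])
  then have "a \<in> pverts A \<longrightarrow> has_path A a b"
  proof (induction rule: converse_rtrancl_induct)
    case (step u v)
    have "has_path X v b" using step X by (auto simp: has_path_iff_rtrancl dest: pair_wf_digraph.in_arcsD2)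
    moreover have "v \<in> pverts X" using step X by (auto dest: pair_wf_digraph.in_arcsD2)
    ultimately have "v \<in> pverts A" using A a(2) by (auto simp: long_cofibration_def)
    then show ?case
      using step A' by (auto intro: has_path_trans[OF A'(2) has_path_arc[OF A'(2)]])
  qed (use a(2) has_path_refl in auto)
  then show "has_path A a b" using a(1) by simp
qed

section \<open>Vertices, arcs and paths of the pushout\<close>

locale cofibration_pushout =
  fixes A X :: "'x pair_pre_digraph" and Y :: "'y pair_pre_digraph" and P :: "'p pair_pre_digraph"
    and f :: "'x \<Rightarrow> 'y" and g :: "'x \<Rightarrow> 'p" and j :: "'y \<Rightarrow> 'p"
  assumes X: "pair_wf_digraph X" and Y: "pair_wf_digraph Y"
    and cofib: "long_cofibration A X"
    and f: "digraph_map A Y f"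
    and pushout: "is_pushout A X Y (\<lambda>a. a) f P g j"
begin

lemmas AX = long_cofibration_arcs[OF cofib]

lemma pushout_maps:
  shows P: "pair_wf_digraph P" and g: "digraph_map X P g" and j: "digraph_map Y P j"
    and gj: "a \<in> pverts A \<Longrightarrow> g a = j (f a)"
  using pushout by (auto simp: is_pushout_def is_cocone_def)

lemma f_vert: "a \<in> pverts A \<Longrightarrow> f a \<in> pverts Y"
  and g_vert: "x \<in> pverts X \<Longrightarrow> g x \<in> pverts P"
  and j_vert: "y \<in> pverts Y \<Longrightarrow> j y \<in> pverts P"
  using f g j by (auto simp: digraph_map_def)

text \<open>\<open>P\<close> is given only by its universal property, so its structure is read off
  by mapping it to test graphs, whose vertex type is free here.\<close>

lemma pushout_factor:
  fixes H :: "'h pair_pre_digraph"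
  assumes "pair_wf_digraph H" "digraph_map X H u" "digraph_map Y H v"
    and "\<And>a. a \<in> pverts A \<Longrightarrow> u a = v (f a)"
  obtains h where "digraph_map P H h" "\<And>x. x \<in> pverts X \<Longrightarrow> h (g x) = u x"
    "\<And>y. y \<in> pverts Y \<Longrightarrow> h (j y) = v y"
  using pushout_universal[OF X Y pushout, of H u v] assms
  by (auto simp: is_cocone_def factors_through_def)

text \<open>Mapping to the indiscrete graph on \<open>'y option\<close>, with \<open>X - A\<close> going to \<open>None\<close>, separates the
  points of \<open>Y\<close> from each other and from \<open>X - A\<close>; symmetrically for \<open>X - A\<close> and \<open>'x option\<close>.\<close>

lemma pushout_separates:
  shows inj_j: "inj_on j (pverts Y)" and inj_g: "inj_on g (pverts X - pverts A)"
    and g_neq_j: "x \<in> pverts X - pverts A \<Longrightarrow> y \<in> pverts Y \<Longrightarrow> g x \<noteq> j y"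
proof -
  obtain h where h: "\<And>x. x \<in> pverts X \<Longrightarrow> h (g x) = (if x \<in> pverts A then Some (f x) else None)"
    "\<And>y. y \<in> pverts Y \<Longrightarrow> h (j y) = Some y"
    by (rule pushout_factor[of "\<lparr>pverts = UNIV, parcs = UNIV\<rparr>"
          "\<lambda>x. if x \<in> pverts A then Some (f x) else None" Some])
      (auto simp: digraph_map_def pair_wf_digraph_def)
  show "inj_on j (pverts Y)" using h(2) by (metis inj_onI option.inject)
  show "x \<in> pverts X - pverts A \<Longrightarrow> y \<in> pverts Y \<Longrightarrow> g x \<noteq> j y"
    using h by (metis DiffD1 DiffD2 option.distinct(1))
  obtain h' where h': "\<And>x. x \<in> pverts X \<Longrightarrow> h' (g x) = (if x \<in> pverts A then None else Some x)"
    by (rule pushout_factor[of "\<lparr>pverts = UNIV, parcs = UNIV\<rparr>"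
          "\<lambda>x. if x \<in> pverts A then None else Some x" "\<lambda>y. None"])
      (auto simp: digraph_map_def pair_wf_digraph_def)
  show "inj_on g (pverts X - pverts A)"
    using h' by (metis (no_types, lifting) DiffD1 DiffD2 inj_onI option.inject)
qed

text \<open>The test graph keeps the vertices of \<open>P\<close> but only the arcs that come from
  \<open>X\<close> and \<open>Y\<close>. The induced map fixes every vertex, because
  \<open>X\<close> and \<open>Y\<close> cover \<open>P\<close>, so an arc of \<open>P\<close>
  survives in the test graph unless its ends agree. The exception cannot be avoided: maps of
  directed graphs do not see loops, and neither does the universal property.\<close>

lemma pushout_arc_cases:
  assumes "(p, q) \<in> parcs P"
  obtains "p = q" | u v where "(u, v) \<in> parcs X" "p = g u" "q = g v"
    | u v where "(u, v) \<in> parcs Y" "p = j u" "q = j v"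
proof -
  define H where "H = \<lparr>pverts = pverts P, parcs = (\<lambda>(u, v). (g u, g v)) ` parcs X \<union> (\<lambda>(u, v). (j u, j v)) ` parcs Y\<rparr>"
  have "pair_wf_digraph H"
    using pair_wf_digraph.in_arcsD1[OF X] pair_wf_digraph.in_arcsD2[OF X]
      pair_wf_digraph.in_arcsD1[OF Y] pair_wf_digraph.in_arcsD2[OF Y]
    by (auto simp: H_def pair_wf_digraph_def g_vert j_vert)
  moreover have "digraph_map X H g" "digraph_map Y H j"
    using g_vert j_vert by (auto simp: H_def digraph_map_def intro!: image_eqI)
  ultimately obtain h where h: "digraph_map P H h" "\<And>x. x \<in> pverts X \<Longrightarrow> h (g x) = g x"
    "\<And>y. y \<in> pverts Y \<Longrightarrow> h (j y) = j y"
    using pushout_factor[of H g j] gj by metis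
  have "h p = p" if "p \<in> pverts P" for p
    using pushout_cover[OF pushout] h(2,3) that by fastforce
  then have "p = q \<or> (p, q) \<in> parcs H"
    using h(1) assms pair_wf_digraph.in_arcsD1[OF P assms] pair_wf_digraph.in_arcsD2[OF P assms]
    by (auto simp: digraph_map_def dest!: bspec[of _ _ "(p, q)"])
  then show thesis using that by (auto simp: H_def)
qed

lemma no_path_into_A: "has_path X x a \<Longrightarrow> a \<in> pverts A \<Longrightarrow> x \<in> pverts A"
  using cofib has_path_pverts(1)[of X x a] by (auto simp: long_cofibration_def)

text \<open>An arc of \<open>X\<close> can end in \<open>j Y\<close> only at a vertex of
  \<open>A\<close>; it then starts in \<open>A\<close> too, and \<open>f\<close> carries it to
  \<open>Y\<close>.\<close>

lemma arc_into_Y: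
  assumes "(p, j y') \<in> parcs P" "y' \<in> pverts Y"
  obtains y where "y \<in> pverts Y" "p = j y" "has_path Y y y'"
  using assms(1)
proof (cases rule: pushout_arc_cases)
  case 1
  then show thesis by (rule that[OF assms(2) _ has_path_refl[OF assms(2)]])
next
  case (2 u v)
  have v: "v \<in> pverts A"
    using g_neq_j[of v y'] 2 assms(2) pair_wf_digraph.in_arcsD2[OF X 2(1)] by auto
  then have u: "u \<in> pverts A" using no_path_into_A has_path_arc[OF X 2(1)] by blast
  have "f v = y'" using v 2 gj inj_onD[OF inj_j] f_vert assms(2) by metis
  moreover have "has_path A u v" using u v 2 AX by (intro has_path_arc) auto
  ultimately have "has_path Y (f u) y'" using digraph_map_has_path[OF AX(2) Y f] by blast
  then show thesis using that[of "f u"] f_vert[OF u] gj[OF u] 2 by simp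
next
  case (3 u v)
  have "v = y'" using 3 assms(2) inj_onD[OF inj_j] pair_wf_digraph.in_arcsD2[OF Y 3(1)] by metis
  then show thesis using that[of u] 3 has_path_arc[OF Y] pair_wf_digraph.in_arcsD1[OF Y 3(1)] by blast
qed

lemma path_into_Y:
  assumes "has_path P p (j y')" "y' \<in> pverts Y"
  obtains y where "y \<in> pverts Y" "p = j y" "has_path Y y y'"
proof -
  have "(p, j y') \<in> (parcs P)\<^sup>*" using assms by (simp add: has_path_iff_rtrancl[OF P])
  then have "\<exists>y \<in> pverts Y. p = j y \<and> has_path Y y y'"
  proof (induction rule: converse_rtrancl_induct)
    case base
    show ?case using assms(2) has_path_refl[OF assms(2)] by blast
  next
    case (step p q)
    then obtain y where "y \<in> pverts Y" "q = j y" "has_path Y y y'" by blast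
    then show ?case using step(1) arc_into_Y[of p y] has_path_trans[OF Y] by metis
  qed
  then show thesis using that by blast
qed

text \<open>Read backwards from \<open>g x\<close>, a path runs in \<open>X - A\<close> until it
  uses an arc of \<open>X\<close> that starts at some \<open>a\<close> in \<open>A\<close>; by
  \<open>arc_into_Y\<close> all that precedes lies in \<open>Y\<close>.\<close>

lemma path_into_X:
  assumes "has_path P p (g x)" "x \<in> pverts X - pverts A"
  shows "(\<exists>x' \<in> pverts X - pverts A. p = g x' \<and> has_path X x' x) \<or>
    (\<exists>y \<in> pverts Y. \<exists>a \<in> pverts A. p = j y \<and> has_path Y y (f a) \<and> has_path X a x)"
proof -
  have "(p, g x) \<in> (parcs P)\<^sup>*" using assms by (simp add: has_path_iff_rtrancl[OF P])
  then show ?thesis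
  proof (induction rule: converse_rtrancl_induct)
    case base
    show ?case using assms(2) has_path_refl[of x X] by blast
  next
    case (step p q)
    from step(3) show ?case
    proof
      assume "\<exists>x' \<in> pverts X - pverts A. q = g x' \<and> has_path X x' x"
      then obtain x' where x': "x' \<in> pverts X - pverts A" "q = g x'" "has_path X x' x" by blast
      from step(1) show ?thesis
      proof (cases rule: pushout_arc_cases)
        case 1
        then show ?thesis using x' by blast
      next
        case (2 u v)
        have u: "u \<in> pverts X" and v: "v \<in> pverts X"
          using pair_wf_digraph.in_arcsD1[OF X 2(1)] pair_wf_digraph.in_arcsD2[OF X 2(1)] .
        have "v \<notin> pverts A" using g_neq_j[OF x'(1), of "f v"] f_vert gj 2 x' by metis
        then have "v = x'" using inj_onD[OF inj_g] 2 x' v by (metis DiffI)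
        then have "has_path X u x" using has_path_trans[OF X has_path_arc[OF X]] 2 x' by blast
        then show ?thesis
          using 2 u has_path_refl[of "f u" Y] f_vert[of u] gj[of u] by (cases "u \<in> pverts A") auto
      next
        case (3 u v)
        then show ?thesis using g_neq_j[OF x'(1), of v] x' pair_wf_digraph.in_arcsD2[OF Y 3(1)] by simp
      qed
    next
      assume "\<exists>y \<in> pverts Y. \<exists>a \<in> pverts A. q = j y \<and> has_path Y y (f a) \<and> has_path X a x"
      then obtain y a where y: "y \<in> pverts Y" "a \<in> pverts A" "q = j y" "has_path Y y (f a)" "has_path X a x"
        by blast
      then obtain y0 where "y0 \<in> pverts Y" "p = j y0" "has_path Y y0 y"
        using arc_into_Y[of p y] step(1) by metis
      then show ?thesis using y has_path_trans[OF Y] by blast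
    qed
  qed
qed

lemma path_j_iff: "y \<in> pverts Y \<Longrightarrow> y' \<in> pverts Y \<Longrightarrow> has_path P (j y) (j y') \<longleftrightarrow> has_path Y y y'"
  using path_into_Y digraph_map_has_path[OF Y P j] inj_onD[OF inj_j] by metis

lemma path_g_iff:
  assumes x: "x \<in> pverts X - pverts A" and x': "x' \<in> pverts X - pverts A"
  shows "has_path P (g x) (g x') \<longleftrightarrow> has_path X x x'"
proof
  assume "has_path P (g x) (g x')"
  from path_into_X[OF this x'] show "has_path X x x'"
    using inj_onD[OF inj_g] x g_neq_j[OF x] by metis
qed (rule digraph_map_has_path[OF X P g])

lemma path_j_g_iff:
  assumes y: "y \<in> pverts Y" and x: "x \<in> pverts X - pverts A"
  shows "has_path P (j y) (g x) \<longleftrightarrow> (\<exists>a \<in> pverts A. has_path Y y (f a) \<and> has_path X a x)"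
proof
  assume "has_path P (j y) (g x)"
  from path_into_X[OF this x] show "\<exists>a \<in> pverts A. has_path Y y (f a) \<and> has_path X a x"
    using inj_onD[OF inj_j] y g_neq_j by metis
next
  assume "\<exists>a \<in> pverts A. has_path Y y (f a) \<and> has_path X a x"
  then obtain a where a: "a \<in> pverts A" "has_path Y y (f a)" "has_path X a x" by blast
  then show "has_path P (j y) (g x)"
    using digraph_map_has_path[OF Y P j a(2)] digraph_map_has_path[OF X P g a(3)] gj[OF a(1)]
      has_path_trans[OF P] by metis
qed

text \<open>The vertex provided by a long cofibration is determined only up to mutual reachability,
  so for \<open>x\<close> in \<open>A\<close> a choice need not return \<open>x\<close>. Fixing
  \<open>A\<close> pointwise is what later makes the prism operator vanish on chains of
  \<open>A\<close>.\<close>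

definition \<pi> :: "'x \<Rightarrow> 'x" where
  "\<pi> x = (if x \<in> pverts A then x
    else (SOME p. p \<in> pverts A \<and> (\<forall>a \<in> pverts A. has_path X a x \<longleftrightarrow> has_path X a p)))"

end

section \<open>Retractions of a reach\<close>

text \<open>The part of a long cofibration that only depends on reachability. It applies to \<open>Y\<close> in \<open>P\<close>, where
  the literal \<^const>\<open>long_cofibration\<close> can fail because of loops.\<close>

locale reach_retraction =
  fixes G :: "'v pair_pre_digraph" and B S :: "'v set" and \<rho> :: "'v \<Rightarrow> 'v"
  assumes G: "pair_wf_digraph G" and B: "B \<subseteq> pverts G"
    and into_B: "has_path G x b \<Longrightarrow> b \<in> B \<Longrightarrow> x \<in> B"
    and S: "S = {x. \<exists>b \<in> B. has_path G b x}"
    and \<rho>_in: "x \<in> S \<Longrightarrow> \<rho> x \<in> B"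
    and \<rho>_id: "x \<in> B \<Longrightarrow> \<rho> x = x"
    and \<rho>: "x \<in> S \<Longrightarrow> b \<in> B \<Longrightarrow> has_path G b x \<longleftrightarrow> has_path G b (\<rho> x)"
begin

lemma S_verts: "S \<subseteq> pverts G"
  by (auto simp: S dest: has_path_pverts(2))

lemma B_S: "B \<subseteq> S"
  using B has_path_refl[of _ G] by (auto simp: S)

lemma S_up: "x \<in> S \<Longrightarrow> has_path G x y \<Longrightarrow> y \<in> S"
  using has_path_trans[OF G] by (auto simp: S)

text \<open>The assumption \<open>\<rho>\<close> says that \<open>\<rho>\<close> is right adjoint to
  the inclusion of \<open>B\<close> into \<open>S\<close>, for the preorder of reachability. This is
  the counit; \<open>\<rho>_mono\<close> then follows as for any adjoint.\<close>

lemma \<rho>_below: "x \<in> S \<Longrightarrow> has_path G (\<rho> x) x"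
  using \<rho>[of x "\<rho> x"] \<rho>_in[of x] B has_path_refl[of "\<rho> x" G] by blast

lemma \<rho>_mono:
  assumes "x \<in> S" "has_path G x y"
  shows "has_path G (\<rho> x) (\<rho> y)"
  using \<rho>[OF S_up[OF assms] \<rho>_in[OF assms(1)]] has_path_trans[OF G \<rho>_below[OF assms(1)] assms(2)] by blast

end

context cofibration_pushout
begin

lemma \<pi>:
  assumes "x \<in> reach_verts A X"
  shows "\<pi> x \<in> pverts A" "a \<in> pverts A \<Longrightarrow> has_path X a x \<longleftrightarrow> has_path X a (\<pi> x)"
proof -
  have "\<exists>p. p \<in> pverts A \<and> (\<forall>a \<in> pverts A. has_path X a x \<longleftrightarrow> has_path X a p)"
    using cofib assms by (auto simp: long_cofibration_def)
  from someI_ex[OF this] show "\<pi> x \<in> pverts A" "a \<in> pverts A \<Longrightarrow> has_path X a x \<longleftrightarrow> has_path X a (\<pi> x)"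
    by (auto simp: \<pi>_def)
qed

lemma reach_retraction_A: "reach_retraction X (pverts A) (reach_verts A X) \<pi>"
proof (rule reach_retraction.intro)
  show "reach_verts A X = {x. \<exists>b \<in> pverts A. has_path X b x}"
    by (auto simp: reach_verts_def dest: has_path_pverts(2))
  show "x \<in> pverts A" if "has_path X x b" "b \<in> pverts A" for x b
    using no_path_into_A that .
  show "\<pi> x = x" if "x \<in> pverts A" for x
    using that by (simp add: \<pi>_def)
qed (fact X AX(1) \<pi>)+

text \<open>The vertices of \<open>P\<close> reachable from \<open>j Y\<close>, described through
  \<open>X\<close> and \<open>Y\<close>; that the two sets agree is part of
  \<open>reach_retraction_Y\<close>.\<close>

definition reach_Y :: "'p set" where
  "reach_Y = j ` pverts Y \<union> g ` (reach_verts A X - pverts A)"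

text \<open>A vertex of \<open>P\<close> outside \<open>j Y\<close> is \<open>g x\<close> for
  exactly one \<open>x\<close> in \<open>X - A\<close>, as \<open>g\<close> is injective there, and
  its retract is taken from that of \<open>x\<close>.\<close>

definition \<pi>\<^sub>Y :: "'p \<Rightarrow> 'p" where
  "\<pi>\<^sub>Y p = (if p \<in> j ` pverts Y then p else g (\<pi> (inv_into (pverts X - pverts A) g p)))"

lemma \<pi>\<^sub>Y_g: "x \<in> pverts X - pverts A \<Longrightarrow> \<pi>\<^sub>Y (g x) = g (\<pi> x)"
  using g_neq_j inv_into_f_f[OF inj_g] by (auto simp: \<pi>\<^sub>Y_def)

lemma reach_sub: "reach_verts A X \<subseteq> pverts X"
  by (auto simp: reach_verts_def)

lemma g_\<pi>: "x \<in> reach_verts A X \<Longrightarrow> g (\<pi> x) = j (f (\<pi> x))"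
  using \<pi>(1) gj by blast

text \<open>A path from \<open>Y\<close> to \<open>g x\<close> crosses at some \<open>f a\<close>
  where \<open>a\<close> reaches \<open>x\<close>. Then \<open>a\<close> reaches
  \<open>\<pi> x\<close>, and \<open>f\<close> carries this path to \<open>Y\<close>, so
  \<open>f (\<pi> x)\<close> can serve as the crossing point of all of them.\<close>

lemma reach_retraction_Y: "reach_retraction P (j ` pverts Y) reach_Y \<pi>\<^sub>Y"
proof (rule reach_retraction.intro)
  show "pair_wf_digraph P" by (rule P)
  show "j ` pverts Y \<subseteq> pverts P" using j_vert by blast
  show "x \<in> j ` pverts Y" if "has_path P x b" "b \<in> j ` pverts Y" for x b
    using that path_into_Y by (metis image_iff)
  show "reach_Y = {p. \<exists>b \<in> j ` pverts Y. has_path P b p}"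
  proof (intro equalityI subsetI)
    fix p assume "p \<in> reach_Y"
    then consider y where "y \<in> pverts Y" "p = j y" | x where "x \<in> reach_verts A X - pverts A" "p = g x"
      by (auto simp: reach_Y_def)
    then show "p \<in> {p. \<exists>b \<in> j ` pverts Y. has_path P b p}"
    proof cases
      case 1
      then show ?thesis using has_path_refl[OF j_vert] by blast
    next
      case 2
      then obtain a where a: "a \<in> pverts A" "has_path X a x" by (auto simp: reach_verts_def)
      then have "has_path P (j (f a)) p"
        using digraph_map_has_path[OF X P g a(2)] gj 2 by simp
      then show ?thesis using f_vert[OF a(1)] by blast
    qed
  next
    fix p assume "p \<in> {p. \<exists>b \<in> j ` pverts Y. has_path P b p}"
    then obtain y where y: "y \<in> pverts Y" "has_path P (j y) p" by blast
    have "p \<in> g ` pverts X \<union> j ` pverts Y"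
      using pushout_cover[OF pushout] has_path_pverts[OF y(2)] by blast
    then consider "p \<in> j ` pverts Y" | x where "x \<in> pverts X - pverts A" "p = g x"
      using gj f_vert by force
    then show "p \<in> reach_Y"
    proof cases
      case 2
      then have "x \<in> reach_verts A X" using y path_j_g_iff by (auto simp: reach_verts_def)
      then show ?thesis using 2 by (auto simp: reach_Y_def)
    qed (auto simp: reach_Y_def)
  qed
  show "\<pi>\<^sub>Y p \<in> j ` pverts Y" if p: "p \<in> reach_Y" for p
  proof (cases "p \<in> j ` pverts Y")
    case False
    then obtain x where "x \<in> reach_verts A X - pverts A" "p = g x" using p by (auto simp: reach_Y_def)
    then show ?thesis using reach_sub \<pi>\<^sub>Y_g[of x] g_\<pi>[of x] f_vert[OF \<pi>(1)[of x]] by auto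
  qed (simp add: \<pi>\<^sub>Y_def)
  show "\<pi>\<^sub>Y p = p" if "p \<in> j ` pverts Y" for p using that by (simp add: \<pi>\<^sub>Y_def)
  show "has_path P b p \<longleftrightarrow> has_path P b (\<pi>\<^sub>Y p)" if p: "p \<in> reach_Y" and b: "b \<in> j ` pverts Y" for p b
  proof (cases "p \<in> j ` pverts Y")
    case False
    then obtain x where x: "x \<in> reach_verts A X - pverts A" "p = g x" using p by (auto simp: reach_Y_def)
    then have xX: "x \<in> pverts X - pverts A" using reach_sub by blast
    obtain y where y: "y \<in> pverts Y" "b = j y" using b by blast
    have \<pi>A: "\<pi> x \<in> pverts A" using x \<pi> by simp
    have "has_path P b (\<pi>\<^sub>Y p) \<longleftrightarrow> has_path Y y (f (\<pi> x))"
      using y x \<pi>\<^sub>Y_g[OF xX] g_\<pi>[of x] path_j_iff f_vert[OF \<pi>A] by simp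
    also have "\<dots> \<longleftrightarrow> (\<exists>a \<in> pverts A. has_path Y y (f a) \<and> has_path X a x)"
    proof
      assume "has_path Y y (f (\<pi> x))"
      moreover have "has_path X (\<pi> x) x" using \<pi>(2)[of x "\<pi> x"] x \<pi>A AX(1) has_path_refl[of "\<pi> x" X] by blast
      ultimately show "\<exists>a \<in> pverts A. has_path Y y (f a) \<and> has_path X a x" using \<pi>A by blast
    next
      assume "\<exists>a \<in> pverts A. has_path Y y (f a) \<and> has_path X a x"
      then obtain a where a: "a \<in> pverts A" "has_path Y y (f a)" "has_path X a x" by blast
      then have "has_path A a (\<pi> x)"
        using \<pi>(2)[of x a] x \<pi>A long_cofibration_has_path[OF X cofib] by simp
      then show "has_path Y y (f (\<pi> x))"
        by (rule has_path_trans[OF Y a(2) digraph_map_has_path[OF AX(2) Y f]])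
    qed
    finally show ?thesis using path_j_g_iff[OF y(1) xX] x y by simp
  qed (simp add: \<pi>\<^sub>Y_def)
qed

end

section \<open>Reachability chains and the prism operator\<close>

abbreviation scale :: "'r \<Rightarrow> ('b \<Rightarrow>\<^sub>0 'r) \<Rightarrow> 'b \<Rightarrow>\<^sub>0 'r::{comm_ring, comm_monoid_mult}" where
  "scale r \<equiv> Poly_Mapping.map ((*) r)"

lemma lookup_scale: "Poly_Mapping.lookup (scale r c) v = r * Poly_Mapping.lookup c v"
  by (transfer; simp add: when_def)

lemma scale_simps [simp]:
  "scale r 0 = 0" "scale 0 c = 0" "scale 1 c = c" "scale r (- c) = - scale r c"
  "scale r (scale s c) = scale (r * s) c"
  by (rule poly_mapping_eqI; simp add: lookup_scale mult.assoc)+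

lemma scale_add: "scale r (c + d) = scale r c + scale r d"
  by (rule poly_mapping_eqI) (simp add: lookup_scale lookup_add distrib_left)

lemma scale_diff: "scale r (c - d) = scale r c - scale r d"
  by (rule poly_mapping_eqI) (simp add: lookup_scale lookup_minus right_diff_distrib)

lemma scale_add_left: "scale (r + s) c = scale r c + scale s c"
  by (rule poly_mapping_eqI) (simp add: lookup_scale lookup_add distrib_right)

lemma scale_sum: "scale r (\<Sum>i\<in>I. c i) = (\<Sum>i\<in>I. scale r (c i))"
  by (rule poly_mapping_eqI) (simp add: lookup_scale lookup_sum sum_distrib_left)

lemma scale_single: "scale r (Poly_Mapping.single v s) = Poly_Mapping.single v (r * s)"
  by (rule poly_mapping_eqI) (simp add: lookup_scale lookup_single when_def)

lemma keys_scale: "Poly_Mapping.keys (scale r c) \<subseteq> Poly_Mapping.keys c"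
  by (auto simp: in_keys_iff lookup_scale)

section \<open>Linear extensions and coordinate projections\<close>

definition lin :: "('a \<Rightarrow> 'b \<Rightarrow>\<^sub>0 'r) \<Rightarrow> ('a \<Rightarrow>\<^sub>0 'r) \<Rightarrow> 'b \<Rightarrow>\<^sub>0 'r::{comm_ring, comm_monoid_mult}" where
  "lin F c = (\<Sum>v\<in>Poly_Mapping.keys c. scale (Poly_Mapping.lookup c v) (F v))"

abbreviation basis :: "'a \<Rightarrow> 'a \<Rightarrow>\<^sub>0 'r::{comm_ring, comm_monoid_mult}" where
  "basis v \<equiv> Poly_Mapping.single v 1"

text \<open>Cancellation can leave a sum with fewer keys than its summands, so expansions are
  compared over a common finite set.\<close>

lemma lin_superset:
  assumes "finite S" "Poly_Mapping.keys c \<subseteq> S"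
  shows "lin F c = (\<Sum>v\<in>S. scale (Poly_Mapping.lookup c v) (F v))"
  unfolding lin_def
  by (rule sum.mono_neutral_left) (use assms in \<open>auto simp: in_keys_iff\<close>)

lemma lin_add: "lin F (c + d) = lin F c + lin F d"
proof -
  let ?S = "Poly_Mapping.keys c \<union> Poly_Mapping.keys d"
  have "Poly_Mapping.keys (c + d) \<subseteq> ?S" by (rule Poly_Mapping.keys_add)
  then show ?thesis
    by (simp add: lin_superset[of ?S] lookup_add scale_add_left sum.distrib)
qed

lemma lin_zero [simp]: "lin F 0 = 0"
  by (simp add: lin_def)

lemma lin_uminus: "lin F (- c) = - lin F c"
  using lin_add[of F c "- c"] by (simp add: minus_unique)

lemma lin_diff: "lin F (c - d) = lin F c - lin F d"
  using lin_add[of F c "- d"] by (simp add: lin_uminus)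

lemma lin_sum: "lin F (\<Sum>i\<in>I. c i) = (\<Sum>i\<in>I. lin F (c i))"
  by (induction I rule: infinite_finite_induct) (simp_all add: lin_add)

lemma lin_scale: "lin F (scale r c) = scale r (lin F c)"
  using keys_scale[of r c]
  by (simp add: lin_superset[of "Poly_Mapping.keys c"] scale_sum lookup_scale)

lemma lin_single [simp]: "lin F (Poly_Mapping.single v r) = scale r (F v)"
  by (simp add: lin_superset[of "{v}"])

lemma lin_cong: "(\<And>v. v \<in> Poly_Mapping.keys c \<Longrightarrow> F v = G v) \<Longrightarrow> lin F c = lin G c"
  by (simp add: lin_def)

text \<open>Operators on chains are expressed by \<open>lin\<close>, so an identity between
  composites only has to be checked on tuples.\<close>

lemma lin_lin: "lin F (lin G c) = lin (\<lambda>v. lin F (G v)) c"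
  by (simp add: lin_def[of G] lin_def[of "\<lambda>v. lin F (G v)"] lin_sum lin_scale)

lemma lin_fun_add: "lin (\<lambda>v. F v + G v) c = lin F c + lin G c"
  by (simp add: lin_def scale_add sum.distrib)

lemma lin_fun_diff: "lin (\<lambda>v. F v - G v) c = lin F c - lin G c"
  by (simp add: lin_def scale_diff sum_subtractf)

lemma lin_basis [simp]: "lin basis c = c"
proof (rule poly_mapping_eqI)
  fix v
  show "Poly_Mapping.lookup (lin basis c) v = Poly_Mapping.lookup c v"
    by (simp add: lin_def lookup_sum lookup_scale lookup_single when_def if_distrib in_keys_iff cong: if_cong)
qed

lemma lin_fun_zero [simp]: "lin (\<lambda>v. 0) c = 0"
  by (simp add: lin_def)

lemma keys_sum_subset: "Poly_Mapping.keys (\<Sum>i\<in>I. c i) \<subseteq> (\<Union>i\<in>I. Poly_Mapping.keys (c i))"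
proof (induction I rule: infinite_finite_induct)
  case (insert i I)
  then show ?case using Poly_Mapping.keys_add[of "c i" "sum c I"] by auto
qed auto

lemma keys_lin: "Poly_Mapping.keys (lin F c) \<subseteq> (\<Union>v\<in>Poly_Mapping.keys c. Poly_Mapping.keys (F v))"
  using keys_sum_subset keys_scale unfolding lin_def by (fastforce simp: subset_iff)

lemma keys_diff_subset: "Poly_Mapping.keys (c - d :: _ \<Rightarrow>\<^sub>0 'r::ab_group_add) \<subseteq> Poly_Mapping.keys c \<union> Poly_Mapping.keys d"
  by (auto simp: in_keys_iff lookup_minus)

definition part :: "'a set \<Rightarrow> ('a \<Rightarrow>\<^sub>0 'r) \<Rightarrow> 'a \<Rightarrow>\<^sub>0 'r::{comm_ring, comm_monoid_mult}" where
  "part T = lin (\<lambda>v. if v \<in> T then basis v else 0)"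

lemma part_basis [simp]: "part T (basis v) = (if v \<in> T then basis v else 0)"
  by (simp add: part_def)

lemma part_zero [simp]: "part T 0 = 0"
  by (simp add: part_def)

lemma part_linear:
  "part T 0 = 0" "part T (c + d) = part T c + part T d" "part T (c - d) = part T c - part T d"
  "part T (lin F b) = lin (\<lambda>v. part T (F v)) b" "part T (\<Sum>i\<in>I. h i) = (\<Sum>i\<in>I. part T (h i))"
  "part T (scale r c) = scale r (part T c)"
  by (simp_all add: part_def lin_add lin_diff lin_lin lin_sum lin_scale)

lemma part_single: "part T (Poly_Mapping.single v r) = (if v \<in> T then Poly_Mapping.single v r else 0)"
  by (simp add: part_def scale_single)

lemma part_id: "Poly_Mapping.keys c \<subseteq> T \<Longrightarrow> part T c = c"
  unfolding part_def by (subst (2) lin_basis[symmetric]) (rule lin_cong, auto)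

lemma keys_part:
  fixes c :: "'a \<Rightarrow>\<^sub>0 'r::{comm_ring, comm_monoid_mult}"
  shows "Poly_Mapping.keys (part T c) \<subseteq> Poly_Mapping.keys c \<inter> T"
proof -
  have "Poly_Mapping.keys (part T c) \<subseteq>
      (\<Union>v\<in>Poly_Mapping.keys c. Poly_Mapping.keys (if v \<in> T then basis v else 0 :: 'a \<Rightarrow>\<^sub>0 'r))"
    unfolding part_def by (rule keys_lin)
  also have "\<dots> \<subseteq> Poly_Mapping.keys c \<inter> T" by (auto split: if_splits)
  finally show ?thesis .
qed

lemma part_split: "c = part T c + part (- T) c"
proof -
  have "part T c + part (- T) c = lin basis c"
    unfolding part_def lin_fun_add[symmetric] by (rule lin_cong) simp
  then show ?thesis by simp
qed

lemma part_part: "part T (part U c) = part (T \<inter> U) c"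
  unfolding part_def by (subst lin_lin) (rule lin_cong, simp)

text \<open>\<open>part\<close> realises the quotient by a coordinate submodule as a projection. The
  assumption says that \<open>lin F\<close> descends to these quotients, hence that projecting first
  changes nothing.\<close>

lemma part_lin_part:
  assumes "\<And>v. v \<notin> T \<Longrightarrow> part U (F v) = 0"
  shows "part U (lin F (part T c)) = part U (lin F c)"
  unfolding part_linear(4) part_def[of T] lin_lin
  by (rule lin_cong) (simp add: assms)

abbreviation nondegenerate :: "'v list set" where
  "nondegenerate \<equiv> Collect distinct_adj"

abbreviation simplices :: "'v list set" where
  "simplices \<equiv> {v. v \<noteq> [] \<and> distinct_adj v}"

lemma simplices_part: "part simplices c = part simplices (part nondegenerate c)"
  by (simp add: part_part Collect_conj_eq[symmetric] conj_ac)

section \<open>Cone, boundary and prism on tuples\<close>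

definition cone :: "'v \<Rightarrow> ('v list \<Rightarrow>\<^sub>0 'r) \<Rightarrow> 'v list \<Rightarrow>\<^sub>0 'r::{comm_ring, comm_monoid_mult}" where
  "cone a = lin (\<lambda>v. basis (a # v))"

text \<open>The operators on tuples below are those of the unnormalised augmented complex, where \<open>[]\<close> spans
  degree \<open>-1\<close>: there they have short recursions. The complex \<^const>\<open>RC\<close> is its quotient by \<open>[]\<close> and the
  degenerate tuples, realised by the projection \<open>part simplices\<close>.\<close>

primrec bd :: "'v list \<Rightarrow> 'v list \<Rightarrow>\<^sub>0 'r::{comm_ring, comm_monoid_mult}" where
  "bd [] = 0"
| "bd (a # v) = basis v - cone a (bd v)"

text \<open>Unfolded, this is the alternating sum of the tuples
  \<open>(\<rho> v_0, ..., \<rho> v_i, v_i, ..., v_k)\<close>, the classical prism operator.\<close>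

primrec prism :: "('v \<Rightarrow> 'v) \<Rightarrow> 'v list \<Rightarrow> 'v list \<Rightarrow>\<^sub>0 'r::{comm_ring, comm_monoid_mult}" where
  "prism \<rho> [] = 0"
| "prism \<rho> (a # v) = basis (\<rho> a # a # v) - cone (\<rho> a) (prism \<rho> v)"

abbreviation map_chain :: "('v \<Rightarrow> 'w) \<Rightarrow> ('v list \<Rightarrow>\<^sub>0 'r) \<Rightarrow> 'w list \<Rightarrow>\<^sub>0 'r::{comm_ring, comm_monoid_mult}" where
  "map_chain f \<equiv> lin (\<lambda>v. basis (map f v))"

lemma cone_simps [simp]:
  "cone a (basis v) = basis (a # v)" "cone a 0 = 0" "cone a (c + d) = cone a c + cone a d"
  "cone a (c - d) = cone a c - cone a d"
  by (simp_all add: cone_def lin_add lin_diff)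

lemma lin_cone: "lin F (cone a c) = lin (\<lambda>v. F (a # v)) c"
  by (simp add: cone_def lin_lin)

lemma cone_lin: "cone a (lin F c) = lin (\<lambda>v. cone a (F v)) c"
  by (simp add: cone_def lin_lin)

text \<open>The cone is a contracting homotopy of the augmented complex; keeping \<open>[]\<close>
  makes the identity hold for tuples of length one as well.\<close>

lemma lin_bd_cone: "lin bd (cone a c) = c - cone a (lin bd c)"
  by (simp add: lin_cone cone_lin lin_fun_diff)

lemma bd_bd: "lin bd (bd v) = 0"
  by (induction v) (simp_all add: lin_diff lin_bd_cone)

lemma map_chain_cone: "map_chain f (cone a c) = cone (f a) (map_chain f c)"
  by (simp add: lin_cone cone_lin)

lemma map_chain_bd: "map_chain f (bd v) = bd (map f v)"
  by (induction v) (simp_all add: lin_diff map_chain_cone)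

lemma lin_prism_cone: "lin (prism \<rho>) (cone a c) = cone (\<rho> a) (cone a c) - cone (\<rho> a) (lin (prism \<rho>) c)"
  by (simp add: lin_cone cone_lin lin_fun_diff) (simp add: cone_def lin_lin)

text \<open>By the cone identity the terms with a bare \<open>prism \<rho> v\<close> cancel, and so
  do those with two cones. Up to two single tuples, what remains is the left-hand side for
  \<open>v\<close> under \<open>cone (\<rho> a)\<close>.\<close>

lemma prism_homotopy:
  "lin bd (prism \<rho> v) + lin (prism \<rho>) (bd v) = (basis v - basis (map \<rho> v) :: _ \<Rightarrow>\<^sub>0 'r::{comm_ring, comm_monoid_mult})"
proof (induction v)
  case (Cons a v)
  have "lin bd (prism \<rho> (a # v)) + lin (prism \<rho>) (bd (a # v))
      = basis (a # v) - cone (\<rho> a) (basis v) + cone (\<rho> a) (lin bd (prism \<rho> v) + lin (prism \<rho>) (bd v) :: _ \<Rightarrow>\<^sub>0 'r)"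
    by (simp add: lin_diff lin_bd_cone lin_prism_cone)
  also have "\<dots> = basis (a # v) - basis (map \<rho> (a # v))"
    unfolding Cons.IH by simp
  finally show ?case .
qed simp

lemma part_cone: "part nondegenerate (cone a (part nondegenerate c)) = part nondegenerate (cone a c)"
  unfolding cone_def by (rule part_lin_part) (auto simp: distinct_adj_Cons)

lemma part_cone_zero: "part nondegenerate c = 0 \<Longrightarrow> part nondegenerate (cone a c) = 0"
  using part_cone[of a c] by (simp add: part_linear)

text \<open>A repetition at the head makes the first two faces equal with opposite signs, and all
  other faces still begin with the repetition. A repetition further back is handled by
  induction.\<close>

lemma part_bd_degenerate: "\<not> distinct_adj v \<Longrightarrow> part nondegenerate (bd v) = 0"
proof (induction v)
  case (Cons a v)
  show ?case
  proof (cases "distinct_adj v")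
    case True
    then obtain u where "v = a # u" using Cons.prems by (cases v) (auto simp: distinct_adj_Cons)
    moreover have "part nondegenerate (cone a (cone a c)) = 0" for c :: "'a list \<Rightarrow>\<^sub>0 'b"
      unfolding cone_def lin_lin part_linear(4) by simp
    ultimately show ?thesis by (simp add: part_linear)
  next
    case False
    then show ?thesis
      by (simp add: part_linear part_cone_zero[OF Cons.IH])
  qed
qed simp

text \<open>In contrast to the boundary nothing has to cancel: each term repeats an entry
  \<open>a\<close> or its image \<open>\<rho> a\<close>.\<close>

lemma part_prism_degenerate: "\<not> distinct_adj v \<Longrightarrow> part nondegenerate (prism \<rho> v) = 0"
proof (induction v)
  case (Cons a v)
  show ?case
  proof (cases "distinct_adj v")
    case True
    then obtain u where u: "v = a # u" using Cons.prems by (cases v) (auto simp: distinct_adj_Cons)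
    moreover have "part nondegenerate (cone (\<rho> a) (cone (\<rho> a) c)) = 0" for c :: "'a list \<Rightarrow>\<^sub>0 'b"
      unfolding cone_def lin_lin part_linear(4) by simp
    ultimately show ?thesis by (simp add: part_linear)
  next
    case False
    then have "\<not> distinct_adj (\<rho> a # a # v)" by (auto dest: distinct_adj_ConsD)
    then show ?thesis
      using part_cone_zero[OF Cons.IH[OF False]] by (auto simp: part_linear)
  qed
qed simp

text \<open>Each term of the prism contains some \<open>\<rho> x\<close> followed by
  \<open>x\<close>; if \<open>\<rho>\<close> fixes \<open>x\<close>, it is degenerate and hence zero
  in the normalised complex.\<close>

lemma part_prism_fixed:
  "(\<And>x. x \<in> set v \<Longrightarrow> \<rho> x = x) \<Longrightarrow> part nondegenerate (prism \<rho> v) = (0 :: _ \<Rightarrow>\<^sub>0 'r::{comm_ring, comm_monoid_mult})"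
proof (induction v)
  case (Cons a v)
  then have "part nondegenerate (prism \<rho> v) = (0 :: _ \<Rightarrow>\<^sub>0 'r)" "\<rho> a = a" by simp_all
  then show ?case using part_cone_zero by (simp add: part_linear)
qed simp

text \<open>Degenerate tuples and \<open>[]\<close> may be dropped before or only after the boundary
  is taken. With the analogous facts for the prism and for vertex maps, identities of the
  unnormalised operators pass to \<open>RC\<close>.\<close>

lemma normal_bd: "part simplices (lin bd (part simplices c)) = part simplices (lin bd c)"
proof (rule part_lin_part)
  fix v :: "'a list" assume "v \<notin> simplices"
  then show "part simplices (bd v :: _ \<Rightarrow>\<^sub>0 'b) = 0"
    by (cases "v = []") (auto simp: part_linear part_bd_degenerate simplices_part[of "bd v"])
qed

lemma normal_prism: "part simplices (lin (prism \<rho>) (part simplices c)) = part simplices (lin (prism \<rho>) c)"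
proof (rule part_lin_part)
  fix v :: "'a list" assume "v \<notin> simplices"
  then show "part simplices (prism \<rho> v :: _ \<Rightarrow>\<^sub>0 'b) = 0"
    by (cases "v = []") (auto simp: part_linear part_prism_degenerate simplices_part[of "prism \<rho> v"])
qed

lemma normal_map_chain: "part simplices (map_chain f (part simplices c)) = part simplices (map_chain f c)"
  by (rule part_lin_part) (auto dest: distinct_adj_mapD)

section \<open>The operators of the reachability complex as normalised operators\<close>

lemma bd_sum: "bd v = (\<Sum>j<length v. Poly_Mapping.single (omit_nth j v) ((- 1) ^ j :: 'r::{comm_ring, comm_monoid_mult}))"
proof (induction v)
  case (Cons a v)
  have "cone a (bd v) = (\<Sum>j<length v. Poly_Mapping.single (a # omit_nth j v) ((- 1) ^ j :: 'r))"
    by (simp add: Cons.IH cone_def lin_sum scale_single)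
  then show ?case
    by (simp add: sum.lessThan_Suc_shift omit_nth_def single_uminus sum_negf del: sum.lessThan_Suc)
qed simp

lemma rc_boundary_eq: "rc_boundary c = part simplices (lin bd c)"
proof -
  have "part simplices (bd v) = (\<Sum>j<length v. if omit_nth j v \<noteq> [] \<and> distinct_adj (omit_nth j v)
      then Poly_Mapping.single (omit_nth j v) ((- 1) ^ j :: 'b) else 0)" for v :: "'a list"
    by (simp add: bd_sum part_linear part_single)
  moreover have "part simplices (lin bd c) = lin (\<lambda>v. part simplices (bd v)) c"
    by (rule part_linear(4))
  ultimately show ?thesis
    unfolding lin_def rc_boundary_def
    by (simp only:) (intro sum.cong refl, auto simp: scale_sum scale_single mult.commute intro!: sum.cong)
qed

lemma rc_map_eq: "rc_map f c = part nondegenerate (map_chain f c)"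
proof -
  have "part nondegenerate (map_chain f c) = lin (\<lambda>v. part nondegenerate (basis (map f v))) c"
    by (rule part_linear(4))
  then show ?thesis
    unfolding lin_def rc_map_def by (simp only:) (intro sum.cong refl, simp add: scale_single)
qed

text \<open>\<open>rc_map\<close> does not remove \<open>[]\<close>, whereas
  \<open>rc_boundary\<close> does; on chains without \<open>[]\<close> both can be written with the
  projection to \<open>simplices\<close>.\<close>

lemma rc_map_eq_normal:
  fixes c :: "_ \<Rightarrow>\<^sub>0 'r::{comm_ring, comm_monoid_mult}"
  assumes "[] \<notin> Poly_Mapping.keys c"
  shows "rc_map f c = part simplices (map_chain f c)"
proof -
  have "Poly_Mapping.keys (map_chain f c) \<subseteq> (\<Union>v\<in>Poly_Mapping.keys c. Poly_Mapping.keys (basis (map f v) :: _ \<Rightarrow>\<^sub>0 'r))"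
    by (rule keys_lin)
  also have "\<dots> \<subseteq> {v. v \<noteq> []}" using assms by (auto split: if_splits)
  finally have "part {v. v \<noteq> []} (rc_map f c) = rc_map f c"
    using keys_part[of nondegenerate "map_chain f c"] by (intro part_id) (auto simp: rc_map_eq)
  then show ?thesis by (simp add: rc_map_eq part_part Collect_conj_eq[symmetric])
qed

lemma rc_linear:
  "rc_boundary (c + d) = rc_boundary c + rc_boundary d"
  "rc_boundary (c - d) = rc_boundary c - rc_boundary d"
  "rc_boundary (scale r c) = scale r (rc_boundary c)"
  "rc_map f (c' + d') = rc_map f c' + rc_map f d'"
  "rc_map f (c' - d') = rc_map f c' - rc_map f d'"
  "rc_map f (scale r c') = scale r (rc_map f c')"
  by (simp_all add: rc_boundary_eq rc_map_eq part_linear lin_add lin_diff lin_scale)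

lemma rc_boundary_boundary: "rc_boundary (rc_boundary c) = 0"
proof -
  have "rc_boundary (rc_boundary c) = part simplices (lin bd (lin bd c))"
    by (simp only: rc_boundary_eq normal_bd)
  also have "lin bd (lin bd c) = 0" by (simp add: lin_lin bd_bd)
  finally show ?thesis by simp
qed

lemma rc_boundary_nonempty: "Poly_Mapping.keys (rc_boundary c) \<subseteq> simplices"
  using keys_part[of simplices "lin bd c"] by (auto simp: rc_boundary_eq)

lemma rc_map_boundary:
  assumes "[] \<notin> Poly_Mapping.keys c"
  shows "rc_map f (rc_boundary c) = rc_boundary (rc_map f c)"
proof -
  have "rc_map f (rc_boundary c) = part simplices (map_chain f (rc_boundary c))"
    using rc_boundary_nonempty by (intro rc_map_eq_normal) auto
  also have "\<dots> = part simplices (map_chain f (lin bd c))"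
    by (simp add: rc_boundary_eq normal_map_chain)
  also have "\<dots> = part simplices (lin bd (map_chain f c))"
    by (simp add: lin_lin map_chain_bd)
  also have "\<dots> = rc_boundary (rc_map f c)"
    by (simp add: rc_map_eq_normal[OF assms] rc_boundary_eq normal_bd)
  finally show ?thesis .
qed

definition rc_prism :: "('v \<Rightarrow> 'v) \<Rightarrow> ('v list \<Rightarrow>\<^sub>0 'r) \<Rightarrow> 'v list \<Rightarrow>\<^sub>0 'r::{comm_ring, comm_monoid_mult}" where
  "rc_prism \<rho> c = part simplices (lin (prism \<rho>) c)"

lemma rc_prism_homotopy:
  assumes "Poly_Mapping.keys c \<subseteq> simplices"
  shows "rc_boundary (rc_prism \<rho> c) + rc_prism \<rho> (rc_boundary c) = c - rc_map \<rho> c"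
proof -
  have "rc_boundary (rc_prism \<rho> c) + rc_prism \<rho> (rc_boundary c)
      = part simplices (lin (\<lambda>v. lin bd (prism \<rho> v) + lin (prism \<rho>) (bd v)) c)"
    by (simp add: rc_boundary_eq rc_prism_def normal_bd normal_prism lin_lin lin_fun_add part_linear(2))
  also have "\<dots> = part simplices c - part simplices (map_chain \<rho> c)"
    by (simp only: prism_homotopy lin_fun_diff lin_basis part_linear(3))
  also have "\<dots> = c - rc_map \<rho> c"
    using assms by (subst rc_map_eq_normal) (auto simp: part_id)
  finally show ?thesis .
qed

lemma rc_prism_fixed:
  assumes "\<And>v x. v \<in> Poly_Mapping.keys c \<Longrightarrow> x \<in> set v \<Longrightarrow> \<rho> x = x"
  shows "rc_prism \<rho> c = 0"
proof -
  have "part nondegenerate (lin (prism \<rho>) c) = lin (\<lambda>v. 0) c"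
    unfolding part_linear(4) by (rule lin_cong, rule part_prism_fixed, rule assms)
  then show ?thesis unfolding rc_prism_def by (subst simplices_part) simp
qed

lemma keys_cone:
  fixes c :: "_ \<Rightarrow>\<^sub>0 'r::{comm_ring, comm_monoid_mult}"
  shows "Poly_Mapping.keys (cone a c) \<subseteq> (#) a ` Poly_Mapping.keys c"
proof -
  have "Poly_Mapping.keys (cone a c) \<subseteq> (\<Union>v\<in>Poly_Mapping.keys c. Poly_Mapping.keys (basis (a # v) :: _ \<Rightarrow>\<^sub>0 'r))"
    unfolding cone_def by (rule keys_lin)
  then show ?thesis by (auto split: if_splits)
qed

lemma keys_basis: "Poly_Mapping.keys (basis v :: _ \<Rightarrow>\<^sub>0 'r::{comm_ring, comm_monoid_mult}) \<subseteq> {v}"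
  by simp

lemma keys_bd:
  "Poly_Mapping.keys (bd v :: _ \<Rightarrow>\<^sub>0 'r::{comm_ring, comm_monoid_mult}) \<subseteq> {w. Suc (length w) = length v \<and> set w \<subseteq> set v \<and> (sorted_wrt r v \<longrightarrow> sorted_wrt r w)}"
proof (induction v)
  case (Cons a v)
  have "Poly_Mapping.keys (bd (a # v) :: _ \<Rightarrow>\<^sub>0 'r) \<subseteq> insert v ((#) a ` Poly_Mapping.keys (bd v :: _ \<Rightarrow>\<^sub>0 'r))"
    using keys_diff_subset[of "basis v" "cone a (bd v) :: _ \<Rightarrow>\<^sub>0 'r"] keys_cone[of a "bd v"] keys_basis[of v]
    unfolding bd.simps by blast
  also have "\<dots> \<subseteq> {w. Suc (length w) = length (a # v) \<and> set w \<subseteq> set (a # v) \<and> (sorted_wrt r (a # v) \<longrightarrow> sorted_wrt r w)}"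
    using Cons.IH by (auto 0 3 simp: subset_iff)
  finally show ?case .
qed simp

text \<open>A prism term \<open>(\<rho> v_0, ..., \<rho> v_i, v_i, ..., v_k)\<close> is sorted
  because \<open>\<rho>\<close> is monotone and \<open>\<rho> v_i\<close> is below
  \<open>v_i\<close>, which joins the two halves.\<close>

lemma keys_prism:
  assumes "transp r" "\<And>x. x \<in> set v \<Longrightarrow> r (\<rho> x) x" "\<And>x y. x \<in> set v \<Longrightarrow> r x y \<Longrightarrow> r (\<rho> x) (\<rho> y)" "sorted_wrt r v"
  shows "Poly_Mapping.keys (prism \<rho> v :: _ \<Rightarrow>\<^sub>0 'r::{comm_ring, comm_monoid_mult}) \<subseteq> {w. length w = Suc (length v) \<and> set w \<subseteq> set v \<union> \<rho> ` set v \<and> sorted_wrt r w}"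
  using assms(2-)
proof (induction v)
  case (Cons a v)
  have ra: "r (\<rho> a) a" and av: "\<And>x. x \<in> set v \<Longrightarrow> r a x" and sv: "sorted_wrt r v"
    using Cons.prems by auto
  \<comment> \<open>These are the entries that can occur behind \<open>\<rho> a\<close> once
    \<open>cone (\<rho> a)\<close> is applied.\<close>
  have below: "r (\<rho> a) x" if "x \<in> set v \<union> \<rho> ` set v" for x
    using that
  proof
    assume "x \<in> set v"
    then show ?thesis using transpD[OF assms(1) ra av] by blast
  next
    assume "x \<in> \<rho> ` set v"
    then show ?thesis using Cons.prems(2)[of a] av by auto
  qed
  have "Poly_Mapping.keys (prism \<rho> (a # v) :: _ \<Rightarrow>\<^sub>0 'r)
      \<subseteq> insert (\<rho> a # a # v) ((#) (\<rho> a) ` Poly_Mapping.keys (prism \<rho> v :: _ \<Rightarrow>\<^sub>0 'r))"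
    using keys_diff_subset[of "basis (\<rho> a # a # v)" "cone (\<rho> a) (prism \<rho> v) :: _ \<Rightarrow>\<^sub>0 'r"]
      keys_cone[of "\<rho> a" "prism \<rho> v"] keys_basis[of "\<rho> a # a # v"]
    unfolding prism.simps by blast
  moreover have "Poly_Mapping.keys (prism \<rho> v :: _ \<Rightarrow>\<^sub>0 'r)
      \<subseteq> {w. length w = Suc (length v) \<and> set w \<subseteq> set v \<union> \<rho> ` set v \<and> sorted_wrt r w}"
    using Cons.prems by (intro Cons.IH) auto
  moreover have "sorted_wrt r (\<rho> a # a # v)" using ra av sv below by auto
  ultimately show ?case
    using below by (fastforce simp: subset_iff)
qed simp

lemma keys_map_chain:
  fixes c :: "_ \<Rightarrow>\<^sub>0 'r::{comm_ring, comm_monoid_mult}"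
  shows "Poly_Mapping.keys (map_chain f c) \<subseteq> map f ` Poly_Mapping.keys c"
proof -
  have "Poly_Mapping.keys (map_chain f c) \<subseteq> (\<Union>v\<in>Poly_Mapping.keys c. Poly_Mapping.keys (basis (map f v) :: _ \<Rightarrow>\<^sub>0 'r))"
    by (rule keys_lin)
  then show ?thesis by (auto split: if_splits)
qed

lemma keys_rc_map: "Poly_Mapping.keys (rc_map f c) \<subseteq> map f ` Poly_Mapping.keys c \<inter> nondegenerate"
  using keys_map_chain[of f c] keys_part[of nondegenerate "map_chain f c"] by (auto simp: rc_map_eq)

lemma map_chain_map_chain: "map_chain f (map_chain h c) = map_chain (f \<circ> h) c"
  by (simp add: lin_lin)

lemma map_chain_id:
  assumes "\<And>v x. v \<in> Poly_Mapping.keys c \<Longrightarrow> x \<in> set v \<Longrightarrow> f x = x"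
  shows "map_chain f c = c"
proof -
  have "map_chain f c = lin basis c"
    by (rule lin_cong) (use assms in \<open>auto simp: map_idI\<close>)
  then show ?thesis by simp
qed

text \<open>An injective vertex map makes no nondegenerate tuple degenerate, so no term of
  \<open>c\<close> is lost and the inverse on vertices recovers it.\<close>

lemma rc_map_inj:
  assumes "inj_on h V" "Poly_Mapping.keys c \<subseteq> lists V \<inter> nondegenerate"
  shows "map_chain (inv_into V h) (rc_map h c) = c"
proof -
  have "Poly_Mapping.keys (map_chain h c) \<subseteq> nondegenerate"
  proof
    fix w assume "w \<in> Poly_Mapping.keys (map_chain h c)"
    then obtain v where "v \<in> Poly_Mapping.keys c" "w = map h v" using keys_map_chain[of h c] by blast
    then show "w \<in> nondegenerate"
      using assms by (auto intro!: distinct_adj_mapI intro: inj_on_subset)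
  qed
  then have "rc_map h c = map_chain h c" by (simp add: rc_map_eq part_id)
  then show ?thesis
    using assms by (simp add: map_chain_map_chain, intro map_chain_id) (auto simp: inv_into_f_f subset_iff)
qed

section \<open>Excision\<close>

lemma chains_closed:
  "Poly_Mapping.keys (c :: _ \<Rightarrow>\<^sub>0 'r::{comm_ring, comm_monoid_mult}) \<subseteq> T \<Longrightarrow> Poly_Mapping.keys d \<subseteq> T \<Longrightarrow> Poly_Mapping.keys (c + d) \<subseteq> T"
  "Poly_Mapping.keys (c :: _ \<Rightarrow>\<^sub>0 'r::{comm_ring, comm_monoid_mult}) \<subseteq> T \<Longrightarrow> Poly_Mapping.keys d \<subseteq> T \<Longrightarrow> Poly_Mapping.keys (c - d) \<subseteq> T"
  "Poly_Mapping.keys (c :: _ \<Rightarrow>\<^sub>0 'r::{comm_ring, comm_monoid_mult}) \<subseteq> T \<Longrightarrow> Poly_Mapping.keys (scale r c) \<subseteq> T"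
  using Poly_Mapping.keys_add[of c d] keys_diff_subset[of c d] keys_scale[of r c] by blast+

lemma free_module_simps [simp]:
  "carrier (free_module R B) = {c. Poly_Mapping.keys c \<subseteq> B}" "\<zero>\<^bsub>free_module R B\<^esub> = 0"
  "c \<oplus>\<^bsub>free_module R B\<^esub> d = c + d" "r \<odot>\<^bsub>free_module R B\<^esub> c = scale r c"
  "add (free_module R B) = (+)"
  by (simp_all add: free_module_def)

lemma scaled_group_free_module: "scaled_group (free_module R B)"
proof (rule scaled_group.intro)
  show "abelian_group (free_module R B)"
  proof (rule abelian_groupI)
    show "\<exists>y \<in> carrier (free_module R B). y \<oplus>\<^bsub>free_module R B\<^esub> x = \<zero>\<^bsub>free_module R B\<^esub>"
      if "x \<in> carrier (free_module R B)" for x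
      using that by (intro bexI[of _ "- x"]) auto
  qed (auto simp: chains_closed(1) add_ac)
  show "scaled_group_axioms (free_module R B)"
    by unfold_locales (auto simp: chains_closed(3) scale_add)
qed

lemma scaled_subgroup_free_module:
  assumes "T \<subseteq> B"
  shows "scaled_subgroup {c. Poly_Mapping.keys c \<subseteq> T} (free_module R B)"
proof -
  interpret scaled_group "free_module R B" by (rule scaled_group_free_module)
  have uminus: "\<ominus>\<^bsub>free_module R B\<^esub> c = - c" if "Poly_Mapping.keys c \<subseteq> B" for c
    using that by (intro minus_equality) auto
  have "subgroup {c. Poly_Mapping.keys c \<subseteq> T} (add_monoid (free_module R B))"
    by (rule add.subgroupI)
      (use assms in \<open>auto simp: chains_closed(1) uminus a_inv_def[symmetric] intro: exI[of _ 0]\<close>)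
  then show ?thesis
    by (auto simp: scaled_subgroup_def additive_subgroup_def chains_closed(3))
qed

text \<open>By transitivity of reachability, the condition on neighbours becomes one on all pairs of
  entries, and this form survives the omission of an entry.\<close>

lemma rc_tuples_eq:
  assumes "pair_wf_digraph G"
  shows "rc_tuples G k = {v \<in> simplices. int (length v) = k + 1 \<and> set v \<subseteq> pverts G \<and> sorted_wrt (has_path G) v}"
proof -
  have "transp (has_path G)" using has_path_trans[OF assms] by (rule transpI)
  from successively_conv_sorted_wrt[OF this] show ?thesis by (auto simp: rc_tuples_def)
qed

lemma rc_tuples_simplices: "rc_tuples G k \<subseteq> simplices"
  by (auto simp: rc_tuples_def)

lemma keys_rc_boundary:
  assumes G: "pair_wf_digraph G" and c: "Poly_Mapping.keys c \<subseteq> rc_tuples G k \<inter> lists S"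
  shows "Poly_Mapping.keys (rc_boundary c :: _ \<Rightarrow>\<^sub>0 'r::{comm_ring, comm_monoid_mult}) \<subseteq> rc_tuples G (k - 1) \<inter> lists S"
proof
  fix w assume "w \<in> Poly_Mapping.keys (rc_boundary c)"
  then have w: "w \<in> simplices" and "w \<in> Poly_Mapping.keys (lin bd c)"
    using keys_part[of simplices "lin bd c"] by (auto simp: rc_boundary_eq)
  then obtain v where v: "v \<in> Poly_Mapping.keys c" "w \<in> Poly_Mapping.keys (bd v :: _ \<Rightarrow>\<^sub>0 'r)"
    using keys_lin[of bd c] by blast
  then show "w \<in> rc_tuples G (k - 1) \<inter> lists S"
    using w c keys_bd[of v "has_path G"] by (fastforce simp: rc_tuples_eq[OF G] in_lists_conv_set)
qed

lemma keys_rc_boundary_tuples: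
  assumes "pair_wf_digraph G" "Poly_Mapping.keys c \<subseteq> rc_tuples G k"
  shows "Poly_Mapping.keys (rc_boundary c) \<subseteq> rc_tuples G (k - 1)"
  using keys_rc_boundary[OF assms(1), of c k UNIV] assms(2) by auto

lemma RC_simps [simp]:
  "chain_mod (RC R G) k = free_module R (rc_tuples G k)" "chain_diff (RC R G) k = rc_boundary"
  by (simp_all add: RC_def)

lemma additive_complex_RC:
  assumes "pair_wf_digraph G"
  shows "additive_complex (RC R G)"
proof -
  have "rc_boundary \<in> module_hom (free_module R (rc_tuples G k)) (free_module R (rc_tuples G (k - 1)))" for k
    by (rule module_homI) (use keys_rc_boundary_tuples[OF assms] in \<open>simp_all add: rc_linear\<close>)
  then show ?thesis
    by (simp add: additive_complex_def scaled_complex_def scaled_group_free_module rc_boundary_boundary)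
qed

lemma keys_rc_map_tuples:
  assumes "pair_wf_digraph G" "pair_wf_digraph H" "digraph_map G H f" "Poly_Mapping.keys c \<subseteq> rc_tuples G k"
  shows "Poly_Mapping.keys (rc_map f c) \<subseteq> rc_tuples H k"
proof
  fix w assume "w \<in> Poly_Mapping.keys (rc_map f c)"
  then obtain v where v: "v \<in> rc_tuples G k" "w = map f v" "distinct_adj w"
    using keys_rc_map[of f c] assms(4) by blast
  have "successively (\<lambda>x y. has_path H (f x) (f y)) v"
    by (rule successively_mono[where P = "has_path G"])
      (use v digraph_map_has_path[OF assms(1-3)] in \<open>auto simp: rc_tuples_def\<close>)
  then show "w \<in> rc_tuples H k"
    using v assms(3) by (auto simp: rc_tuples_def digraph_map_def successively_map)
qed

lemma rc_map_boundary_tuples: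
  "Poly_Mapping.keys c \<subseteq> rc_tuples G k \<Longrightarrow> rc_map f (rc_boundary c) = rc_boundary (rc_map f c)"
  using rc_tuples_simplices[of G k] by (intro rc_map_boundary) auto

lemma chain_map_RC:
  assumes "pair_wf_digraph G" "pair_wf_digraph H" "digraph_map G H f"
  shows "chain_map (RC R G) (RC R H) (\<lambda>k. rc_map f)"
  unfolding chain_map_def
proof (intro allI conjI ballI)
  fix k
  show "rc_map f \<in> module_hom (chain_mod (RC R G) k) (chain_mod (RC R H) k)"
    by (rule module_homI) (use keys_rc_map_tuples[OF assms] in \<open>simp_all add: rc_linear\<close>)
  fix c assume "c \<in> carrier (chain_mod (RC R G) k)"
  then show "rc_map f (chain_diff (RC R G) k c) = chain_diff (RC R H) k (rc_map f c)"
    by (simp add: rc_map_boundary_tuples)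
qed

section \<open>Chains on the reach of a retract\<close>

context reach_retraction
begin

lemma keys_rc_prism:
  assumes c: "Poly_Mapping.keys c \<subseteq> rc_tuples G k \<inter> lists S"
  shows "Poly_Mapping.keys (rc_prism \<rho> c :: _ \<Rightarrow>\<^sub>0 'r::{comm_ring, comm_monoid_mult}) \<subseteq> rc_tuples G (k + 1) \<inter> lists S"
proof
  fix w assume "w \<in> Poly_Mapping.keys (rc_prism \<rho> c)"
  then have w: "w \<in> simplices" and "w \<in> Poly_Mapping.keys (lin (prism \<rho>) c)"
    using keys_part[of simplices "lin (prism \<rho>) c"] by (auto simp: rc_prism_def)
  then obtain v where v: "v \<in> Poly_Mapping.keys c" "w \<in> Poly_Mapping.keys (prism \<rho> v :: _ \<Rightarrow>\<^sub>0 'r)"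
    using keys_lin[of "prism \<rho>" c] by blast
  then have vt: "v \<in> rc_tuples G k" "set v \<subseteq> S" using c by (auto simp: in_lists_conv_set)
  have "transp (has_path G)" using has_path_trans[OF G] by (rule transpI)
  then have "w \<in> {w. length w = Suc (length v) \<and> set w \<subseteq> set v \<union> \<rho> ` set v \<and> sorted_wrt (has_path G) w}"
    using vt v(2) \<rho>_below \<rho>_mono by (intro subsetD[OF keys_prism]) (auto simp: rc_tuples_eq[OF G])
  then have "length w = Suc (length v)" "sorted_wrt (has_path G) w" and "set w \<subseteq> set v \<union> \<rho> ` set v"
    by auto
  moreover have "set v \<union> \<rho> ` set v \<subseteq> S" using vt \<rho>_in B_S by auto
  ultimately have wS: "set w \<subseteq> S" by (simp only: subset_trans)
  have "set w \<subseteq> pverts G" using wS S_verts by blast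
  then show "w \<in> rc_tuples G (k + 1) \<inter> lists S"
    using w vt wS \<open>length w = Suc (length v)\<close> \<open>sorted_wrt (has_path G) w\<close>
    by (auto simp: rc_tuples_eq[OF G])
qed

lemma keys_rc_retract:
  assumes c: "Poly_Mapping.keys c \<subseteq> rc_tuples G k \<inter> lists S"
  shows "Poly_Mapping.keys (rc_map \<rho> c) \<subseteq> rc_tuples G k \<inter> lists B"
proof
  fix w assume "w \<in> Poly_Mapping.keys (rc_map \<rho> c)"
  then obtain v where v: "v \<in> rc_tuples G k" "v \<in> lists S" "w = map \<rho> v" "distinct_adj w"
    using keys_rc_map[of \<rho> c] c by blast
  have "successively (\<lambda>x y. has_path G (\<rho> x) (\<rho> y)) v"
    by (rule successively_mono[where P = "has_path G"]) (use v \<rho>_mono in \<open>auto simp: rc_tuples_def\<close>)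
  moreover have "set w \<subseteq> B" using v \<rho>_in by auto
  ultimately show "w \<in> rc_tuples G k \<inter> lists B"
    using v B by (auto simp: rc_tuples_def successively_map in_lists_conv_set)
qed

text \<open>The witnesses are the retraction and the prism of \<open>c\<close>; the prism operator vanishes on chains of \<open>B\<close>.\<close>

lemma relative_cycle_on_reach:
  assumes c: "Poly_Mapping.keys c \<subseteq> rc_tuples G k \<inter> lists S"
    and dc: "Poly_Mapping.keys (rc_boundary c) \<subseteq> lists B"
  obtains b e where "Poly_Mapping.keys b \<subseteq> rc_tuples G k \<inter> lists B"
    "Poly_Mapping.keys e \<subseteq> rc_tuples G (k + 1) \<inter> lists S"
    "c = b + rc_boundary (e :: _ \<Rightarrow>\<^sub>0 'r::{comm_ring, comm_monoid_mult})"
proof (rule that)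
  show "Poly_Mapping.keys (rc_map \<rho> c) \<subseteq> rc_tuples G k \<inter> lists B" by (rule keys_rc_retract[OF c])
  show "Poly_Mapping.keys (rc_prism \<rho> c) \<subseteq> rc_tuples G (k + 1) \<inter> lists S" by (rule keys_rc_prism[OF c])
  have "rc_prism \<rho> (rc_boundary c) = 0"
    by (rule rc_prism_fixed) (use dc \<rho>_id in \<open>auto simp: in_lists_conv_set\<close>)
  then show "c = rc_map \<rho> c + rc_boundary (rc_prism \<rho> c)"
    using rc_prism_homotopy[of c \<rho>] c rc_tuples_simplices[of G k] by (auto simp: algebra_simps)
qed

text \<open>The head of a tuple reaches every entry. The reach is closed under going forward, and an
  entry in \<open>B\<close> would force the head into \<open>B\<close>.\<close>

lemma rc_tuples_split:
  assumes v: "v \<in> rc_tuples G k"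
  shows "hd v \<in> S \<Longrightarrow> v \<in> lists S" "hd v \<notin> S \<Longrightarrow> set v \<inter> B = {}"
proof -
  have hd_path: "has_path G (hd v) x" if "x \<in> set v" for x
    using v that by (cases v) (auto simp: rc_tuples_eq[OF G] has_path_refl)
  show "hd v \<in> S \<Longrightarrow> v \<in> lists S" using hd_path S_up by auto
  show "hd v \<notin> S \<Longrightarrow> set v \<inter> B = {}" using hd_path into_B B_S by blast
qed

text \<open>This splits modules, not complexes: omitting the head of a tuple of the first kind can
  produce a tuple in the reach. Correcting for this is the work in both halves of excision.\<close>

lemma rc_chain_split:
  assumes "Poly_Mapping.keys c \<subseteq> rc_tuples G k"
  obtains c1 c2 where "c = c1 + (c2 :: _ \<Rightarrow>\<^sub>0 'r::{comm_ring, comm_monoid_mult})"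
    "Poly_Mapping.keys c1 \<subseteq> rc_tuples G k \<inter> {v. hd v \<notin> S}" "Poly_Mapping.keys c2 \<subseteq> rc_tuples G k \<inter> lists S"
proof (rule that[OF part_split[of c "{v. hd v \<notin> S}"]])
  show "Poly_Mapping.keys (part {v. hd v \<notin> S} c) \<subseteq> rc_tuples G k \<inter> {v. hd v \<notin> S}"
    using keys_part[of "{v. hd v \<notin> S}" c] assms by blast
  show "Poly_Mapping.keys (part (- {v. hd v \<notin> S}) c) \<subseteq> rc_tuples G k \<inter> lists S"
    using keys_part[of "- {v. hd v \<notin> S}" c] assms rc_tuples_split(1) by blast
qed

end

lemma rc_tuples_restrict:
  assumes "\<And>x y. x \<in> pverts H \<Longrightarrow> y \<in> pverts H \<Longrightarrow> has_path H x y \<longleftrightarrow> has_path G x y"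
    and "pverts H \<subseteq> pverts G"
  shows "rc_tuples H k = rc_tuples G k \<inter> lists (pverts H)"
proof -
  have "successively (has_path H) v \<longleftrightarrow> successively (has_path G) v" if "set v \<subseteq> pverts H" for v
    using that by (induction v rule: induct_list012) (auto simp: assms(1))
  then show ?thesis using assms(2) by (auto simp: rc_tuples_def in_lists_conv_set)
qed

section \<open>Comparison of the chains of \<open>A\<close>, \<open>X\<close>, \<open>Y\<close> and
  \<open>P\<close>\<close>

context cofibration_pushout
begin

interpretation RA: reach_retraction X "pverts A" "reach_verts A X" \<pi> by (rule reach_retraction_A)
interpretation RY: reach_retraction P "j ` pverts Y" reach_Y \<pi>\<^sub>Y by (rule reach_retraction_Y)

lemma g_reach: "x \<in> pverts X \<Longrightarrow> g x \<in> reach_Y \<longleftrightarrow> x \<in> reach_verts A X"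
proof
  assume x: "x \<in> pverts X" and "g x \<in> reach_Y"
  show "x \<in> reach_verts A X"
  proof (cases "x \<in> pverts A")
    case True
    then show ?thesis using RA.B_S by blast
  next
    case False
    then have "g x \<notin> j ` pverts Y" using g_neq_j x by blast
    then obtain x' where x': "x' \<in> reach_verts A X - pverts A" "g x = g x'"
      using \<open>g x \<in> reach_Y\<close> by (auto simp: reach_Y_def)
    then have "x = x'" using inj_onD[OF inj_g x'(2)] x False reach_sub by blast
    then show ?thesis using x' by blast
  qed
next
  assume "x \<in> reach_verts A X"
  then show "g x \<in> reach_Y"
    using gj f_vert by (cases "x \<in> pverts A") (auto simp: reach_Y_def)
qed

lemma rc_tuples_A: "rc_tuples A k = rc_tuples X k \<inter> lists (pverts A)"
  using AX long_cofibration_has_path[OF X cofib] by (intro rc_tuples_restrict) auto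

lemma image_Y: "pair_wf_digraph (image_graph j Y)" "digraph_map Y (image_graph j Y) j"
  "pverts (image_graph j Y) = j ` pverts Y"
  using pair_wf_digraph.in_arcsD1[OF Y] pair_wf_digraph.in_arcsD2[OF Y]
  by (auto simp: image_graph_def pair_wf_digraph_def digraph_map_def intro!: image_eqI)

text \<open>A path of \<open>P\<close> might use arcs that the copy of \<open>Y\<close> lacks. By
  \<open>path_j_iff\<close> there is then also a path in \<open>Y\<close>, and \<open>j\<close>
  carries it to the copy.\<close>

lemma image_Y_path:
  assumes "y \<in> pverts Y" "y' \<in> pverts Y"
  shows "has_path (image_graph j Y) (j y) (j y') \<longleftrightarrow> has_path P (j y) (j y')"
proof
  assume *: "has_path (image_graph j Y) (j y) (j y')"
  have "digraph_map (image_graph j Y) P (\<lambda>p. p)"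
    using j by (auto simp: image_graph_def digraph_map_def)
  from digraph_map_has_path[OF image_Y(1) P this *] show "has_path P (j y) (j y')" .
next
  assume "has_path P (j y) (j y')"
  then show "has_path (image_graph j Y) (j y) (j y')"
    using path_j_iff[OF assms] digraph_map_has_path[OF Y image_Y(1,2)] by blast
qed

lemma rc_tuples_Y: "rc_tuples (image_graph j Y) k = rc_tuples P k \<inter> lists (j ` pverts Y)"
  using rc_tuples_restrict[of "image_graph j Y" P k] image_Y_path j_vert by (auto simp: image_Y(3))

lemma rc_map_A:
  assumes "Poly_Mapping.keys c \<subseteq> rc_tuples A k"
  shows "rc_map (\<lambda>a. a) c = c"
proof -
  have "map_chain (\<lambda>a. a) c = c" by (rule map_chain_id) simp
  then show ?thesis
    using assms rc_tuples_simplices[of A k] by (auto simp: rc_map_eq intro!: part_id)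
qed

lemma rc_map_g_A:
  assumes "Poly_Mapping.keys c \<subseteq> lists (pverts A)"
  shows "rc_map g c = part nondegenerate (map_chain j (map_chain f c))"
    "Poly_Mapping.keys (rc_map g c) \<subseteq> lists (j ` pverts Y)"
proof -
  have "map_chain g c = map_chain (j \<circ> f) c"
  proof (rule lin_cong)
    fix v assume "v \<in> Poly_Mapping.keys c"
    then have "map g v = map (j \<circ> f) v" using assms gj by auto
    then show "basis (map g v) = basis (map (j \<circ> f) v)" by (rule arg_cong)
  qed
  then show "rc_map g c = part nondegenerate (map_chain j (map_chain f c))"
    by (simp add: rc_map_eq map_chain_map_chain)
  show "Poly_Mapping.keys (rc_map g c) \<subseteq> lists (j ` pverts Y)"
  proof
    fix w assume "w \<in> Poly_Mapping.keys (rc_map g c)"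
    then obtain v where v: "set v \<subseteq> pverts A" "w = map g v"
      using keys_rc_map[of g c] assms by (fastforce simp: in_lists_conv_set)
    have "g x \<in> j ` pverts Y" if "x \<in> set v" for x
      using v(1) that gj[of x] f_vert[of x] by auto
    then show "w \<in> lists (j ` pverts Y)" using v(2) by auto
  qed
qed

lemma rc_map_commutes:
  assumes "Poly_Mapping.keys a \<subseteq> rc_tuples A k"
  shows "rc_map g (rc_map (\<lambda>a. a) a) = rc_map j (rc_map f a)"
proof -
  have "rc_map g (rc_map (\<lambda>a. a) a) = part nondegenerate (map_chain j (map_chain f a))"
    using assms by (simp only: rc_map_A[OF assms]) (simp add: rc_map_g_A(1) rc_tuples_A)
  also have "\<dots> = part nondegenerate (map_chain j (part nondegenerate (map_chain f a)))"
    by (rule part_lin_part[symmetric]) (auto dest: distinct_adj_mapD)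
  finally show ?thesis by (simp add: rc_map_eq)
qed

lemma rc_map_j_inj:
  assumes "Poly_Mapping.keys c \<subseteq> rc_tuples Y k"
  shows "map_chain (inv_into (pverts Y) j) (rc_map j c) = c"
  using assms by (intro rc_map_inj[OF inj_j]) (auto simp: rc_tuples_def)

text \<open>As \<open>j\<close> is injective and reflects paths on \<open>Y\<close>, its inverse
  turns tuples of \<open>P\<close> with entries in \<open>j Y\<close> into tuples of
  \<open>Y\<close>.\<close>

lemma rc_map_j_image: "rc_map j ` {c. Poly_Mapping.keys c \<subseteq> rc_tuples Y k}
    = {c :: _ \<Rightarrow>\<^sub>0 'r::{comm_ring, comm_monoid_mult}. Poly_Mapping.keys c \<subseteq> rc_tuples P k \<inter> lists (j ` pverts Y)}"
proof (intro equalityI subsetI)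
  fix d :: "_ \<Rightarrow>\<^sub>0 'r" assume "d \<in> rc_map j ` {c. Poly_Mapping.keys c \<subseteq> rc_tuples Y k}"
  then obtain c where "Poly_Mapping.keys c \<subseteq> rc_tuples Y k" "d = rc_map j c" by blast
  then show "d \<in> {c. Poly_Mapping.keys c \<subseteq> rc_tuples P k \<inter> lists (j ` pverts Y)}"
    using keys_rc_map_tuples[OF Y image_Y(1,2), of c k] by (simp add: rc_tuples_Y)
next
  fix d :: "_ \<Rightarrow>\<^sub>0 'r" assume "d \<in> {c. Poly_Mapping.keys c \<subseteq> rc_tuples P k \<inter> lists (j ` pverts Y)}"
  then have d: "Poly_Mapping.keys d \<subseteq> rc_tuples P k \<inter> lists (j ` pverts Y)" by simp
  let ?h = "inv_into (pverts Y) j"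
  have "Poly_Mapping.keys (map_chain ?h d) \<subseteq> rc_tuples Y k"
  proof
    fix w assume "w \<in> Poly_Mapping.keys (map_chain ?h d)"
    then obtain v where "v \<in> Poly_Mapping.keys d" and w: "w = map ?h v"
      using keys_map_chain[of ?h d] by blast
    then have v: "v \<in> rc_tuples P k" "set v \<subseteq> j ` pverts Y" "w = map ?h v" using d by auto
    have vw: "v = map j w" using v(2,3) by (auto simp: map_idI f_inv_into_f subset_iff)
    have wY: "set w \<subseteq> pverts Y" using v(2,3) by (auto intro: inv_into_into)
    have "successively (has_path Y) w"
      by (rule successively_mono[where P = "\<lambda>x y. has_path P (j x) (j y)"])
        (use v(1) vw wY path_j_iff in \<open>auto simp: rc_tuples_def successively_map subset_iff\<close>)
    then show "w \<in> rc_tuples Y k"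
      using v(1) vw wY by (auto simp: rc_tuples_def dest: distinct_adj_mapD)
  qed
  moreover have "rc_map j (map_chain ?h d) = d"
  proof -
    have "map_chain j (map_chain ?h d) = d"
      unfolding map_chain_map_chain
      by (rule map_chain_id) (use d in \<open>auto simp: in_lists_conv_set f_inv_into_f subset_iff\<close>)
    then show ?thesis using d by (auto simp: rc_map_eq rc_tuples_def intro!: part_id)
  qed
  ultimately show "d \<in> rc_map j ` {c. Poly_Mapping.keys c \<subseteq> rc_tuples Y k}" by (metis (mono_tags) image_eqI mem_Collect_eq)
qed

lemma rc_map_A_image: "rc_map (\<lambda>a. a) ` {c. Poly_Mapping.keys c \<subseteq> rc_tuples A k}
    = {c :: _ \<Rightarrow>\<^sub>0 'r::{comm_ring, comm_monoid_mult}. Poly_Mapping.keys c \<subseteq> rc_tuples X k \<inter> lists (pverts A)}"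
proof -
  have "rc_map (\<lambda>a. a) ` {c :: _ \<Rightarrow>\<^sub>0 'r. Poly_Mapping.keys c \<subseteq> rc_tuples A k}
      = (\<lambda>c. c) ` {c :: _ \<Rightarrow>\<^sub>0 'r. Poly_Mapping.keys c \<subseteq> rc_tuples A k}"
    by (rule image_cong) (simp_all add: rc_map_A[of _ k])
  then show ?thesis by (simp add: rc_tuples_A)
qed

text \<open>Tuples that start outside the reach of \<open>A\<close> stay in \<open>X - A\<close>, so that \<open>g\<close> identifies them with the
  tuples of \<open>P\<close> that start outside the reach of \<open>Y\<close>.\<close>

lemma rc_lift_outside:
  assumes d: "Poly_Mapping.keys d \<subseteq> rc_tuples P k \<inter> {v. hd v \<notin> reach_Y}"
  obtains c where "Poly_Mapping.keys c \<subseteq> rc_tuples X k" "rc_map g c = (d :: _ \<Rightarrow>\<^sub>0 'r::{comm_ring, comm_monoid_mult})"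
proof (rule that)
  let ?h = "inv_into (pverts X - pverts A) g"
  have range: "set v \<subseteq> g ` (pverts X - pverts A)" if "v \<in> rc_tuples P k" "hd v \<notin> reach_Y" for v
  proof
    fix p assume "p \<in> set v"
    then have "p \<notin> j ` pverts Y" "p \<in> pverts P"
      using RY.rc_tuples_split(2)[OF that] that by (auto simp: rc_tuples_def)
    then show "p \<in> g ` (pverts X - pverts A)"
      using pushout_cover[OF pushout] gj f_vert by force
  qed
  have "map_chain g (map_chain ?h d) = d"
    unfolding map_chain_map_chain
    by (rule map_chain_id) (use d range in \<open>fastforce simp: f_inv_into_f subset_iff\<close>)
  then show "rc_map g (map_chain ?h d) = d"
    using d by (auto simp: rc_map_eq rc_tuples_def intro!: part_id)
  show "Poly_Mapping.keys (map_chain ?h d) \<subseteq> rc_tuples X k"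
  proof
    fix w assume "w \<in> Poly_Mapping.keys (map_chain ?h d)"
    then obtain v where "v \<in> Poly_Mapping.keys d" and w: "w = map ?h v"
      using keys_map_chain[of ?h d] by blast
    then have v: "v \<in> rc_tuples P k" "hd v \<notin> reach_Y" "w = map ?h v" using d by auto
    have vw: "v = map g w" using v(3) range[OF v(1,2)] by (auto simp: map_idI f_inv_into_f subset_iff)
    have wX: "set w \<subseteq> pverts X - pverts A"
      using v(3) range[OF v(1,2)] inv_into_into[of _ g "pverts X - pverts A"] by fastforce
    have "successively (has_path X) w"
      by (rule successively_mono[where P = "\<lambda>x y. has_path P (g x) (g y)"])
        (use v(1) vw wX path_g_iff in \<open>auto simp: rc_tuples_def successively_map subset_iff\<close>)
    then show "w \<in> rc_tuples X k"
      using v(1) vw wX by (auto simp: rc_tuples_def dest: distinct_adj_mapD)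
  qed
qed

lemma keys_rc_map_g:
  assumes "Poly_Mapping.keys c \<subseteq> rc_tuples X k"
  shows "Poly_Mapping.keys (rc_map g c) \<subseteq> rc_tuples P k"
  by (rule keys_rc_map_tuples[OF X P g assms])

lemma keys_rc_map_g_reach:
  assumes "Poly_Mapping.keys c \<subseteq> lists (reach_verts A X)"
  shows "Poly_Mapping.keys (rc_map g c) \<subseteq> lists reach_Y"
proof
  fix w assume "w \<in> Poly_Mapping.keys (rc_map g c)"
  then obtain v where v: "set v \<subseteq> reach_verts A X" "w = map g v"
    using keys_rc_map[of g c] assms by (fastforce simp: in_lists_conv_set)
  have "g x \<in> reach_Y" if "x \<in> set v" for x
    using v(1) that g_reach[of x] reach_sub by blast
  then show "w \<in> lists reach_Y" using v(2) by auto
qed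

text \<open>\<open>g\<close> may collapse tuples that meet \<open>A\<close>, so it is not injective
  on all chains. But it is injective on the part of \<open>c\<close> that starts outside the reach,
  and sends it to tuples that start outside \<open>reach_Y\<close>; this part must therefore be
  zero.\<close>

lemma rc_map_g_reach_reflect:
  assumes c: "Poly_Mapping.keys c \<subseteq> rc_tuples X k" and gc: "Poly_Mapping.keys (rc_map g c) \<subseteq> lists reach_Y"
  shows "Poly_Mapping.keys (c :: _ \<Rightarrow>\<^sub>0 'r::{comm_ring, comm_monoid_mult}) \<subseteq> lists (reach_verts A X)"
proof -
  obtain c1 c2 where split: "c = c1 + c2"
    and c1: "Poly_Mapping.keys c1 \<subseteq> rc_tuples X k \<inter> {v. hd v \<notin> reach_verts A X}"
    and c2: "Poly_Mapping.keys c2 \<subseteq> rc_tuples X k \<inter> lists (reach_verts A X)"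
    by (rule RA.rc_chain_split[OF c])
  have "rc_map g c1 = rc_map g c - rc_map g c2" by (simp add: split rc_linear)
  then have 1: "Poly_Mapping.keys (rc_map g c1) \<subseteq> lists reach_Y"
    using gc keys_rc_map_g_reach[of c2] c2 by (simp add: chains_closed(2))
  have "w \<notin> Poly_Mapping.keys (rc_map g c1)" for w
  proof
    assume w: "w \<in> Poly_Mapping.keys (rc_map g c1)"
    then obtain v where v: "v \<in> rc_tuples X k" "hd v \<notin> reach_verts A X" "w = map g v"
      using keys_rc_map[of g c1] c1 by blast
    then have "v \<noteq> []" "hd v \<in> pverts X" by (auto simp: rc_tuples_def)
    then have "hd w \<in> set w" "hd w \<notin> reach_Y" using v g_reach by (auto simp: hd_map)
    then show False using w 1 by (auto simp: in_lists_conv_set)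
  qed
  then have "rc_map g c1 = 0" by (intro poly_mapping_eqI) (simp add: in_keys_iff)
  moreover have "map_chain (inv_into (pverts X - pverts A) g) (rc_map g c1) = c1"
  proof (rule rc_map_inj[OF inj_g], rule subsetI)
    fix v assume "v \<in> Poly_Mapping.keys c1"
    then have v: "v \<in> rc_tuples X k" "hd v \<notin> reach_verts A X" using c1 by auto
    then show "v \<in> lists (pverts X - pverts A) \<inter> nondegenerate"
      using RA.rc_tuples_split(2)[OF v] by (auto simp: rc_tuples_def in_lists_conv_set)
  qed
  ultimately have "c1 = 0" by simp
  then show ?thesis using split c2 by simp
qed

text \<open>The part of \<open>e\<close> that starts outside the reach of \<open>Y\<close> lifts to
  a chain \<open>u\<close> of \<open>X\<close>. Modulo the boundary of \<open>u\<close>, the chain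
  \<open>c\<close> is supported on the reach of \<open>A\<close>, where the retraction shows that
  relative cycles bound modulo \<open>A\<close>.\<close>

lemma rc_relative_injective:
  fixes c :: "_ \<Rightarrow>\<^sub>0 'r::{comm_ring, comm_monoid_mult}"
  assumes c: "Poly_Mapping.keys c \<subseteq> rc_tuples X k"
    and dc: "Poly_Mapping.keys (rc_boundary c) \<subseteq> lists (pverts A)"
    and e: "Poly_Mapping.keys e \<subseteq> rc_tuples P (k + 1)"
    and m: "Poly_Mapping.keys m \<subseteq> rc_tuples P k \<inter> lists (j ` pverts Y)"
    and eq: "rc_map g c = m + rc_boundary e"
  shows "\<exists>n e'. Poly_Mapping.keys n \<subseteq> rc_tuples X k \<inter> lists (pverts A) \<and>
    Poly_Mapping.keys e' \<subseteq> rc_tuples X (k + 1) \<and> c = n + rc_boundary e'"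
proof -
  obtain e1 e2 where split: "e = e1 + e2"
    and e1: "Poly_Mapping.keys e1 \<subseteq> rc_tuples P (k + 1) \<inter> {v. hd v \<notin> reach_Y}"
    and e2: "Poly_Mapping.keys e2 \<subseteq> rc_tuples P (k + 1) \<inter> lists reach_Y"
    by (rule RY.rc_chain_split[OF e])
  obtain u where u: "Poly_Mapping.keys u \<subseteq> rc_tuples X (k + 1)" "rc_map g u = e1"
    by (rule rc_lift_outside[OF e1])
  have du: "Poly_Mapping.keys (rc_boundary u) \<subseteq> rc_tuples X k"
    using keys_rc_boundary_tuples[OF X u(1)] by simp
  \<comment> \<open>The boundary of \<open>c'\<close> is still that of \<open>c\<close>, so it
    remains in \<open>A\<close>, while \<open>g\<close> now sends \<open>c'\<close> to
    \<open>m\<close> plus the boundary of \<open>e2\<close>, a chain on the reach of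
    \<open>Y\<close>.\<close>
  define c' where "c' = c - rc_boundary u"
  have c': "Poly_Mapping.keys c' \<subseteq> rc_tuples X k" using c du by (simp add: c'_def chains_closed(2))
  have "rc_map g (rc_boundary u) = rc_boundary e1"
    using rc_map_boundary_tuples[OF u(1), of g] u(2) by simp
  then have "rc_map g c' = m + rc_boundary e2"
    by (simp add: c'_def rc_linear eq split)
  moreover have "Poly_Mapping.keys (rc_boundary e2) \<subseteq> lists reach_Y"
    using keys_rc_boundary[OF P e2] by simp
  moreover have "Poly_Mapping.keys m \<subseteq> lists reach_Y"
    using m lists_mono[OF RY.B_S] by blast
  ultimately have "Poly_Mapping.keys (rc_map g c') \<subseteq> lists reach_Y"
    by (simp add: chains_closed(1))
  from rc_map_g_reach_reflect[OF c' this] c'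
  have "Poly_Mapping.keys c' \<subseteq> rc_tuples X k \<inter> lists (reach_verts A X)" by simp
  moreover have "Poly_Mapping.keys (rc_boundary c') \<subseteq> lists (pverts A)"
    using dc by (simp add: c'_def rc_linear rc_boundary_boundary)
  ultimately obtain b e' where b: "Poly_Mapping.keys b \<subseteq> rc_tuples X k \<inter> lists (pverts A)"
    and e': "Poly_Mapping.keys e' \<subseteq> rc_tuples X (k + 1) \<inter> lists (reach_verts A X)"
    and ceq: "c' = b + rc_boundary e'"
    by (rule RA.relative_cycle_on_reach)
  have "c = b + rc_boundary (e' + u)" using ceq by (simp add: c'_def rc_linear algebra_simps)
  moreover have "Poly_Mapping.keys (e' + u) \<subseteq> rc_tuples X (k + 1)"
    using e' u by (simp add: chains_closed(1))
  ultimately show ?thesis using b by blast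
qed

text \<open>The part of \<open>d\<close> outside the reach lifts to a chain \<open>u\<close> of
  \<open>X\<close>, but the boundary of \<open>u\<close> is only known to lie on the reach of
  \<open>A\<close>. The retraction is used twice: on the reach of \<open>A\<close> to make the lift
  a relative cycle, and on the reach of \<open>Y\<close> to absorb the resulting error.\<close>

lemma rc_relative_surjective:
  fixes d :: "_ \<Rightarrow>\<^sub>0 'r::{comm_ring, comm_monoid_mult}"
  assumes d: "Poly_Mapping.keys d \<subseteq> rc_tuples P k"
    and dd: "Poly_Mapping.keys (rc_boundary d) \<subseteq> lists (j ` pverts Y)"
  shows "\<exists>c m e. Poly_Mapping.keys c \<subseteq> rc_tuples X k \<and>
    Poly_Mapping.keys (rc_boundary c) \<subseteq> rc_tuples X (k - 1) \<inter> lists (pverts A) \<and>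
    Poly_Mapping.keys m \<subseteq> rc_tuples P k \<inter> lists (j ` pverts Y) \<and>
    Poly_Mapping.keys e \<subseteq> rc_tuples P (k + 1) \<and> d = m + (rc_boundary e + rc_map g c)"
proof -
  obtain d1 d2 where split: "d = d1 + d2"
    and d1: "Poly_Mapping.keys d1 \<subseteq> rc_tuples P k \<inter> {v. hd v \<notin> reach_Y}"
    and d2: "Poly_Mapping.keys d2 \<subseteq> rc_tuples P k \<inter> lists reach_Y"
    by (rule RY.rc_chain_split[OF d])
  obtain u where u: "Poly_Mapping.keys u \<subseteq> rc_tuples X k" "rc_map g u = d1"
    by (rule rc_lift_outside[OF d1])
  have gdu: "rc_map g (rc_boundary u) = rc_boundary d - rc_boundary d2"
    using rc_map_boundary_tuples[OF u(1), of g] u(2) split by (simp add: rc_linear)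
  have "Poly_Mapping.keys (rc_boundary d2) \<subseteq> lists reach_Y"
    using keys_rc_boundary[OF P d2] by simp
  moreover have "Poly_Mapping.keys (rc_boundary d) \<subseteq> lists reach_Y"
    using dd lists_mono[OF RY.B_S] by blast
  ultimately have "Poly_Mapping.keys (rc_map g (rc_boundary u)) \<subseteq> lists reach_Y"
    by (simp add: gdu chains_closed(2))
  from rc_map_g_reach_reflect[OF keys_rc_boundary_tuples[OF X u(1)] this] keys_rc_boundary_tuples[OF X u(1)]
  have "Poly_Mapping.keys (rc_boundary u) \<subseteq> rc_tuples X (k - 1) \<inter> lists (reach_verts A X)" by simp
  moreover have "Poly_Mapping.keys (rc_boundary (rc_boundary u)) \<subseteq> lists (pverts A)"
    by (simp add: rc_boundary_boundary)
  ultimately obtain a e' where a: "Poly_Mapping.keys a \<subseteq> rc_tuples X (k - 1) \<inter> lists (pverts A)"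
    and e': "Poly_Mapping.keys e' \<subseteq> rc_tuples X k \<inter> lists (reach_verts A X)"
    and ueq: "rc_boundary u = a + rc_boundary e'"
    by (rule RA.relative_cycle_on_reach) simp
  \<comment> \<open>The boundary of \<open>u\<close> is a cycle on the reach of \<open>A\<close>,
    hence a chain \<open>a\<close> on \<open>A\<close> plus the boundary of \<open>e'\<close>;
    subtracting \<open>e'\<close> leaves exactly \<open>a\<close>.\<close>
  define c where "c = u - e'"
  have c: "Poly_Mapping.keys c \<subseteq> rc_tuples X k" using u e' by (simp add: c_def chains_closed(2))
  have dc: "rc_boundary c = a" by (simp add: c_def rc_linear ueq)
  \<comment> \<open>The error consists of \<open>d2\<close> and the image of \<open>e'\<close>, both
    on the reach of \<open>Y\<close>, and its boundary lies in \<open>j Y\<close>.\<close>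
  define w where "w = d - rc_map g c"
  have "w = d2 + rc_map g e'" by (simp add: w_def c_def rc_linear u split)
  moreover have "Poly_Mapping.keys (rc_map g e') \<subseteq> rc_tuples P k \<inter> lists reach_Y"
    using keys_rc_map_g[of e' k] keys_rc_map_g_reach[of e'] e' by simp
  ultimately have w: "Poly_Mapping.keys w \<subseteq> rc_tuples P k \<inter> lists reach_Y"
    using d2 by (simp add: chains_closed(1))
  have "rc_boundary w = rc_boundary d - rc_map g a"
    using rc_map_boundary_tuples[OF c, of g] by (simp add: w_def rc_linear flip: dc)
  then have "Poly_Mapping.keys (rc_boundary w) \<subseteq> lists (j ` pverts Y)"
    using dd rc_map_g_A(2)[of a] a by (simp add: chains_closed(2))
  with w obtain m e where m: "Poly_Mapping.keys m \<subseteq> rc_tuples P k \<inter> lists (j ` pverts Y)"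
    and e: "Poly_Mapping.keys e \<subseteq> rc_tuples P (k + 1) \<inter> lists reach_Y" and weq: "w = m + rc_boundary e"
    by (rule RY.relative_cycle_on_reach)
  have "d = m + (rc_boundary e + rc_map g c)" using weq by (simp add: w_def algebra_simps)
  then show ?thesis using c a m e by (intro exI[of _ c] exI[of _ m] exI[of _ e]) (simp add: dc)
qed

lemma incl: "digraph_map A X (\<lambda>a. a)"
  using AX by (auto simp: digraph_map_def)

text \<open>The images of the chains of \<open>A\<close> and \<open>Y\<close> are the chains
  supported on \<open>A\<close> and on \<open>j Y\<close>, which turns the conditions of the square
  into the two results on relative chains.\<close>

lemma excisive_square_RC:
  "excisive_square (RC R A) (RC R X) (RC R Y) (RC R P)
    (\<lambda>k. rc_map (\<lambda>a. a)) (\<lambda>k. rc_map f) (\<lambda>k. rc_map g) (\<lambda>k. rc_map j)"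
proof (rule excisive_square.intro)
  fix k and c :: "'x list \<Rightarrow>\<^sub>0 'a" and e m
  assume "c \<in> carrier (chain_mod (RC R X) k)"
    "chain_diff (RC R X) k c \<in> rc_map (\<lambda>a. a) ` carrier (chain_mod (RC R A) (k - 1))"
    "e \<in> carrier (chain_mod (RC R P) (k + 1))" "m \<in> rc_map j ` carrier (chain_mod (RC R Y) k)"
    "rc_map g c = m + chain_diff (RC R P) (k + 1) e"
  then have "Poly_Mapping.keys c \<subseteq> rc_tuples X k" "Poly_Mapping.keys (rc_boundary c) \<subseteq> lists (pverts A)"
    "Poly_Mapping.keys e \<subseteq> rc_tuples P (k + 1)" "Poly_Mapping.keys m \<subseteq> rc_tuples P k \<inter> lists (j ` pverts Y)"
    "rc_map g c = m + rc_boundary e"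
    by (simp_all add: rc_map_A_image rc_map_j_image)
  from rc_relative_injective[OF this]
  show "\<exists>n \<in> rc_map (\<lambda>a. a) ` carrier (chain_mod (RC R A) k). \<exists>e' \<in> carrier (chain_mod (RC R X) (k + 1)).
      c = n + chain_diff (RC R X) (k + 1) e'"
    unfolding RC_simps free_module_simps rc_map_A_image by blast
next
  fix k and d :: "'p list \<Rightarrow>\<^sub>0 'a"
  assume "d \<in> carrier (chain_mod (RC R P) k)"
    "chain_diff (RC R P) k d \<in> rc_map j ` carrier (chain_mod (RC R Y) (k - 1))"
  then have "Poly_Mapping.keys d \<subseteq> rc_tuples P k" "Poly_Mapping.keys (rc_boundary d) \<subseteq> lists (j ` pverts Y)"
    by (simp_all add: rc_map_j_image)
  from rc_relative_surjective[OF this]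
  show "\<exists>c \<in> carrier (chain_mod (RC R X) k).
      chain_diff (RC R X) k c \<in> rc_map (\<lambda>a. a) ` carrier (chain_mod (RC R A) (k - 1)) \<and>
      (\<exists>m \<in> rc_map j ` carrier (chain_mod (RC R Y) k). \<exists>e \<in> carrier (chain_mod (RC R P) (k + 1)).
        d = m + (chain_diff (RC R P) (k + 1) e + rc_map g c))"
    unfolding RC_simps free_module_simps rc_map_A_image rc_map_j_image by blast
next
  show "y = 0" if "y \<in> carrier (chain_mod (RC R Y) k)" "rc_map j y = 0" for y k
    using that rc_map_j_inj[of y k] by simp
  show "a = 0" if "a \<in> carrier (chain_mod (RC R A) k)" "rc_map (\<lambda>a. a) a = 0" for a k
    using that rc_map_A[of a k] by simp
  show "rc_map g (rc_map (\<lambda>a. a) a) = rc_map j (rc_map f a)" if "a \<in> carrier (chain_mod (RC R A) k)" for a k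
    using that rc_map_commutes[of a k] by simp
qed (intro additive_complex_RC chain_map_RC AX X Y P incl f g j)+

lemma excision:
  "RH_rel_map R P (image_graph j Y) g k
    \<in> module_iso (RH_rel R X A k) (RH_rel R P (image_graph j Y) k)"
proof -
  interpret excisive_square "RC R A" "RC R X" "RC R Y" "RC R P"
    "\<lambda>k. rc_map (\<lambda>a. a)" "\<lambda>k. rc_map f" "\<lambda>k. rc_map g" "\<lambda>k. rc_map j"
    by (rule excisive_square_RC)
  \<comment> \<open>The subcomplexes factored out are rewritten as images of chain maps, the form in
    which the square states its assumptions; excision then rests on the same two facts as the exact
    sequence.\<close>
  have subA: "RC_sub R A k = rc_map (\<lambda>a. a) ` carrier (chain_mod (RC R A) k)" for k
    unfolding RC_sub_def RC_simps free_module_simps rc_map_A_image by (simp add: rc_tuples_A)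
  have subY: "RC_sub R (image_graph j Y) k = rc_map j ` carrier (chain_mod (RC R Y) k)" for k
    unfolding RC_sub_def RC_simps free_module_simps rc_map_j_image by (simp add: rc_tuples_Y)
  have "subcomplex (RC_sub R A) (RC R X)"
    unfolding subcomplex_def RC_sub_def RC_simps free_module_simps rc_tuples_A
    by (intro allI conjI scaled_subgroup_free_module Int_lower1 image_subsetI CollectI keys_rc_boundary[OF X])
      (erule CollectD)
  moreover have "subcomplex (RC_sub R (image_graph j Y)) (RC R P)"
    unfolding subcomplex_def RC_sub_def RC_simps free_module_simps rc_tuples_Y
    by (intro allI conjI scaled_subgroup_free_module Int_lower1 image_subsetI CollectI keys_rc_boundary[OF P])
      (erule CollectD)
  moreover have "rc_map g ` RC_sub R A k \<subseteq> RC_sub R (image_graph j Y) k" for k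
    unfolding RC_sub_def RC_simps free_module_simps rc_tuples_A rc_tuples_Y
    by (intro image_subsetI CollectI Int_greatest keys_rc_map_g rc_map_g_A(2)) simp_all
  ultimately show ?thesis
    unfolding RH_rel_map_def RH_rel_def RC_rel_def
    by (rule quot_homology_map_iso[OF scaled(2) _ scaled(4) _ maps(3)])
      (unfold subA subY ops, (rule rel_inj; assumption), (rule rel_surj; assumption))
qed

end

theorem theorem6p4:
  fixes R :: "'r::{comm_ring, comm_monoid_mult} itself"
    and A X :: "'x pair_pre_digraph" and Y :: "'y pair_pre_digraph" and P :: "'p pair_pre_digraph"
    and i :: "'x \<Rightarrow> 'x" and f :: "'x \<Rightarrow> 'y" and g :: "'x \<Rightarrow> 'p" and j :: "'y \<Rightarrow> 'p"
  assumes X: "pair_wf_digraph X" and Y: "pair_wf_digraph Y"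
    and i: "long_cofibration A X" "i = (\<lambda>a. a)"
    and f: "digraph_map A Y f"
    and P: "is_pushout A X Y i f P g j"
  shows
    "(\<forall>k. RH_rel_map R P (image_graph j Y) g k
        \<in> module_iso (RH_rel R X A k) (RH_rel R P (image_graph j Y) k)) \<and>
     (let \<alpha> = (\<lambda>k a. (\<ominus>\<^bsub>RH R X k\<^esub> RH_map R X i k a, RH_map R Y f k a));
          \<beta> = (\<lambda>k (x, y). RH_map R P g k x \<oplus>\<^bsub>RH R P k\<^esub> RH_map R P j k y);
          XY = (\<lambda>k. module_prod (RH R X k) (RH R Y k))
      in \<exists>\<delta>. \<forall>k.
           exact_at (RH R A k) (\<alpha> k) (XY k) (\<beta> k) (RH R P k) \<and>
           exact_at (XY k) (\<beta> k) (RH R P k) (\<delta> k) (RH R A (k - 1)) \<and>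
           exact_at (RH R P k) (\<delta> k) (RH R A (k - 1)) (\<alpha> (k - 1)) (XY (k - 1)))"
proof -
  interpret cofibration_pushout A X Y P f g j
    by (rule cofibration_pushout.intro) (use assms in simp_all)
  interpret excisive_square "RC R A" "RC R X" "RC R Y" "RC R P"
    "\<lambda>k. rc_map (\<lambda>a. a)" "\<lambda>k. rc_map f" "\<lambda>k. rc_map g" "\<lambda>k. rc_map j"
    by (rule excisive_square_RC)
  have \<alpha>: "(\<lambda>a. (\<ominus>\<^bsub>RH R X k\<^esub> RH_map R X i k a, RH_map R Y f k a)) = to_sum k" for k
    by (simp add: fun_eq_iff to_sum_def RH_def RH_map_def i(2))
  have \<beta>: "(\<lambda>(x, y). RH_map R P g k x \<oplus>\<^bsub>RH R P k\<^esub> RH_map R P j k y) = from_sum k" for k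
    by (simp add: fun_eq_iff from_sum_def RH_def RH_map_def)
  show ?thesis
    unfolding Let_def \<alpha> \<beta>
    unfolding RH_def
    using excision exact_at_sum exact_at_total exact_at_intersection by (intro conjI allI exI[of _ connecting_map])
qed

end
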